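(* Let $d\ge2$, let $\mathcal{E}$ be a weakly idempotent complete exact category, and let $\mathcal{M}$ be a $d$-cluster tilting subcategory of $\mathcal{E}$. For positive integers $m,n$ with $m+n=d$ put $$\mathcal{E}_{m,n}=\{E\in\mathcal{E}\mid\operatorname{Ext}^i_{\mathcal{E}}(E,\mathcal{M})=0=\operatorname{Ext}^j_{\mathcal{E}}(\mathcal{M},E)\text{ for all }0<i<m\text{ and }0<j<n\}.$$ Then for any $E\in\mathcal{E}$ there exists $M\in\mathcal{M}$ such that $$E\oplus M\in\operatorname{Filt}\Big(\bigcup_{\substack{m,n>0\\ m+n=d}}\mathcal{E}_{m,n}\Big).$$
   Context: Conventions: all categories are additive; subcategories are full, closed under isomorphisms and finite direct sums. An additive category is weakly idempotent complete if every split epimorphism has a kernel. Exact categories are in the sense of Quillen, with conflations, inflations and deflations. $\operatorname{Ext}$ denotes Yoneda Ext. A subcategory $\mathcal{M}$ of an exact category $\mathcal{E}$ is $d$-cluster tilting if it is generating (every $E\in\mathcal{E}$ admits a deflation $M\to E$ with $M\in\mathcal{M}$), cogenerating (every $E$ admits an inflation $E\to M$ with $M\in\mathcal{M}$), functorially finite, and $\mathcal{M}=\{E\in\mathcal{E}\mid\operatorname{Ext}^i_{\mathcal{E}}(E,\mathcal{M})=0,\ 0<i<d\}=\{E\in\mathcal{E}\mid\operatorname{Ext}^i_{\mathcal{E}}(\mathcal{M},E)=0,\ 0<i<d\}$. For a class $\mathcal{S}$ of objects of $\mathcal{E}$, $\operatorname{Filt}(\mathcal{S})$ is the subcategory of objects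 $E$ for which there is a sequence of inflations $0=E^0\to E^1\to\cdots\to E^{k}\to E^{k+1}=E$ such that the cokernel of $E^i\to E^{i+1}$ is in $\mathcal{S}$ for all $0\le i\le k$. *)

theory Defs
  imports "HOL-Algebra.Group"
begin

section \<open>Additive categories\<close>

text \<open>
  A category has a set of objects, a set of arrows, and source and target maps; \<open>g \<cdot> f\<close> is
  ``\<open>g\<close> after \<open>f\<close>'' and is meaningful only when the target of \<open>f\<close> is the source of \<open>g\<close>.
  Likewise \<open>add_arr\<close> is meaningful only on parallel arrows.
\<close>

record ('o, 'm) add_cat =
  obj :: "'o set"
  arr :: "'m set"
  src :: "'m \<Rightarrow> 'o"
  tgt :: "'m \<Rightarrow> 'o"
  ident :: "'o \<Rightarrow> 'm"
  comp_arr :: "'m \<Rightarrow> 'm \<Rightarrow> 'm" (infixl "\<cdot>\<index>" 70)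
  add_arr :: "'m \<Rightarrow> 'm \<Rightarrow> 'm"
  zero_arr :: "'o \<Rightarrow> 'o \<Rightarrow> 'm"

definition Hom :: "('o, 'm, 'x) add_cat_scheme \<Rightarrow> 'o \<Rightarrow> 'o \<Rightarrow> 'm set" where
  "Hom C A B = {f \<in> arr C. src C f = A \<and> tgt C f = B}"

definition hom_group :: "('o, 'm, 'x) add_cat_scheme \<Rightarrow> 'o \<Rightarrow> 'o \<Rightarrow> 'm monoid" where
  "hom_group C A B = \<lparr>carrier = Hom C A B, mult = add_arr C, one = zero_arr C A B\<rparr>"

definition is_zero_object :: "('o, 'm, 'x) add_cat_scheme \<Rightarrow> 'o \<Rightarrow> bool" where
  "is_zero_object C Z \<longleftrightarrow> Z \<in> obj C \<and>
     (\<forall>A \<in> obj C. (\<exists>!f. f \<in> Hom C A Z) \<and> (\<exists>!f. f \<in> Hom C Z A))"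

definition is_direct_sum :: "('o, 'm, 'x) add_cat_scheme \<Rightarrow> 'o \<Rightarrow> 'o \<Rightarrow> 'o \<Rightarrow> bool" where
  "is_direct_sum C A B S \<longleftrightarrow> A \<in> obj C \<and> B \<in> obj C \<and> S \<in> obj C \<and>
     (\<exists>i\<^sub>1 \<in> Hom C A S. \<exists>i\<^sub>2 \<in> Hom C B S. \<exists>p\<^sub>1 \<in> Hom C S A. \<exists>p\<^sub>2 \<in> Hom C S B.
        p\<^sub>1 \<cdot>\<^bsub>C\<^esub> i\<^sub>1 = ident C A \<and> p\<^sub>2 \<cdot>\<^bsub>C\<^esub> i\<^sub>2 = ident C B \<and>
        p\<^sub>1 \<cdot>\<^bsub>C\<^esub> i\<^sub>2 = zero_arr C B A \<and> p\<^sub>2 \<cdot>\<^bsub>C\<^esub> i\<^sub>1 = zero_arr C A B \<and>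
        add_arr C (i\<^sub>1 \<cdot>\<^bsub>C\<^esub> p\<^sub>1) (i\<^sub>2 \<cdot>\<^bsub>C\<^esub> p\<^sub>2) = ident C S)"

locale additive_category =
  fixes C :: "('o, 'm, 'x) add_cat_scheme" (structure)
  assumes src_obj: "f \<in> arr C \<Longrightarrow> src C f \<in> obj C"
    and tgt_obj: "f \<in> arr C \<Longrightarrow> tgt C f \<in> obj C"
    and ident_Hom: "A \<in> obj C \<Longrightarrow> ident C A \<in> Hom C A A"
    and comp_Hom: "\<lbrakk>f \<in> Hom C A B; g \<in> Hom C B D\<rbrakk> \<Longrightarrow> g \<cdot> f \<in> Hom C A D"
    and ident_left: "f \<in> Hom C A B \<Longrightarrow> ident C B \<cdot> f = f"
    and ident_right: "f \<in> Hom C A B \<Longrightarrow> f \<cdot> ident C A = f"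
    and comp_assoc: "\<lbrakk>f \<in> Hom C A B; g \<in> Hom C B D; h \<in> Hom C D E\<rbrakk>
          \<Longrightarrow> h \<cdot> g \<cdot> f = h \<cdot> (g \<cdot> f)"
    and hom_comm_group: "\<lbrakk>A \<in> obj C; B \<in> obj C\<rbrakk> \<Longrightarrow> comm_group (hom_group C A B)"
    and comp_add_left: "\<lbrakk>f \<in> Hom C A B; f' \<in> Hom C A B; g \<in> Hom C B D\<rbrakk>
          \<Longrightarrow> g \<cdot> add_arr C f f' = add_arr C (g \<cdot> f) (g \<cdot> f')"
    and comp_add_right: "\<lbrakk>f \<in> Hom C A B; g \<in> Hom C B D; g' \<in> Hom C B D\<rbrakk>
          \<Longrightarrow> add_arr C g g' \<cdot> f = add_arr C (g \<cdot> f) (g' \<cdot> f)"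
    and zero_object_exists: "\<exists>Z. is_zero_object C Z"
    and direct_sum_exists: "\<lbrakk>A \<in> obj C; B \<in> obj C\<rbrakk> \<Longrightarrow> \<exists>S. is_direct_sum C A B S"

definition is_iso :: "('o, 'm, 'x) add_cat_scheme \<Rightarrow> 'm \<Rightarrow> bool" where
  "is_iso C f \<longleftrightarrow> f \<in> arr C \<and>
     (\<exists>g \<in> Hom C (tgt C f) (src C f).
        g \<cdot>\<^bsub>C\<^esub> f = ident C (src C f) \<and> f \<cdot>\<^bsub>C\<^esub> g = ident C (tgt C f))"

definition is_kernel :: "('o, 'm, 'x) add_cat_scheme \<Rightarrow> 'm \<Rightarrow> 'm \<Rightarrow> bool" where
  "is_kernel C k f \<longleftrightarrow> k \<in> arr C \<and> f \<in> arr C \<and> tgt C k = src C f \<and>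
     f \<cdot>\<^bsub>C\<^esub> k = zero_arr C (src C k) (tgt C f) \<and>
     (\<forall>h \<in> arr C. tgt C h = src C f \<and> f \<cdot>\<^bsub>C\<^esub> h = zero_arr C (src C h) (tgt C f) \<longrightarrow>
        (\<exists>!u. u \<in> Hom C (src C h) (src C k) \<and> k \<cdot>\<^bsub>C\<^esub> u = h))"

definition is_cokernel :: "('o, 'm, 'x) add_cat_scheme \<Rightarrow> 'm \<Rightarrow> 'm \<Rightarrow> bool" where
  "is_cokernel C c f \<longleftrightarrow> c \<in> arr C \<and> f \<in> arr C \<and> src C c = tgt C f \<and>
     c \<cdot>\<^bsub>C\<^esub> f = zero_arr C (src C f) (tgt C c) \<and>
     (\<forall>h \<in> arr C. src C h = tgt C f \<and> h \<cdot>\<^bsub>C\<^esub> f = zero_arr C (src C f) (tgt C h) \<longrightarrow>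
        (\<exists>!u. u \<in> Hom C (tgt C c) (tgt C h) \<and> u \<cdot>\<^bsub>C\<^esub> c = h))"

definition weakly_idempotent_complete :: "('o, 'm, 'x) add_cat_scheme \<Rightarrow> bool" where
  "weakly_idempotent_complete C \<longleftrightarrow>
     (\<forall>f \<in> arr C. (\<exists>s \<in> Hom C (tgt C f) (src C f). f \<cdot>\<^bsub>C\<^esub> s = ident C (tgt C f)) \<longrightarrow>
        (\<exists>k. is_kernel C k f))"

text \<open>\<open>f : A \<rightarrow> B\<close>, \<open>a : A \<rightarrow> A'\<close>, and the pushout is \<open>f' : A' \<rightarrow> B' \<leftarrow> B : b\<close>.\<close>

definition is_pushout :: "('o, 'm, 'x) add_cat_scheme \<Rightarrow> 'm \<Rightarrow> 'm \<Rightarrow> 'm \<Rightarrow> 'm \<Rightarrow> bool" where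
  "is_pushout C f a f' b \<longleftrightarrow>
     f \<in> arr C \<and> a \<in> arr C \<and> f' \<in> arr C \<and> b \<in> arr C \<and>
     src C f = src C a \<and> tgt C a = src C f' \<and> tgt C f = src C b \<and> tgt C f' = tgt C b \<and>
     f' \<cdot>\<^bsub>C\<^esub> a = b \<cdot>\<^bsub>C\<^esub> f \<and>
     (\<forall>x \<in> arr C. \<forall>y \<in> arr C.
        src C x = tgt C a \<and> src C y = tgt C f \<and> tgt C x = tgt C y \<and> x \<cdot>\<^bsub>C\<^esub> a = y \<cdot>\<^bsub>C\<^esub> f \<longrightarrow>
        (\<exists>!u. u \<in> Hom C (tgt C b) (tgt C x) \<and> u \<cdot>\<^bsub>C\<^esub> f' = x \<and> u \<cdot>\<^bsub>C\<^esub> b = y))"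

text \<open>\<open>g : B \<rightarrow> D\<close>, \<open>a : D' \<rightarrow> D\<close>, and the pullback is \<open>g' : B' \<rightarrow> D'\<close>, \<open>b : B' \<rightarrow> B\<close>.\<close>

definition is_pullback :: "('o, 'm, 'x) add_cat_scheme \<Rightarrow> 'm \<Rightarrow> 'm \<Rightarrow> 'm \<Rightarrow> 'm \<Rightarrow> bool" where
  "is_pullback C g a g' b \<longleftrightarrow>
     g \<in> arr C \<and> a \<in> arr C \<and> g' \<in> arr C \<and> b \<in> arr C \<and>
     tgt C g = tgt C a \<and> src C a = tgt C g' \<and> src C g = tgt C b \<and> src C g' = src C b \<and>
     a \<cdot>\<^bsub>C\<^esub> g' = g \<cdot>\<^bsub>C\<^esub> b \<and>
     (\<forall>x \<in> arr C. \<forall>y \<in> arr C.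
        tgt C x = src C a \<and> tgt C y = src C g \<and> src C x = src C y \<and> a \<cdot>\<^bsub>C\<^esub> x = g \<cdot>\<^bsub>C\<^esub> y \<longrightarrow>
        (\<exists>!u. u \<in> Hom C (src C x) (src C b) \<and> g' \<cdot>\<^bsub>C\<^esub> u = x \<and> b \<cdot>\<^bsub>C\<^esub> u = y))"


section \<open>Exact categories\<close>

record ('o, 'm) exact_cat = "('o, 'm) add_cat" +
  conflations :: "('m \<times> 'm) set"

definition inflation :: "('o, 'm, 'x) exact_cat_scheme \<Rightarrow> 'm \<Rightarrow> bool" where
  "inflation C f \<longleftrightarrow> (\<exists>g. (f, g) \<in> conflations C)"

definition deflation :: "('o, 'm, 'x) exact_cat_scheme \<Rightarrow> 'm \<Rightarrow> bool" where
  "deflation C g \<longleftrightarrow> (\<exists>f. (f, g) \<in> conflations C)"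

text \<open>
  Quillen's axioms in the self-dual form of Keller and Buehler; Quillen's remaining
  (``obscure'') axiom follows from these.
\<close>

locale exact_category = additive_category C
  for C :: "('o, 'm, 'x) exact_cat_scheme" (structure) +
  assumes conflation_kernel: "(f, g) \<in> conflations C \<Longrightarrow> is_kernel C f g"
    and conflation_cokernel: "(f, g) \<in> conflations C \<Longrightarrow> is_cokernel C g f"
    and conflation_iso:
      "\<lbrakk>(f, g) \<in> conflations C; f' \<in> arr C; g' \<in> arr C; tgt C f' = src C g';
        is_iso C a; is_iso C b; is_iso C c;
        a \<in> Hom C (src C f) (src C f'); b \<in> Hom C (tgt C f) (tgt C f');
        c \<in> Hom C (tgt C g) (tgt C g');
        b \<cdot> f = f' \<cdot> a; c \<cdot> g = g' \<cdot> b\<rbrakk> \<Longrightarrow> (f', g') \<in> conflations C"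
    and ident_inflation: "A \<in> obj C \<Longrightarrow> inflation C (ident C A)"
    and ident_deflation: "A \<in> obj C \<Longrightarrow> deflation C (ident C A)"
    and inflation_comp: "\<lbrakk>inflation C f; inflation C g; tgt C f = src C g\<rbrakk> \<Longrightarrow> inflation C (g \<cdot> f)"
    and deflation_comp: "\<lbrakk>deflation C f; deflation C g; tgt C f = src C g\<rbrakk> \<Longrightarrow> deflation C (g \<cdot> f)"
    and inflation_pushout: "\<lbrakk>inflation C f; a \<in> arr C; src C a = src C f\<rbrakk>
          \<Longrightarrow> \<exists>f' b. is_pushout C f a f' b \<and> inflation C f'"
    and deflation_pullback: "\<lbrakk>deflation C g; a \<in> arr C; tgt C a = tgt C g\<rbrakk>
          \<Longrightarrow> \<exists>g' b. is_pullback C g a g' b \<and> deflation C g'"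


section \<open>Yoneda Ext\<close>

text \<open>
  For \<open>n > 0\<close>, an \<open>n\<close>-extension
  \<open>0 \<rightarrow> B \<rightarrow> E\<^sub>0 \<rightarrow> \<dots> \<rightarrow> E\<^sub>n\<^sub>-\<^sub>1 \<rightarrow> A \<rightarrow> 0\<close> of \<open>A\<close> by \<open>B\<close> is stored as the list of the
  conflations \<open>K\<^sub>i \<rightarrow> E\<^sub>i \<rightarrow> K\<^sub>i\<^sub>+\<^sub>1\<close> (\<open>i < n\<close>, \<open>K\<^sub>0 = B\<close>, \<open>K\<^sub>n = A\<close>) from which it is spliced
  together.
\<close>

definition extensions ::
  "('o, 'm, 'x) exact_cat_scheme \<Rightarrow> nat \<Rightarrow> 'o \<Rightarrow> 'o \<Rightarrow> ('m \<times> 'm) list set" where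
  "extensions C n A B = {xs. n > 0 \<and> length xs = n \<and> set xs \<subseteq> conflations C \<and>
     src C (fst (xs ! 0)) = B \<and> tgt C (snd (xs ! (n - 1))) = A \<and>
     (\<forall>i. Suc i < n \<longrightarrow> tgt C (snd (xs ! i)) = src C (fst (xs ! Suc i)))}"

text \<open>
  Pairs of \<open>n\<close>-extensions \<open>(xs, ys)\<close> admitting a morphism \<open>xs \<rightarrow> ys\<close> that is the identity on
  \<open>A\<close> and \<open>B\<close>, with components \<open>u i : E\<^sub>i \<rightarrow> E'\<^sub>i\<close> and \<open>k i : K\<^sub>i \<rightarrow> K'\<^sub>i\<close>.
\<close>

definition extension_morphisms ::
  "('o, 'm, 'x) exact_cat_scheme \<Rightarrow> nat \<Rightarrow> 'o \<Rightarrow> 'o \<Rightarrow> (('m \<times> 'm) list \<times> ('m \<times> 'm) list) set" where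
  "extension_morphisms C n A B = {(xs, ys).
     xs \<in> extensions C n A B \<and> ys \<in> extensions C n A B \<and>
     (\<exists>u k. k 0 = ident C B \<and> k n = ident C A \<and>
        (\<forall>i<n. let (f, g) = xs ! i; (f', g') = ys ! i in
           k i \<in> Hom C (src C f) (src C f') \<and>
           u i \<in> Hom C (tgt C f) (tgt C f') \<and>
           k (Suc i) \<in> Hom C (tgt C g) (tgt C g') \<and>
           u i \<cdot>\<^bsub>C\<^esub> f = f' \<cdot>\<^bsub>C\<^esub> k i \<and>
           k (Suc i) \<cdot>\<^bsub>C\<^esub> g = g' \<cdot>\<^bsub>C\<^esub> u i))}"

definition yoneda_equiv ::
  "('o, 'm, 'x) exact_cat_scheme \<Rightarrow> nat \<Rightarrow> 'o \<Rightarrow> 'o \<Rightarrow> (('m \<times> 'm) list \<times> ('m \<times> 'm) list) set" where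
  "yoneda_equiv C n A B = (extension_morphisms C n A B \<union> (extension_morphisms C n A B)\<inverse>)\<^sup>*"

text \<open>The underlying set of \<open>Ext\<^sup>n(A, B)\<close>; used for \<open>n > 0\<close> only.\<close>

definition Ext ::
  "('o, 'm, 'x) exact_cat_scheme \<Rightarrow> nat \<Rightarrow> 'o \<Rightarrow> 'o \<Rightarrow> ('m \<times> 'm) list set set" where
  "Ext C n A B = extensions C n A B // yoneda_equiv C n A B"

text \<open>
  \<open>Ext\<^sup>n(A, B) = 0\<close>. A group is zero precisely when its underlying set has exactly one element,
  so the Baer sum is not needed to express this.
\<close>

definition Ext_vanishes :: "('o, 'm, 'x) exact_cat_scheme \<Rightarrow> nat \<Rightarrow> 'o \<Rightarrow> 'o \<Rightarrow> bool" where
  "Ext_vanishes C n A B \<longleftrightarrow> is_singleton (Ext C n A B)"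


section \<open>Cluster tilting subcategories and filtrations\<close>

text \<open>Full subcategories are given by their sets of objects.\<close>

definition subcategory :: "('o, 'm, 'x) add_cat_scheme \<Rightarrow> 'o set \<Rightarrow> bool" where
  "subcategory C M \<longleftrightarrow> M \<subseteq> obj C \<and>
     (\<forall>f. is_iso C f \<and> src C f \<in> M \<longrightarrow> tgt C f \<in> M) \<and>
     (\<forall>Z. is_zero_object C Z \<longrightarrow> Z \<in> M) \<and>
     (\<forall>A \<in> M. \<forall>B \<in> M. \<forall>S. is_direct_sum C A B S \<longrightarrow> S \<in> M)"

definition generating :: "('o, 'm, 'x) exact_cat_scheme \<Rightarrow> 'o set \<Rightarrow> bool" where
  "generating C M \<longleftrightarrow> (\<forall>E \<in> obj C. \<exists>p. deflation C p \<and> src C p \<in> M \<and> tgt C p = E)"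

definition cogenerating :: "('o, 'm, 'x) exact_cat_scheme \<Rightarrow> 'o set \<Rightarrow> bool" where
  "cogenerating C M \<longleftrightarrow> (\<forall>E \<in> obj C. \<exists>i. inflation C i \<and> src C i = E \<and> tgt C i \<in> M)"

definition contravariantly_finite :: "('o, 'm, 'x) add_cat_scheme \<Rightarrow> 'o set \<Rightarrow> bool" where
  "contravariantly_finite C M \<longleftrightarrow>
     (\<forall>E \<in> obj C. \<exists>X \<in> M. \<exists>f \<in> Hom C X E.
        \<forall>Y \<in> M. \<forall>g \<in> Hom C Y E. \<exists>h \<in> Hom C Y X. f \<cdot>\<^bsub>C\<^esub> h = g)"

definition covariantly_finite :: "('o, 'm, 'x) add_cat_scheme \<Rightarrow> 'o set \<Rightarrow> bool" where
  "covariantly_finite C M \<longleftrightarrow>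
     (\<forall>E \<in> obj C. \<exists>X \<in> M. \<exists>f \<in> Hom C E X.
        \<forall>Y \<in> M. \<forall>g \<in> Hom C E Y. \<exists>h \<in> Hom C X Y. h \<cdot>\<^bsub>C\<^esub> f = g)"

definition functorially_finite :: "('o, 'm, 'x) add_cat_scheme \<Rightarrow> 'o set \<Rightarrow> bool" where
  "functorially_finite C M \<longleftrightarrow> contravariantly_finite C M \<and> covariantly_finite C M"

definition cluster_tilting :: "('o, 'm, 'x) exact_cat_scheme \<Rightarrow> nat \<Rightarrow> 'o set \<Rightarrow> bool" where
  "cluster_tilting C d M \<longleftrightarrow>
     subcategory C M \<and> generating C M \<and> cogenerating C M \<and> functorially_finite C M \<and>
     M = {E \<in> obj C. \<forall>i. 0 < i \<and> i < d \<longrightarrow> (\<forall>X \<in> M. Ext_vanishes C i E X)} \<and>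
     M = {E \<in> obj C. \<forall>i. 0 < i \<and> i < d \<longrightarrow> (\<forall>X \<in> M. Ext_vanishes C i X E)}"

definition Ext_perp ::
  "('o, 'm, 'x) exact_cat_scheme \<Rightarrow> 'o set \<Rightarrow> nat \<Rightarrow> nat \<Rightarrow> 'o set" where
  "Ext_perp C M m n = {E \<in> obj C.
     (\<forall>i. 0 < i \<and> i < m \<longrightarrow> (\<forall>X \<in> M. Ext_vanishes C i E X)) \<and>
     (\<forall>j. 0 < j \<and> j < n \<longrightarrow> (\<forall>X \<in> M. Ext_vanishes C j X E))}"

definition Filt :: "('o, 'm, 'x) exact_cat_scheme \<Rightarrow> 'o set \<Rightarrow> 'o set" where
  "Filt C S = {E \<in> obj C. \<exists>(k::nat) X f. is_zero_object C (X 0) \<and> X (Suc k) = E \<and>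
     (\<forall>i\<le>k. f i \<in> Hom C (X i) (X (Suc i)) \<and> inflation C (f i) \<and>
        (\<exists>c. is_cokernel C c (f i) \<and> tgt C c \<in> S))}"

end

theory Submission
  imports Defs
begin

text \<open>
  Kernels of right \<open>\<M>\<close>-approximations gain a vanishing \<open>Ext\<close> group at each step, so every \<open>E\<close>
  has an \<open>\<M>\<close>-resolution \<open>0 \<rightarrow> M\<^sub>k \<rightarrow> \<dots> \<rightarrow> M\<^sub>0 \<rightarrow> E \<rightarrow> 0\<close> with \<open>k < d\<close>. Continue \<open>M\<^sub>k \<rightarrow> M\<^sub>k\<^sub>-\<^sub>1\<close> by left
  approximations instead; the last cokernel lies in \<open>\<E>\<^bsub>k,d-k\<^esub>\<close> and, after adding a summand from \<open>\<M>\<close>,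
  gives a conflation \<open>W \<rightarrow> Z \<rightarrow> E\<close> with \<open>Z \<in> \<E>\<^bsub>k,d-k\<^esub>\<close> whose kernel \<open>W\<close> has a resolution of length \<open>k - 2\<close>
  (the mapping cone of the comparison with the given resolution). Rotate it: for an inflation
  \<open>Z \<rightarrow> N\<close> with \<open>N \<in> \<M>\<close>, the pushout is a conflation \<open>Z \<rightarrow> N \<oplus> E \<rightarrow> N/W\<close>, and \<open>N/W\<close> has a
  resolution of length \<open>k - 1\<close>, so induction on \<open>k\<close> applies.

  There need be no projectives or injectives, so \<open>Ext\<close> is handled through Yoneda extensions: an
  \<open>n\<close>-extension of \<open>A\<close> by \<open>B\<close> is equivalent to the trivial one if and only if it maps, by the
  identity on \<open>B\<close>, to an \<open>n\<close>-extension of the zero object.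
\<close>

section \<open>Additive categories\<close>

text \<open>A filtration builds an object up from subobjects, but
  \<open>W \<rightarrow> Z \<rightarrow> E\<close> presents \<open>E\<close> as a quotient. The
  rotation makes \<open>Z\<close> a subobject at the cost of the summand \<open>N\<close>, which is
  where the object of \<M> in the theorem comes from. The induction closes because
  \<open>N/W\<close> has one more term in its resolution than \<open>W\<close>, hence one fewer than
  \<open>E\<close>. Functorial finiteness gives approximations that need not be inflations or
  deflations. A left approximation is repaired by adding an inflation into \<M> as a second
  component; right approximations follow in the opposite category, which supplies the other dual
  statements as well. For Ext the obstacle is that Yoneda equivalence is a zigzag, and that two
  morphisms of extensions agreeing on one end agree on the other only up to homotopy. Nullity passes
  against a morphism by composition alone; passing along it takes an enlargement of the target that
  absorbs the homotopy. After that, three exactness statements from the long Ext sequence and their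
  duals suffice.\<close>

definition neg_arr :: "('o, 'm, 'x) add_cat_scheme \<Rightarrow> 'm \<Rightarrow> 'm" where
  "neg_arr C f = inv\<^bsub>hom_group C (src C f) (tgt C f)\<^esub> f"

lemma mem_Hom: "f \<in> Hom C A B \<longleftrightarrow> f \<in> arr C \<and> src C f = A \<and> tgt C f = B"
  by (simp add: Hom_def)

context additive_category
begin

lemma obj_arr [simp]: "f \<in> arr C \<Longrightarrow> src C f \<in> obj C" "f \<in> arr C \<Longrightarrow> tgt C f \<in> obj C"
  by (simp_all add: src_obj tgt_obj)

lemma Hom_obj: "f \<in> Hom C A B \<Longrightarrow> A \<in> obj C" "f \<in> Hom C A B \<Longrightarrow> B \<in> obj C"
  by (auto simp: mem_Hom)

lemma ident_simps [simp]:
  assumes "A \<in> obj C"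
  shows "ident C A \<in> arr C" "src C (ident C A) = A" "tgt C (ident C A) = A"
  using ident_Hom[OF assms] by (simp_all add: mem_Hom)

lemma comp_simps [simp]:
  assumes "f \<in> arr C" "g \<in> arr C" "tgt C f = src C g"
  shows "g \<cdot> f \<in> arr C" "src C (g \<cdot> f) = src C f" "tgt C (g \<cdot> f) = tgt C g"
  using comp_Hom[of f "src C f" "tgt C f" g "tgt C g"] assms by (simp_all add: mem_Hom)

lemma comp_assoc' [simp]:
  "\<lbrakk>f \<in> arr C; g \<in> arr C; h \<in> arr C; tgt C f = src C g; tgt C g = src C h\<rbrakk>
    \<Longrightarrow> h \<cdot> g \<cdot> f = h \<cdot> (g \<cdot> f)"
  using comp_assoc[of f "src C f" "tgt C f" g "tgt C g" h "tgt C h"] by (simp add: mem_Hom)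

lemma ident_comp [simp]:
  "\<lbrakk>f \<in> arr C; tgt C f = A\<rbrakk> \<Longrightarrow> ident C A \<cdot> f = f"
  "\<lbrakk>f \<in> arr C; src C f = A\<rbrakk> \<Longrightarrow> f \<cdot> ident C A = f"
  using ident_left[of f "src C f" "tgt C f"] ident_right[of f "src C f" "tgt C f"]
  by (auto simp: mem_Hom)

text \<open>The simplifier associates composites to the right, which hides
  \<open>g \<cdot> f\<close> inside \<open>g \<cdot> (f \<cdot> x)\<close>. Instantiated with an
  equation for \<open>g \<cdot> f\<close>, this rewrites the hidden occurrence.\<close>

lemma comp_reassoc:
  "\<lbrakk>g \<cdot> f = r; f \<in> arr C; g \<in> arr C; tgt C f = src C g; x \<in> arr C; tgt C x = src C f\<rbrakk>
    \<Longrightarrow> g \<cdot> (f \<cdot> x) = r \<cdot> x"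
  by (metis comp_assoc')

lemma zero_simps [simp]:
  assumes "A \<in> obj C" "B \<in> obj C"
  shows "zero_arr C A B \<in> arr C" "src C (zero_arr C A B) = A" "tgt C (zero_arr C A B) = B"
proof -
  interpret comm_group "hom_group C A B" using assms by (rule hom_comm_group)
  from one_closed show "zero_arr C A B \<in> arr C" "src C (zero_arr C A B) = A"
    "tgt C (zero_arr C A B) = B"
    by (simp_all add: hom_group_def mem_Hom)
qed

lemma add_simps [simp]:
  assumes "f \<in> arr C" "g \<in> arr C" "src C f = src C g" "tgt C f = tgt C g"
  shows "add_arr C f g \<in> arr C" "src C (add_arr C f g) = src C g"
    "tgt C (add_arr C f g) = tgt C g"
proof -
  interpret comm_group "hom_group C (src C g) (tgt C g)"
    using assms by (intro hom_comm_group) auto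
  from m_closed[of f g] assms show "add_arr C f g \<in> arr C" "src C (add_arr C f g) = src C g"
    "tgt C (add_arr C f g) = tgt C g"
    by (simp_all add: hom_group_def mem_Hom)
qed

lemma neg_simps [simp]:
  assumes "f \<in> arr C"
  shows "neg_arr C f \<in> arr C" "src C (neg_arr C f) = src C f" "tgt C (neg_arr C f) = tgt C f"
proof -
  interpret comm_group "hom_group C (src C f) (tgt C f)"
    using assms by (intro hom_comm_group) auto
  from inv_closed[of f] assms show "neg_arr C f \<in> arr C" "src C (neg_arr C f) = src C f"
    "tgt C (neg_arr C f) = tgt C f"
    by (simp_all add: hom_group_def mem_Hom neg_arr_def)
qed

lemma add_zero [simp]:
  assumes "f \<in> arr C" "src C f = A" "tgt C f = B"
  shows "add_arr C f (zero_arr C A B) = f" "add_arr C (zero_arr C A B) f = f"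
proof -
  interpret comm_group "hom_group C A B"
    using assms by (intro hom_comm_group) auto
  from r_one[of f] l_one[of f] assms
  show "add_arr C f (zero_arr C A B) = f" "add_arr C (zero_arr C A B) f = f"
    by (simp_all add: hom_group_def mem_Hom)
qed

lemma add_neg [simp]:
  assumes "f \<in> arr C"
  shows "add_arr C f (neg_arr C f) = zero_arr C (src C f) (tgt C f)"
    "add_arr C (neg_arr C f) f = zero_arr C (src C f) (tgt C f)"
proof -
  interpret comm_group "hom_group C (src C f) (tgt C f)"
    using assms by (intro hom_comm_group) auto
  from r_inv[of f] l_inv[of f] assms
  show "add_arr C f (neg_arr C f) = zero_arr C (src C f) (tgt C f)"
    "add_arr C (neg_arr C f) f = zero_arr C (src C f) (tgt C f)"
    by (simp_all add: hom_group_def mem_Hom neg_arr_def)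
qed

lemma add_assoc [simp]:
  assumes "f \<in> arr C" "g \<in> arr C" "h \<in> arr C"
    "src C f = src C g" "tgt C f = tgt C g" "src C g = src C h" "tgt C g = tgt C h"
  shows "add_arr C (add_arr C f g) h = add_arr C f (add_arr C g h)"
proof -
  interpret comm_group "hom_group C (src C f) (tgt C f)"
    using assms by (intro hom_comm_group) auto
  from m_assoc[of f g h] assms show ?thesis by (simp add: hom_group_def mem_Hom)
qed

lemma add_commute:
  assumes "f \<in> arr C" "g \<in> arr C" "src C f = src C g" "tgt C f = tgt C g"
  shows "add_arr C f g = add_arr C g f"
proof -
  interpret comm_group "hom_group C (src C f) (tgt C f)"
    using assms by (intro hom_comm_group) auto
  from m_comm[of f g] assms show ?thesis by (simp add: hom_group_def mem_Hom)
qed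

lemma add_left_commute:
  assumes "f \<in> arr C" "g \<in> arr C" "h \<in> arr C"
    "src C f = src C g" "tgt C f = tgt C g" "src C g = src C h" "tgt C g = tgt C h"
  shows "add_arr C f (add_arr C g h) = add_arr C g (add_arr C f h)"
proof -
  have "add_arr C (add_arr C f g) h = add_arr C (add_arr C g f) h"
    using add_commute[of f g] assms by simp
  then show ?thesis using assms by simp
qed

lemma add_neg_cancel [simp]:
  assumes "f \<in> arr C" "g \<in> arr C" "src C f = src C g" "tgt C f = tgt C g"
  shows "add_arr C f (add_arr C (neg_arr C f) g) = g"
    "add_arr C (neg_arr C f) (add_arr C f g) = g"
  using add_assoc[of f "neg_arr C f" g] add_assoc[of "neg_arr C f" f g] assms by simp_all

lemma comp_add [simp]:
  assumes "f \<in> arr C" "f' \<in> arr C" "g \<in> arr C" "src C f = src C f'" "tgt C f = tgt C f'"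
    "tgt C f' = src C g"
  shows "g \<cdot> add_arr C f f' = add_arr C (g \<cdot> f) (g \<cdot> f')"
  using comp_add_left[of f "src C f" "tgt C f" f' g "tgt C g"] assms by (simp add: mem_Hom)

lemma add_comp [simp]:
  assumes "f \<in> arr C" "g \<in> arr C" "g' \<in> arr C" "src C g = src C g'" "tgt C g = tgt C g'"
    "tgt C f = src C g'"
  shows "add_arr C g g' \<cdot> f = add_arr C (g \<cdot> f) (g' \<cdot> f)"
  using comp_add_right[of f "src C f" "tgt C f" g "tgt C g" g'] assms by (simp add: mem_Hom)

lemma add_self_zero:
  assumes "add_arr C f f = f" "f \<in> arr C" "src C f = A" "tgt C f = B"
  shows "f = zero_arr C A B"
proof -
  have "add_arr C (add_arr C f f) (neg_arr C f) = zero_arr C A B"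
    using assms by (simp only: assms(1)) simp
  then show ?thesis using assms(2-) by simp
qed

lemma comp_zero [simp]:
  assumes "f \<in> arr C" "A \<in> obj C" "src C f = B"
  shows "f \<cdot> zero_arr C A B = zero_arr C A (tgt C f)"
proof -
  from assms have B: "B \<in> obj C" by auto
  have "add_arr C (f \<cdot> zero_arr C A B) (f \<cdot> zero_arr C A B) = f \<cdot> zero_arr C A B"
    using comp_add[of "zero_arr C A B" "zero_arr C A B" f] assms B by simp
  then show ?thesis by (rule add_self_zero) (use assms B in simp_all)
qed

lemma zero_comp [simp]:
  assumes "f \<in> arr C" "B \<in> obj C" "tgt C f = A"
  shows "zero_arr C A B \<cdot> f = zero_arr C (src C f) B"
proof -
  from assms have A: "A \<in> obj C" by auto
  have "add_arr C (zero_arr C A B \<cdot> f) (zero_arr C A B \<cdot> f) = zero_arr C A B \<cdot> f"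
    using add_comp[of f "zero_arr C A B" "zero_arr C A B"] assms A by simp
  then show ?thesis by (rule add_self_zero) (use assms A in simp_all)
qed

lemma neg_unique:
  assumes "f \<in> arr C" "g \<in> arr C" "src C f = src C g" "tgt C f = tgt C g"
    "add_arr C f g = zero_arr C (src C f) (tgt C f)"
  shows "g = neg_arr C f"
proof -
  have "add_arr C (neg_arr C f) (add_arr C f g) = neg_arr C f"
    using assms(1-4) by (simp add: assms(5))
  then show ?thesis using assms(1-4) by simp
qed

lemma comp_neg [simp]:
  assumes "f \<in> arr C" "g \<in> arr C" "tgt C f = src C g"
  shows "g \<cdot> neg_arr C f = neg_arr C (g \<cdot> f)" "neg_arr C g \<cdot> f = neg_arr C (g \<cdot> f)"
proof -
  have "add_arr C (g \<cdot> f) (g \<cdot> neg_arr C f) = zero_arr C (src C f) (tgt C g)"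
    using comp_add[of f "neg_arr C f" g] assms by simp
  then show "g \<cdot> neg_arr C f = neg_arr C (g \<cdot> f)"
    using assms by (intro neg_unique) simp_all
  have "add_arr C (g \<cdot> f) (neg_arr C g \<cdot> f) = zero_arr C (src C f) (tgt C g)"
    using add_comp[of f g "neg_arr C g"] assms by simp
  then show "neg_arr C g \<cdot> f = neg_arr C (g \<cdot> f)"
    using assms by (intro neg_unique) simp_all
qed

lemma neg_neg [simp]: "f \<in> arr C \<Longrightarrow> neg_arr C (neg_arr C f) = f"
  by (rule neg_unique[symmetric]) simp_all

lemma neg_zero [simp]:
  "\<lbrakk>A \<in> obj C; B \<in> obj C\<rbrakk> \<Longrightarrow> neg_arr C (zero_arr C A B) = zero_arr C A B"
  by (rule neg_unique[symmetric]) simp_all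

lemma neg_add [simp]:
  assumes "f \<in> arr C" "g \<in> arr C" "src C f = src C g" "tgt C f = tgt C g"
  shows "neg_arr C (add_arr C f g) = add_arr C (neg_arr C f) (neg_arr C g)"
proof -
  have "add_arr C (add_arr C f g) (add_arr C (neg_arr C f) (neg_arr C g)) =
      zero_arr C (src C f) (tgt C f)"
    using assms add_left_commute[of g "neg_arr C f" "neg_arr C g"] by simp
  then show ?thesis
    using assms by (intro neg_unique[symmetric]) simp_all
qed

lemma eq_if_diff_zero:
  assumes "add_arr C f (neg_arr C g) = zero_arr C (src C f) (tgt C f)"
    "f \<in> arr C" "g \<in> arr C" "src C f = src C g" "tgt C f = tgt C g"
  shows "f = g"
proof -
  have "neg_arr C g = neg_arr C f" using assms by (intro neg_unique) simp_all
  then have "neg_arr C (neg_arr C f) = neg_arr C (neg_arr C g)" by simp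
  then show ?thesis using assms(2,3) by simp
qed

lemma is_zero_objectI:
  assumes "A \<in> obj C" "ident C A = zero_arr C A A"
  shows "is_zero_object C A"
  unfolding is_zero_object_def
proof (intro conjI ballI ex1I)
  fix B assume B: "B \<in> obj C"
  show "zero_arr C B A \<in> Hom C B A" "zero_arr C A B \<in> Hom C A B"
    using assms B by (simp_all add: mem_Hom)
  show "f = zero_arr C B A" if "f \<in> Hom C B A" for f
    using that assms ident_comp(1)[of f A] zero_comp[of f A A] by (simp add: mem_Hom)
  show "f = zero_arr C A B" if "f \<in> Hom C A B" for f
    using that assms ident_comp(2)[of f A] comp_zero[of f A A] by (simp add: mem_Hom)
qed (use assms in simp)

lemma is_zero_objectD:
  assumes "is_zero_object C A" "f \<in> Hom C A B"
  shows "f = zero_arr C A B"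
proof -
  have "zero_arr C A B \<in> Hom C A B" using Hom_obj[OF assms(2)] by (simp add: mem_Hom)
  then show ?thesis
    using assms Hom_obj[OF assms(2)] unfolding is_zero_object_def by blast
qed

end

section \<open>Conflations, pushouts and pullbacks\<close>

definition conflation ::
  "('o, 'm, 'x) exact_cat_scheme \<Rightarrow> 'o \<Rightarrow> 'm \<Rightarrow> 'o \<Rightarrow> 'm \<Rightarrow> 'o \<Rightarrow> bool" where
  "conflation C A f E g B \<longleftrightarrow> (f, g) \<in> conflations C \<and> f \<in> Hom C A E \<and> g \<in> Hom C E B"

text \<open>Dual statements are obtained by instantiating a lemma at \<open>op_cat C\<close> and
  unfolding \<open>op_cat_simps\<close> and \<open>op_cat_defs\<close>, so that no diagram has to be
  chased twice.\<close>

definition op_cat :: "('o, 'm, 'x) exact_cat_scheme \<Rightarrow> ('o, 'm, 'x) exact_cat_scheme" where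
  "op_cat C = C\<lparr>src := tgt C, tgt := src C, comp_arr := (\<lambda>g f. f \<cdot>\<^bsub>C\<^esub> g),
     zero_arr := (\<lambda>A B. zero_arr C B A), conflations := {(g, f). (f, g) \<in> conflations C}\<rparr>"

lemma op_cat_simps:
  "obj (op_cat C) = obj C" "arr (op_cat C) = arr C" "src (op_cat C) = tgt C"
  "tgt (op_cat C) = src C" "ident (op_cat C) = ident C" "g \<cdot>\<^bsub>op_cat C\<^esub> f = f \<cdot>\<^bsub>C\<^esub> g"
  "add_arr (op_cat C) = add_arr C" "zero_arr (op_cat C) A B = zero_arr C B A"
  "(f, g) \<in> conflations (op_cat C) \<longleftrightarrow> (g, f) \<in> conflations C"
  "Hom (op_cat C) A B = Hom C B A"
  by (auto simp: op_cat_def Hom_def)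

lemma op_cat_op_cat [simp]: "op_cat (op_cat C) = C"
  by (simp add: op_cat_def)

lemma op_cat_defs:
  "hom_group (op_cat C) A B = hom_group C B A"
  "is_zero_object (op_cat C) A = is_zero_object C A"
  "is_direct_sum (op_cat C) A B S = is_direct_sum C A B S"
  "is_iso (op_cat C) f = is_iso C f"
  "is_kernel (op_cat C) f g = is_cokernel C f g"
  "is_cokernel (op_cat C) f g = is_kernel C f g"
  "is_pushout (op_cat C) f a f' b = is_pullback C f a f' b"
  "is_pullback (op_cat C) f a f' b = is_pushout C f a f' b"
  "inflation (op_cat C) f = deflation C f"
  "deflation (op_cat C) f = inflation C f"
  "conflation (op_cat C) A f E g B = conflation C B g E f A"
proof -
  show "is_direct_sum (op_cat C) A B S = is_direct_sum C A B S"
    unfolding is_direct_sum_def op_cat_simps by (rule iffI) blast+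
qed (auto simp: op_cat_simps hom_group_def is_zero_object_def is_iso_def is_kernel_def
    is_cokernel_def is_pushout_def is_pullback_def inflation_def deflation_def conflation_def)

context exact_category
begin

lemma is_isoE:
  assumes "is_iso C f" "f \<in> Hom C A B"
  obtains g where "g \<in> Hom C B A" "g \<cdot> f = ident C A" "f \<cdot> g = ident C B" "is_iso C g"
proof -
  from assms have f: "f \<in> arr C" "src C f = A" "tgt C f = B" by (simp_all add: mem_Hom)
  with assms(1) obtain g where g: "g \<in> Hom C B A" "g \<cdot> f = ident C A" "f \<cdot> g = ident C B"
    unfolding is_iso_def by auto
  moreover have "is_iso C g"
    unfolding is_iso_def using f g assms(2) by (intro conjI bexI[of _ f]) (simp_all add: mem_Hom)
  ultimately show thesis by (rule that)
qed

lemma is_isoI: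
  assumes "f \<in> Hom C A B" "g \<in> Hom C B A" "g \<cdot> f = ident C A" "f \<cdot> g = ident C B"
  shows "is_iso C f"
  using assms unfolding is_iso_def by (auto simp: mem_Hom)

text \<open>The axioms are self-dual or come in dual pairs, except for the direction of the
  isomorphisms in \<open>conflation_iso\<close>. In the opposite category they run from the new pair
  to the old one, so both squares are first rewritten for the inverses.\<close>

lemma exact_op: "exact_category (op_cat C)"
proof (intro exact_category.intro additive_category.intro exact_category_axioms.intro)
  fix f g f' g' a b c
  assume h: "(f, g) \<in> conflations (op_cat C)" "f' \<in> arr (op_cat C)" "g' \<in> arr (op_cat C)"
    "tgt (op_cat C) f' = src (op_cat C) g'" "is_iso (op_cat C) a" "is_iso (op_cat C) b"
    "is_iso (op_cat C) c"
    "a \<in> Hom (op_cat C) (src (op_cat C) f) (src (op_cat C) f')"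
    "b \<in> Hom (op_cat C) (tgt (op_cat C) f) (tgt (op_cat C) f')"
    "c \<in> Hom (op_cat C) (tgt (op_cat C) g) (tgt (op_cat C) g')"
    "b \<cdot>\<^bsub>op_cat C\<^esub> f = f' \<cdot>\<^bsub>op_cat C\<^esub> a" "c \<cdot>\<^bsub>op_cat C\<^esub> g = g' \<cdot>\<^bsub>op_cat C\<^esub> b"
  note h = h[unfolded op_cat_simps op_cat_defs]
  from conflation_kernel[OF h(1)] have fg: "f \<in> arr C" "g \<in> arr C" "tgt C g = src C f"
    by (simp_all add: is_kernel_def)
  obtain a' where a': "a' \<in> Hom C (tgt C f) (tgt C f')" "a' \<cdot> a = ident C (tgt C f')"
    "a \<cdot> a' = ident C (tgt C f)" "is_iso C a'"
    using is_isoE[OF h(5) h(8)] by metis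
  obtain b' where b': "b' \<in> Hom C (src C f) (src C f')" "b' \<cdot> b = ident C (src C f')"
    "b \<cdot> b' = ident C (src C f)" "is_iso C b'"
    using is_isoE[OF h(6) h(9)] by metis
  obtain c' where c': "c' \<in> Hom C (src C g) (src C g')" "c' \<cdot> c = ident C (src C g')"
    "c \<cdot> c' = ident C (src C g)" "is_iso C c'"
    using is_isoE[OF h(7) h(10)] by metis
  note s = h(2-4,8-10)[unfolded mem_Hom] a'(1)[unfolded mem_Hom] b'(1)[unfolded mem_Hom]
    c'(1)[unfolded mem_Hom] fg
  have "a' \<cdot> f = a' \<cdot> (f \<cdot> (b \<cdot> b'))" using s b'(3) by simp
  also have "\<dots> = a' \<cdot> ((f \<cdot> b) \<cdot> b')" using s by simp
  also have "\<dots> = (a' \<cdot> a) \<cdot> (f' \<cdot> b')" unfolding h(11) using s by simp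
  also have "\<dots> = f' \<cdot> b'" unfolding a'(2) using s by simp
  finally have 1: "a' \<cdot> f = f' \<cdot> b'" .
  have "b' \<cdot> g = b' \<cdot> (g \<cdot> (c \<cdot> c'))" using s c'(3) by simp
  also have "\<dots> = b' \<cdot> ((g \<cdot> c) \<cdot> c')" using s by simp
  also have "\<dots> = (b' \<cdot> b) \<cdot> (g' \<cdot> c')" unfolding h(12) using s by simp
  also have "\<dots> = g' \<cdot> c'" unfolding b'(2) using s by simp
  finally have 2: "b' \<cdot> g = g' \<cdot> c'" .
  have "(g', f') \<in> conflations C"
    using conflation_iso[OF h(1) h(3,2) h(4)[symmetric] c'(4) b'(4) a'(4)]
      a'(1) b'(1) c'(1) 1 2 fg h(4) by simp
  then show "(f', g') \<in> conflations (op_cat C)" by (simp add: op_cat_simps)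
next
  fix f A B g D h E
  assume "f \<in> Hom (op_cat C) A B" "g \<in> Hom (op_cat C) B D" "h \<in> Hom (op_cat C) D E"
  then show "h \<cdot>\<^bsub>op_cat C\<^esub> g \<cdot>\<^bsub>op_cat C\<^esub> f = h \<cdot>\<^bsub>op_cat C\<^esub> (g \<cdot>\<^bsub>op_cat C\<^esub> f)"
    by (simp add: op_cat_simps comp_assoc)
next
  fix f g
  show "inflation (op_cat C) f \<Longrightarrow> inflation (op_cat C) g \<Longrightarrow>
    tgt (op_cat C) f = src (op_cat C) g \<Longrightarrow> inflation (op_cat C) (g \<cdot>\<^bsub>op_cat C\<^esub> f)"
    using deflation_comp[of g f] by (simp add: op_cat_simps op_cat_defs)
  show "deflation (op_cat C) f \<Longrightarrow> deflation (op_cat C) g \<Longrightarrow>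
    tgt (op_cat C) f = src (op_cat C) g \<Longrightarrow> deflation (op_cat C) (g \<cdot>\<^bsub>op_cat C\<^esub> f)"
    using inflation_comp[of g f] by (simp add: op_cat_simps op_cat_defs)
next
  fix f a
  show "inflation (op_cat C) f \<Longrightarrow> a \<in> arr (op_cat C) \<Longrightarrow>
      src (op_cat C) a = src (op_cat C) f \<Longrightarrow>
      \<exists>f' b. is_pushout (op_cat C) f a f' b \<and> inflation (op_cat C) f'"
    unfolding op_cat_simps op_cat_defs by (rule deflation_pullback)
  show "deflation (op_cat C) f \<Longrightarrow> a \<in> arr (op_cat C) \<Longrightarrow>
      tgt (op_cat C) a = tgt (op_cat C) f \<Longrightarrow>
      \<exists>f' b. is_pullback (op_cat C) f a f' b \<and> deflation (op_cat C) f'"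
    unfolding op_cat_simps op_cat_defs by (rule inflation_pushout)
qed (simp_all add: op_cat_simps op_cat_defs ident_Hom comp_Hom hom_comm_group comp_add_left
    comp_add_right zero_object_exists direct_sum_exists conflation_kernel conflation_cokernel
    ident_inflation ident_deflation ident_left ident_right src_obj tgt_obj)

lemma conflationD:
  assumes "conflation C A f E g B"
  shows "f \<in> arr C" "src C f = A" "tgt C f = E" "g \<in> arr C" "src C g = E" "tgt C g = B"
    "g \<cdot> f = zero_arr C A B" "A \<in> obj C" "E \<in> obj C" "B \<in> obj C" "(f, g) \<in> conflations C"
    "is_kernel C f g" "is_cokernel C g f" "f \<in> Hom C A E" "g \<in> Hom C E B" "inflation C f"
    "deflation C g"
proof -
  from assms have *: "(f, g) \<in> conflations C" "f \<in> Hom C A E" "g \<in> Hom C E B"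
    by (auto simp: conflation_def)
  then show "is_kernel C f g" "is_cokernel C g f"
    by (simp_all add: conflation_kernel conflation_cokernel)
  then show "g \<cdot> f = zero_arr C A B"
    using * by (auto simp: is_kernel_def mem_Hom)
  show "inflation C f" "deflation C g" using *(1) unfolding inflation_def deflation_def by auto
  show "(f, g) \<in> conflations C" "f \<in> Hom C A E" "g \<in> Hom C E B" by fact+
qed (use assms in \<open>auto simp: conflation_def mem_Hom\<close>)

lemma conflation_factor:
  assumes "conflation C A f E g B" "h \<in> Hom C T E" "g \<cdot> h = zero_arr C T B"
  obtains u where "u \<in> Hom C T A" "f \<cdot> u = h"
proof -
  note c = conflationD[OF assms(1)]
  have "\<exists>!u. u \<in> Hom C (src C h) (src C f) \<and> f \<cdot> u = h"
    using c(12) assms(2,3) c(1-6) unfolding is_kernel_def mem_Hom by metis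
  then show ?thesis using that assms(2) c(1-6) unfolding mem_Hom by metis
qed

lemma conflation_mono:
  assumes "conflation C A f E g B" "f \<cdot> u = f \<cdot> v" "u \<in> Hom C T A" "v \<in> Hom C T A"
  shows "u = v"
proof -
  note c = conflationD[OF assms(1)]
  have fu: "f \<cdot> u \<in> Hom C T E" using assms(3) c by (simp add: mem_Hom)
  have "g \<cdot> (f \<cdot> u) = zero_arr C A B \<cdot> u"
    using assms(3) c by (intro comp_reassoc) (simp_all add: mem_Hom)
  also have "\<dots> = zero_arr C T B" using assms(3) c by (simp add: mem_Hom)
  finally have "\<exists>!w. w \<in> Hom C (src C (f \<cdot> u)) (src C f) \<and> f \<cdot> w = f \<cdot> u"
    using c(12) fu c(1-6) unfolding is_kernel_def mem_Hom by metis
  moreover have "u \<in> Hom C (src C (f \<cdot> u)) (src C f)" "v \<in> Hom C (src C (f \<cdot> u)) (src C f)"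
    using assms(3,4) c fu by (simp_all add: mem_Hom)
  ultimately show ?thesis using assms(2) by metis
qed

lemma conflation_cofactor:
  assumes "conflation C A f E g B" "h \<in> Hom C E T" "h \<cdot> f = zero_arr C A T"
  obtains u where "u \<in> Hom C B T" "u \<cdot> g = h"
  using exact_category.conflation_factor[OF exact_op, unfolded op_cat_defs op_cat_simps,
      OF assms] .

lemma conflation_epi:
  assumes "conflation C A f E g B" "u \<cdot> g = v \<cdot> g" "u \<in> Hom C B T" "v \<in> Hom C B T"
  shows "u = v"
  using exact_category.conflation_mono[OF exact_op, unfolded op_cat_defs op_cat_simps,
      OF assms] .

section \<open>Recognising conflations; pushouts and pullbacks\<close>

lemma inflationE:
  assumes "inflation C f"
  obtains E g B where "conflation C (src C f) f E g B"
proof -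
  from assms obtain g where g: "(f, g) \<in> conflations C" by (auto simp: inflation_def)
  from conflation_kernel[OF g] have "f \<in> arr C" "g \<in> arr C" "tgt C f = src C g"
    by (auto simp: is_kernel_def)
  then have "conflation C (src C f) f (tgt C f) g (tgt C g)"
    using g by (simp add: conflation_def mem_Hom)
  then show ?thesis by (rule that)
qed

text \<open>An inflation has some conflation \<open>(f, g')\<close>; the universal properties of
  \<open>g\<close> and \<open>g'\<close> give an isomorphism of their targets, and conflations are
  closed under isomorphism. In this way a conflation is recognised without any check on
  kernels.\<close>

lemma conflation_if_cokernel:
  assumes "inflation C f" "f \<in> Hom C A E" "g \<in> Hom C E B" "g \<cdot> f = zero_arr C A B"
    and fac: "\<And>T h. \<lbrakk>h \<in> Hom C E T; h \<cdot> f = zero_arr C A T\<rbrakk> \<Longrightarrow> \<exists>u \<in> Hom C B T. u \<cdot> g = h"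
    and epi: "\<And>T u v. \<lbrakk>u \<in> Hom C B T; v \<in> Hom C B T; u \<cdot> g = v \<cdot> g\<rbrakk> \<Longrightarrow> u = v"
  shows "conflation C A f E g B"
proof -
  obtain E' g' B' where "conflation C (src C f) f E' g' B'"
    using assms(1) by (rule inflationE)
  then have c: "conflation C A f E g' B'"
    using assms(2) by (auto simp: conflation_def mem_Hom)
  note cd = conflationD[OF c] and s = assms(2,3)[unfolded mem_Hom]
  obtain u where u: "u \<in> Hom C B' B" "u \<cdot> g' = g"
    using conflation_cofactor[OF c assms(3,4)] by blast
  obtain v where v: "v \<in> Hom C B B'" "v \<cdot> g = g'"
    using fac[OF cd(15,7)] by blast
  note t = u(1)[unfolded mem_Hom] v(1)[unfolded mem_Hom]
  have "v \<cdot> u \<cdot> g' = ident C B' \<cdot> g'" using s t cd u v by simp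
  then have 1: "v \<cdot> u = ident C B'"
    by (rule conflation_epi[OF c]) (use t cd in \<open>simp_all add: mem_Hom\<close>)
  have "u \<cdot> v \<cdot> g = ident C B \<cdot> g" using s t cd u v by simp
  then have 2: "u \<cdot> v = ident C B"
    by (rule epi[rotated 2]) (use t s in \<open>auto simp: mem_Hom\<close>)
  have "(f, g) \<in> conflations C"
    using conflation_iso[OF cd(11), of f g "ident C A" "ident C E" u]
      is_isoI[OF u(1) v(1) 1 2] is_isoI[of "ident C A" A A "ident C A"]
      is_isoI[of "ident C E" E E "ident C E"] u cd s
    by (simp add: mem_Hom)
  then show ?thesis using assms(2,3) by (simp add: conflation_def)
qed

text \<open>The axiom supplies only the square. The deflation \<open>g'\<close> is induced on the
  pushout by \<open>0\<close> and \<open>g\<close>, and its universal property is inherited from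
  that of \<open>g\<close>, so both rows end in the same object \<open>B\<close>.\<close>

lemma ex_pushout:
  assumes "conflation C A f E g B" "a \<in> Hom C A A'"
  obtains E' f' g' e where "conflation C A' f' E' g' B" "e \<in> Hom C E E'"
    "e \<cdot> f = f' \<cdot> a" "g' \<cdot> e = g"
    "\<And>T x y. \<lbrakk>x \<in> Hom C A' T; y \<in> Hom C E T; x \<cdot> a = y \<cdot> f\<rbrakk>
      \<Longrightarrow> \<exists>u \<in> Hom C E' T. u \<cdot> f' = x \<and> u \<cdot> e = y"
proof -
  note c = conflationD[OF assms(1)] and a = assms(2)[unfolded mem_Hom]
  obtain f' e where "is_pushout C f a f' e" and inf: "inflation C f'"
    using inflation_pushout[of f a] c a by auto
  then have s: "f' \<in> arr C" "e \<in> arr C" "src C f' = A'" "src C e = E" "tgt C e = tgt C f'"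
    and eq: "e \<cdot> f = f' \<cdot> a"
    and univ: "\<And>x y. \<lbrakk>x \<in> arr C; y \<in> arr C; src C x = A'; src C y = E; tgt C x = tgt C y;
      x \<cdot> a = y \<cdot> f\<rbrakk> \<Longrightarrow> \<exists>!u. u \<in> Hom C (tgt C f') (tgt C x) \<and> u \<cdot> f' = x \<and> u \<cdot> e = y"
    using c a unfolding is_pushout_def by auto
  define E' where "E' = tgt C f'"
  note s = s[folded E'_def] and univ = univ[folded E'_def] and E' = E'_def[symmetric]
  obtain g' where g': "g' \<in> Hom C E' B" "g' \<cdot> f' = zero_arr C A' B" "g' \<cdot> e = g"
    using ex1_implies_ex[OF univ[of "zero_arr C A' B" g]] c a s by force
  note t = g'(1)[unfolded mem_Hom]
  have "conflation C A' f' E' g' B"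
  proof (rule conflation_if_cokernel)
    show "f' \<in> Hom C A' E'" using s E' by (simp add: mem_Hom)
    fix T h assume h: "h \<in> Hom C E' T" "h \<cdot> f' = zero_arr C A' T"
    note hs = h(1)[unfolded mem_Hom]
    have hf: "h \<cdot> (f' \<cdot> a) = zero_arr C A T"
      using comp_reassoc[OF h(2), of a] hs s a E' by auto
    have "(h \<cdot> e) \<cdot> f = zero_arr C A T" using eq hf hs s c E' by simp
    then obtain u where u: "u \<in> Hom C B T" "u \<cdot> g = h \<cdot> e"
      using conflation_cofactor[OF assms(1), of "h \<cdot> e" T] hs s by (auto simp: mem_Hom)
    note us = u(1)[unfolded mem_Hom]
    have "\<exists>!w. w \<in> Hom C E' (tgt C (h \<cdot> f')) \<and> w \<cdot> f' = h \<cdot> f' \<and> w \<cdot> e = h \<cdot> e"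
      by (rule univ) (use hs s a c eq E' in simp_all)
    moreover have "u \<cdot> g' \<cdot> f' = h \<cdot> f'" using us t s h(2) g'(2) Hom_obj(2)[OF assms(2)] E' by simp
    moreover have "u \<cdot> g' \<cdot> e = h \<cdot> e" using us t s u(2) g'(3) E' by simp
    moreover have "u \<cdot> g' \<in> Hom C E' (tgt C (h \<cdot> f'))" "h \<in> Hom C E' (tgt C (h \<cdot> f'))"
      using us t hs s E' by (simp_all add: mem_Hom)
    ultimately show "\<exists>u \<in> Hom C B T. u \<cdot> g' = h" using u(1) by blast
  next
    fix T u v assume h: "u \<in> Hom C B T" "v \<in> Hom C B T" "u \<cdot> g' = v \<cdot> g'"
    note hs = h(1,2)[unfolded mem_Hom]
    have "u \<cdot> g' \<cdot> e = v \<cdot> g' \<cdot> e" by (simp only: h(3))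
    then have "u \<cdot> g = v \<cdot> g" using hs t s g'(3) E' by simp
    then show "u = v" using conflation_epi[OF assms(1)] h by blast
  qed (use inf g' in auto)
  moreover have "\<exists>u \<in> Hom C E' T. u \<cdot> f' = x \<and> u \<cdot> e = y"
    if "x \<in> Hom C A' T" "y \<in> Hom C E T" "x \<cdot> a = y \<cdot> f" for T x y
    using ex1_implies_ex[OF univ[of x y]] that by (auto simp: mem_Hom)
  ultimately show ?thesis using that[of f' E' g' e] s eq g'(3) E' by (simp add: mem_Hom)
qed

lemma ex_pullback:
  assumes "conflation C A f E g B" "b \<in> Hom C B' B"
  obtains E' f' g' e where "conflation C A f' E' g' B'" "e \<in> Hom C E' E"
    "g \<cdot> e = b \<cdot> g'" "e \<cdot> f' = f"
    "\<And>T x y. \<lbrakk>x \<in> Hom C T B'; y \<in> Hom C T E; b \<cdot> x = g \<cdot> y\<rbrakk>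
      \<Longrightarrow> \<exists>u \<in> Hom C T E'. g' \<cdot> u = x \<and> e \<cdot> u = y"
  using exact_category.ex_pushout[OF exact_op, unfolded op_cat_defs op_cat_simps, OF assms]
  by metis

text \<open>On the pullback \<open>P\<close> of \<open>g\<close> and \<open>g'\<close>, the universal morphism becomes \<open>y \<pi> + x \<rho>\<close>, where
  \<open>f' \<rho> = \<pi>' - e \<pi>\<close>.\<close>

lemma pushout_univ:
  assumes c1: "conflation C A f E g B" and c2: "conflation C A' f' E' g' B"
    and a: "a \<in> Hom C A A'" and e: "e \<in> Hom C E E'"
    and eq: "e \<cdot> f = f' \<cdot> a" "g' \<cdot> e = g"
    and x: "x \<in> Hom C A' T" and y: "y \<in> Hom C E T" and xy: "x \<cdot> a = y \<cdot> f"
  obtains u where "u \<in> Hom C E' T" "u \<cdot> f' = x" "u \<cdot> e = y"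
proof -
  note c = conflationD[OF c1] conflationD[OF c2]
    a[unfolded mem_Hom] e[unfolded mem_Hom] x[unfolded mem_Hom] y[unfolded mem_Hom]
    Hom_obj[OF x] Hom_obj[OF y]
  obtain P \<kappa> \<pi>' \<pi> where P: "conflation C A \<kappa> P \<pi>' E'" "\<pi> \<in> Hom C P E" "g \<cdot> \<pi> = g' \<cdot> \<pi>'"
    "\<pi> \<cdot> \<kappa> = f"
    and univ: "\<And>T x y. \<lbrakk>x \<in> Hom C T E'; y \<in> Hom C T E; g' \<cdot> x = g \<cdot> y\<rbrakk>
      \<Longrightarrow> \<exists>u \<in> Hom C T P. \<pi>' \<cdot> u = x \<and> \<pi> \<cdot> u = y"
    using ex_pullback[OF c1 conflationD(15)[OF c2]] by metis
  note c = c conflationD[OF P(1)] P(2)[unfolded mem_Hom]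
  have "add_arr C \<pi>' (neg_arr C (e \<cdot> \<pi>)) \<in> Hom C P E'" using c by (simp add: mem_Hom)
  moreover have "g' \<cdot> add_arr C \<pi>' (neg_arr C (e \<cdot> \<pi>)) = zero_arr C P B"
    using c P(3) by (simp add: comp_reassoc[OF eq(2)])
  ultimately obtain \<rho> where \<rho>: "\<rho> \<in> Hom C P A'" "f' \<cdot> \<rho> = add_arr C \<pi>' (neg_arr C (e \<cdot> \<pi>))"
    using conflation_factor[OF c2] by blast
  note c = c \<rho>(1)[unfolded mem_Hom]
  have \<rho>_comp: "f' \<cdot> (\<rho> \<cdot> v) = add_arr C (\<pi>' \<cdot> v) (neg_arr C (e \<cdot> (\<pi> \<cdot> v)))"
    if "v \<in> Hom C S P" for v S
    using c that comp_reassoc[OF \<rho>(2), of v] by (simp add: mem_Hom)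
  have "f' \<cdot> (\<rho> \<cdot> \<kappa>) = f' \<cdot> neg_arr C a"
    using c \<rho>_comp[of \<kappa> A] P(4) eq(1) by (simp add: mem_Hom)
  then have \<rho>\<kappa>: "\<rho> \<cdot> \<kappa> = neg_arr C a"
    by (rule conflation_mono[OF c2]) (use c in \<open>simp_all add: mem_Hom\<close>)
  have "add_arr C (y \<cdot> \<pi>) (x \<cdot> \<rho>) \<in> Hom C P T" using c by (simp add: mem_Hom)
  moreover have "add_arr C (y \<cdot> \<pi>) (x \<cdot> \<rho>) \<cdot> \<kappa> = zero_arr C A T"
    using c \<rho>\<kappa> P(4) xy by simp
  ultimately obtain u where u: "u \<in> Hom C E' T" "u \<cdot> \<pi>' = add_arr C (y \<cdot> \<pi>) (x \<cdot> \<rho>)"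
    using conflation_cofactor[OF P(1)] by blast
  note c = c u(1)[unfolded mem_Hom]
  have u_comp: "u \<cdot> (\<pi>' \<cdot> v) = add_arr C (y \<cdot> (\<pi> \<cdot> v)) (x \<cdot> (\<rho> \<cdot> v))" if "v \<in> Hom C S P" for v S
    using c that comp_reassoc[OF u(2), of v] by (simp add: mem_Hom)
  \<comment> \<open>\<open>k\<close> and \<open>s\<close> lift \<open>f'\<close> and
    \<open>e\<close> to \<open>P\<close>. They satisfy \<open>\<rho> \<cdot> k = 1\<close> and
    \<open>\<rho> \<cdot> s = 0\<close>, so that composing \<open>u \<cdot> \<pi>'\<close> with them
    returns \<open>x\<close> and \<open>y\<close>.\<close>
  have "zero_arr C A' E \<in> Hom C A' E" "g' \<cdot> f' = g \<cdot> zero_arr C A' E"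
    using c by (simp_all add: mem_Hom)
  then obtain k where k: "k \<in> Hom C A' P" "\<pi>' \<cdot> k = f'" "\<pi> \<cdot> k = zero_arr C A' E"
    using univ[OF conflationD(14)[OF c2]] by blast
  have "ident C E \<in> Hom C E E" "g' \<cdot> e = g \<cdot> ident C E"
    using c eq(2) by (simp_all add: mem_Hom)
  then obtain s where s: "s \<in> Hom C E P" "\<pi>' \<cdot> s = e" "\<pi> \<cdot> s = ident C E"
    using univ[OF e] by blast
  note c = c k(1)[unfolded mem_Hom] s(1)[unfolded mem_Hom]
  have "f' \<cdot> (\<rho> \<cdot> k) = f' \<cdot> ident C A'" using c \<rho>_comp[OF k(1)] k by simp
  then have \<rho>k: "\<rho> \<cdot> k = ident C A'"
    by (rule conflation_mono[OF c2]) (use c in \<open>simp_all add: mem_Hom\<close>)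
  have "f' \<cdot> (\<rho> \<cdot> s) = f' \<cdot> zero_arr C E A'" using c \<rho>_comp[OF s(1)] s by simp
  then have \<rho>s: "\<rho> \<cdot> s = zero_arr C E A'"
    by (rule conflation_mono[OF c2]) (use c in \<open>simp_all add: mem_Hom\<close>)
  have "u \<cdot> f' = x" using u_comp[OF k(1)] c k \<rho>k by simp
  moreover have "u \<cdot> e = y" using u_comp[OF s(1)] c s \<rho>s by simp
  ultimately show ?thesis using that u(1) by blast
qed

lemma pullback_univ:
  assumes "conflation C A f E g B" "conflation C A f' E' g' B'"
    "b \<in> Hom C B' B" "e \<in> Hom C E' E" "g \<cdot> e = b \<cdot> g'" "e \<cdot> f' = f"
    "x \<in> Hom C T B'" "y \<in> Hom C T E" "b \<cdot> x = g \<cdot> y"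
  obtains u where "u \<in> Hom C T E'" "g' \<cdot> u = x" "e \<cdot> u = y"
  using exact_category.pushout_univ[OF exact_op, unfolded op_cat_defs op_cat_simps, OF assms] .

text \<open>The difference of \<open>u\<close> and \<open>v\<close> vanishes on \<open>f'\<close>
  and so factors through \<open>g'\<close>. As it also vanishes on \<open>e\<close>, the factor
  vanishes on \<open>g' \<cdot> e = g\<close>, which is epi.\<close>

lemma pushout_joint_epi:
  assumes c1: "conflation C A f E g B" and c2: "conflation C A' f' E' g' B"
    and e: "e \<in> Hom C E E'" and eq: "g' \<cdot> e = g"
    and u: "u \<in> Hom C E' T" and v: "v \<in> Hom C E' T" and uv: "u \<cdot> f' = v \<cdot> f'" "u \<cdot> e = v \<cdot> e"
  shows "u = v"
proof -
  note c = conflationD[OF c1] conflationD[OF c2] e[unfolded mem_Hom] u[unfolded mem_Hom]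
    v[unfolded mem_Hom] Hom_obj[OF u]
  define d where "d = add_arr C u (neg_arr C v)"
  have d: "d \<in> Hom C E' T" using c by (simp add: d_def mem_Hom)
  have "d \<cdot> f' = zero_arr C A' T" using c uv by (simp add: d_def)
  then obtain w where w: "w \<in> Hom C B T" "w \<cdot> g' = d"
    using conflation_cofactor[OF c2 d] by blast
  note c = c w(1)[unfolded mem_Hom]
  have "w \<cdot> g = w \<cdot> g' \<cdot> e" using c eq by simp
  also have "\<dots> = zero_arr C B T \<cdot> g" unfolding w(2) using c uv by (simp add: d_def)
  finally have "w = zero_arr C B T"
    by (rule conflation_epi[OF c1]) (use c in \<open>simp_all add: mem_Hom\<close>)
  then have "d = zero_arr C E' T" using w(2)[symmetric] c by simp
  then show ?thesis using c unfolding d_def by - (rule eq_if_diff_zero, simp_all)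
qed

lemma pullback_joint_mono:
  assumes "conflation C A f E g B" "conflation C A f' E' g' B'"
    "e \<in> Hom C E' E" "e \<cdot> f' = f"
    "u \<in> Hom C T E'" "v \<in> Hom C T E'" "g' \<cdot> u = g' \<cdot> v" "e \<cdot> u = e \<cdot> v"
  shows "u = v"
  using exact_category.pushout_joint_epi[OF exact_op, unfolded op_cat_defs op_cat_simps,
      OF assms] .

text \<open>Noether's isomorphism theorem: with \<open>D = N/A\<close> and \<open>L = I/N\<close>,
  the pushout \<open>P\<close> of \<open>w\<close> along \<open>q\<close> is
  \<open>I/A\<close>.\<close>

lemma conflation_comp_pushout:
  assumes j: "conflation C A j N q D" and w: "conflation C N w I r L"
    and t: "conflation C D c P t L" and s: "s \<in> Hom C I P"
    and eq: "s \<cdot> w = c \<cdot> q" "t \<cdot> s = r"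
  shows "conflation C A (w \<cdot> j) I s P"
proof (rule conflation_if_cokernel)
  note c = conflationD[OF j] conflationD[OF w] conflationD[OF t] s[unfolded mem_Hom]
  show "inflation C (w \<cdot> j)" using c by (intro inflation_comp) simp_all
  show "w \<cdot> j \<in> Hom C A I" using c by (simp add: mem_Hom)
  show "s \<cdot> (w \<cdot> j) = zero_arr C A P" using c by (simp add: comp_reassoc[OF eq(1)])
  fix T h assume h: "h \<in> Hom C I T" "h \<cdot> (w \<cdot> j) = zero_arr C A T"
  note c = c h(1)[unfolded mem_Hom]
  have "h \<cdot> w \<in> Hom C N T" "h \<cdot> w \<cdot> j = zero_arr C A T" using c h(2) by (simp_all add: mem_Hom)
  then obtain x where x: "x \<in> Hom C D T" "x \<cdot> q = h \<cdot> w"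
    using conflation_cofactor[OF j] by metis
  obtain u where "u \<in> Hom C P T" "u \<cdot> s = h"
    using pushout_univ[OF w t conflationD(15)[OF j] s eq x(1) h(1) x(2)] by blast
  then show "\<exists>u \<in> Hom C P T. u \<cdot> s = h" by blast
next
  note c = conflationD[OF j] conflationD[OF w] conflationD[OF t] s[unfolded mem_Hom]
  fix T u v assume h: "u \<in> Hom C P T" "v \<in> Hom C P T" "u \<cdot> s = v \<cdot> s"
  note c = c h(1,2)[unfolded mem_Hom]
  have "u \<cdot> s \<cdot> w = v \<cdot> s \<cdot> w" by (simp only: h(3))
  then have "u \<cdot> c \<cdot> q = v \<cdot> c \<cdot> q" using c eq by simp
  then have "u \<cdot> c = v \<cdot> c"
    by (rule conflation_epi[OF j]) (use c in \<open>simp_all add: mem_Hom\<close>)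
  then show "u = v" using pushout_joint_epi[OF w t s eq(2) h(1,2)] h(3) by blast
qed (use s in auto)

lemma conflation_iso_middle:
  assumes c: "conflation C A f E g B" and t: "t \<in> Hom C E E'" "t' \<in> Hom C E' E"
    "t' \<cdot> t = ident C E" "t \<cdot> t' = ident C E'"
  shows "conflation C A (t \<cdot> f) E' (g \<cdot> t') B"
proof -
  note c = conflationD[OF c] t(1,2)[unfolded mem_Hom]
  have "(t \<cdot> f, g \<cdot> t') \<in> conflations C"
  proof (rule conflation_iso[OF c(11), of _ _ "ident C A" t "ident C B"])
    show "is_iso C t" using is_isoI[OF t] .
    show "is_iso C (ident C A)" "is_iso C (ident C B)"
      using is_isoI[of "ident C A" A A "ident C A"] is_isoI[of "ident C B" B B "ident C B"] c
      by (simp_all add: mem_Hom)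
  qed (use c t(3) in \<open>simp_all add: mem_Hom\<close>)
  then show ?thesis using c by (simp add: conflation_def mem_Hom)
qed

text \<open>\<open>ex_pushout\<close> produces a conflation along one side of the square only. The
  pushout \<open>P2\<close> formed along the other side has the same universal property as
  \<open>P\<close>, so its conflation is transported along the resulting isomorphism.\<close>

lemma pushout_symmetric:
  assumes c1: "conflation C A i N p D" and c2: "conflation C A f X q F"
    and c3: "conflation C X i' P p' D" and b: "b \<in> Hom C N P"
    and eq: "b \<cdot> i = i' \<cdot> f" "p' \<cdot> b = p"
  obtains q' where "conflation C N b P q' F" "q' \<cdot> i' = q"
proof -
  note c = conflationD[OF c1] conflationD[OF c2] conflationD[OF c3] b[unfolded mem_Hom]
  obtain P2 b2 q2 i2 where c4: "conflation C N b2 P2 q2 F" and i2: "i2 \<in> Hom C X P2"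
    and eq2: "i2 \<cdot> f = b2 \<cdot> i" "q2 \<cdot> i2 = q"
    and univ: "\<And>T x y. \<lbrakk>x \<in> Hom C N T; y \<in> Hom C X T; x \<cdot> i = y \<cdot> f\<rbrakk>
      \<Longrightarrow> \<exists>u \<in> Hom C P2 T. u \<cdot> b2 = x \<and> u \<cdot> i2 = y"
    using ex_pushout[OF c2 conflationD(14)[OF c1]] by metis
  note c = c conflationD[OF c4] i2[unfolded mem_Hom]
  obtain t where t: "t \<in> Hom C P2 P" "t \<cdot> b2 = b" "t \<cdot> i2 = i'"
    using univ[OF b conflationD(14)[OF c3] eq(1)] by blast
  obtain t' where t': "t' \<in> Hom C P P2" "t' \<cdot> i' = i2" "t' \<cdot> b = b2"
    using pushout_univ[OF c1 c3 conflationD(14)[OF c2] b eq i2 conflationD(14)[OF c4] eq2(1)]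
    by blast
  note c = c t(1)[unfolded mem_Hom] t'(1)[unfolded mem_Hom]
  have 1: "t' \<cdot> t = ident C P2"
    by (rule pushout_joint_epi[OF c2 c4 i2 eq2(2)]) (use c t t' in \<open>simp_all add: mem_Hom\<close>)
  have 2: "t \<cdot> t' = ident C P"
    by (rule pushout_joint_epi[OF c1 c3 b eq(2)]) (use c t t' in \<open>simp_all add: mem_Hom\<close>)
  have "conflation C N b P (q2 \<cdot> t') F"
    using conflation_iso_middle[OF c4 t(1) t'(1) 1 2] t(2) by simp
  moreover have "q2 \<cdot> t' \<cdot> i' = q" using c t' eq2 by simp
  ultimately show ?thesis by (rule that)
qed

text \<open>The conflation \<open>A \<rightarrow> N \<oplus> X \<rightarrow> P\<close> of a pushout
  square. \<open>Q\<close> is constructed as the pullback of \<open>p\<close> and \<open>p'\<close>,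
  which yields the conflation at once; the biproduct structure is then read off from the universal
  property.\<close>

lemma pushout_biproduct:
  assumes c1: "conflation C A i N p D" and c2: "conflation C X i' P p' D"
    and f: "f \<in> Hom C A X" and b: "b \<in> Hom C N P"
    and eq: "b \<cdot> i = i' \<cdot> f" "p' \<cdot> b = p"
  obtains Q k r n x where "conflation C A k Q r P" "is_direct_sum C N X Q"
    "n \<in> Hom C Q N" "n \<cdot> k = i" "x \<in> Hom C Q X" "x \<cdot> k = f"
proof -
  note c = conflationD[OF c1] conflationD[OF c2] b[unfolded mem_Hom] f[unfolded mem_Hom]
  obtain k Q r n where Q: "conflation C A k Q r P" "n \<in> Hom C Q N" "p \<cdot> n = p' \<cdot> r" "n \<cdot> k = i"
    using ex_pullback[OF c1 conflationD(15)[OF c2]] by metis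
  note c = c conflationD[OF Q(1)] Q(2)[unfolded mem_Hom]
  note univ = pullback_univ[OF c1 Q(1) conflationD(15)[OF c2] Q(2,3,4)]
  note jm = pullback_joint_mono[OF c1 Q(1,2,4)]
  have "ident C N \<in> Hom C N N" "p' \<cdot> b = p \<cdot> ident C N" using c eq by (simp_all add: mem_Hom)
  then obtain s where s: "s \<in> Hom C N Q" "r \<cdot> s = b" "n \<cdot> s = ident C N"
    using univ[OF b] by blast
  have "zero_arr C X N \<in> Hom C X N" "p' \<cdot> i' = p \<cdot> zero_arr C X N"
    using c eq by (simp_all add: mem_Hom)
  then obtain s' where s': "s' \<in> Hom C X Q" "r \<cdot> s' = i'" "n \<cdot> s' = zero_arr C X N"
    using univ[OF conflationD(14)[OF c2]] by blast
  note c = c s(1)[unfolded mem_Hom] s'(1)[unfolded mem_Hom]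
  have "add_arr C r (neg_arr C (b \<cdot> n)) \<in> Hom C Q P" using c by (simp add: mem_Hom)
  moreover have "p' \<cdot> add_arr C r (neg_arr C (b \<cdot> n)) = zero_arr C Q D"
    using c Q(3) by (simp add: comp_reassoc[OF eq(2)])
  ultimately obtain x where x: "x \<in> Hom C Q X" "i' \<cdot> x = add_arr C r (neg_arr C (b \<cdot> n))"
    using conflation_factor[OF c2] by blast
  note c = c x(1)[unfolded mem_Hom]
  have x_comp: "i' \<cdot> (x \<cdot> v) = add_arr C (r \<cdot> v) (neg_arr C (b \<cdot> (n \<cdot> v)))"
    if "v \<in> Hom C S Q" for v S
    using c that comp_reassoc[OF x(2), of v] by (simp add: mem_Hom)
  have "i' \<cdot> (x \<cdot> k) = i' \<cdot> neg_arr C f"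
    using c x_comp[of k A] Q(4) eq(1) by (simp add: mem_Hom)
  then have xk: "x \<cdot> k = neg_arr C f"
    by (rule conflation_mono[OF c2]) (use c in \<open>simp_all add: mem_Hom\<close>)
  have "i' \<cdot> (x \<cdot> s') = i' \<cdot> ident C X" using c x_comp[OF s'(1)] s' by simp
  then have xs': "x \<cdot> s' = ident C X"
    by (rule conflation_mono[OF c2]) (use c in \<open>simp_all add: mem_Hom\<close>)
  have "i' \<cdot> (x \<cdot> s) = i' \<cdot> zero_arr C N X" using c x_comp[OF s(1)] s by simp
  then have xs: "x \<cdot> s = zero_arr C N X"
    by (rule conflation_mono[OF c2]) (use c in \<open>simp_all add: mem_Hom\<close>)
  have "add_arr C (s \<cdot> n) (s' \<cdot> x) = ident C Q"
  proof (rule jm)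
    show "r \<cdot> add_arr C (s \<cdot> n) (s' \<cdot> x) = r \<cdot> ident C Q"
      using c x(2) add_left_commute[of "b \<cdot> n" r "neg_arr C (b \<cdot> n)"]
      by (simp add: comp_reassoc[OF s(2)] comp_reassoc[OF s'(2)])
    show "n \<cdot> add_arr C (s \<cdot> n) (s' \<cdot> x) = n \<cdot> ident C Q"
      using c by (simp add: comp_reassoc[OF s(3)] comp_reassoc[OF s'(3)])
  qed (use c in \<open>simp_all add: mem_Hom\<close>)
  then have "is_direct_sum C N X Q"
    unfolding is_direct_sum_def using c s s' x(1) xs xs' Q(2) by blast
  \<comment> \<open>The projection \<open>x\<close> of the direct sum has
    \<open>x \<cdot> k = - f\<close>; its negative is the arrow asked for in the conclusion.\<close>
  moreover have "neg_arr C x \<in> Hom C Q X" "neg_arr C x \<cdot> k = f" using c xk by (simp_all add: mem_Hom)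
  ultimately show ?thesis using that[OF Q(1) _ Q(2,4)] by blast
qed

text \<open>The conflation is pulled back along the projection \<open>T \<rightarrow> P\<close>. The
  subobject \<open>Z\<close> is unchanged, and the middle term gains the same summand as the
  quotient.\<close>

lemma conflation_add_summand:
  assumes c1: "conflation C Z a G r P" and S: "is_direct_sum C P M T"
  obtains G' a' r' where "conflation C Z a' G' r' T" "is_direct_sum C G M G'"
proof -
  from S obtain i1 i2 p1 p2 where S: "i1 \<in> Hom C P T" "i2 \<in> Hom C M T" "p1 \<in> Hom C T P"
    "p2 \<in> Hom C T M" "p1 \<cdot> i1 = ident C P" "p2 \<cdot> i2 = ident C M" "p1 \<cdot> i2 = zero_arr C M P"
    "p2 \<cdot> i1 = zero_arr C P M" "add_arr C (i1 \<cdot> p1) (i2 \<cdot> p2) = ident C T"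
    "M \<in> obj C" "T \<in> obj C"
    unfolding is_direct_sum_def by blast
  note c = conflationD[OF c1] S(1-4)[unfolded mem_Hom] S(10-11)
  obtain a' G' r' e where G': "conflation C Z a' G' r' T" "e \<in> Hom C G' G" "r \<cdot> e = p1 \<cdot> r'"
    "e \<cdot> a' = a"
    using ex_pullback[OF c1 S(3)] by metis
  note c = c conflationD[OF G'(1)] G'(2)[unfolded mem_Hom]
  note univ = pullback_univ[OF c1 G'(1) S(3) G'(2,3,4)]
  note jm = pullback_joint_mono[OF c1 G'(1,2,4)]
  have "i1 \<cdot> r \<in> Hom C G T" "ident C G \<in> Hom C G G" "p1 \<cdot> (i1 \<cdot> r) = r \<cdot> ident C G"
    using c by (simp_all add: mem_Hom comp_reassoc[OF S(5)])
  then obtain s where s: "s \<in> Hom C G G'" "r' \<cdot> s = i1 \<cdot> r" "e \<cdot> s = ident C G"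
    using univ by blast
  have "zero_arr C M G \<in> Hom C M G" "p1 \<cdot> i2 = r \<cdot> zero_arr C M G"
    using c S(7) by (simp_all add: mem_Hom)
  then obtain k where k: "k \<in> Hom C M G'" "r' \<cdot> k = i2" "e \<cdot> k = zero_arr C M G"
    using univ[OF S(2)] by blast
  note c = c s(1)[unfolded mem_Hom] k(1)[unfolded mem_Hom]
  have S9: "add_arr C (i1 \<cdot> (p1 \<cdot> r')) (i2 \<cdot> (p2 \<cdot> r')) = r'"
    using c arg_cong[OF S(9), of "\<lambda>x. x \<cdot> r'"] by simp
  have "add_arr C (s \<cdot> e) (k \<cdot> (p2 \<cdot> r')) = ident C G'"
  proof (rule jm)
    show "r' \<cdot> add_arr C (s \<cdot> e) (k \<cdot> (p2 \<cdot> r')) = r' \<cdot> ident C G'"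
      using c S9 G'(3) by (simp add: comp_reassoc[OF s(2)] comp_reassoc[OF k(2)])
    show "e \<cdot> add_arr C (s \<cdot> e) (k \<cdot> (p2 \<cdot> r')) = e \<cdot> ident C G'"
      using c by (simp add: comp_reassoc[OF s(3)] comp_reassoc[OF k(3)])
  qed (use c in \<open>simp_all add: mem_Hom\<close>)
  moreover have "p2 \<cdot> r' \<cdot> k = ident C M" using c k S by simp
  moreover have "p2 \<cdot> r' \<cdot> s = zero_arr C G M" using c s S by (simp add: comp_reassoc[OF S(8)])
  moreover have "p2 \<cdot> r' \<in> Hom C G' M" using c by (simp add: mem_Hom)
  ultimately have "is_direct_sum C G M G'"
    unfolding is_direct_sum_def using c s k G'(2) by blast
  then show ?thesis using that G'(1) by blast
qed

text \<open>Merges the summands gained at successive steps of the final induction into one.\<close>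

lemma direct_sum_assoc:
  assumes Q: "is_direct_sum C N E Q" and G: "is_direct_sum C Q M G" and S: "is_direct_sum C N M S"
  shows "is_direct_sum C E S G"
proof -
  from Q obtain i1 i2 p1 p2 where Q: "i1 \<in> Hom C N Q" "i2 \<in> Hom C E Q" "p1 \<in> Hom C Q N"
    "p2 \<in> Hom C Q E" "p1 \<cdot> i1 = ident C N" "p2 \<cdot> i2 = ident C E" "p1 \<cdot> i2 = zero_arr C E N"
    "p2 \<cdot> i1 = zero_arr C N E" "add_arr C (i1 \<cdot> p1) (i2 \<cdot> p2) = ident C Q"
    unfolding is_direct_sum_def by blast
  from G obtain j1 j2 q1 q2 where G: "j1 \<in> Hom C Q G" "j2 \<in> Hom C M G" "q1 \<in> Hom C G Q"
    "q2 \<in> Hom C G M" "q1 \<cdot> j1 = ident C Q" "q2 \<cdot> j2 = ident C M" "q1 \<cdot> j2 = zero_arr C M Q"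
    "q2 \<cdot> j1 = zero_arr C Q M" "add_arr C (j1 \<cdot> q1) (j2 \<cdot> q2) = ident C G"
    unfolding is_direct_sum_def by blast
  from S obtain k1 k2 r1 r2 where S: "k1 \<in> Hom C N S" "k2 \<in> Hom C M S" "r1 \<in> Hom C S N"
    "r2 \<in> Hom C S M" "r1 \<cdot> k1 = ident C N" "r2 \<cdot> k2 = ident C M" "r1 \<cdot> k2 = zero_arr C M N"
    "r2 \<cdot> k1 = zero_arr C N M" "add_arr C (k1 \<cdot> r1) (k2 \<cdot> r2) = ident C S"
    unfolding is_direct_sum_def by blast
  note o = Hom_obj[OF Q(1)] Hom_obj[OF Q(2)] Hom_obj[OF G(1)] Hom_obj[OF G(2)] Hom_obj[OF S(1)]
  note c = Q(1-4)[unfolded mem_Hom] G(1-4)[unfolded mem_Hom] S(1-4)[unfolded mem_Hom] o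
  note r = Q(5-8) G(5-8) S(5-8) Q(5-8)[THEN comp_reassoc] G(5-8)[THEN comp_reassoc]
    S(5-8)[THEN comp_reassoc]
  define i' where "i' = add_arr C (j1 \<cdot> (i1 \<cdot> r1)) (j2 \<cdot> r2)"
  define p' where "p' = add_arr C (k1 \<cdot> (p1 \<cdot> q1)) (k2 \<cdot> q2)"
  have QG: "add_arr C (j1 \<cdot> (i1 \<cdot> (p1 \<cdot> q1))) (j1 \<cdot> (i2 \<cdot> (p2 \<cdot> q1))) = j1 \<cdot> q1"
    using c arg_cong[OF Q(9), of "\<lambda>x. j1 \<cdot> x \<cdot> q1"] by simp
  have "j1 \<cdot> i2 \<in> Hom C E G" "i' \<in> Hom C S G" "p2 \<cdot> q1 \<in> Hom C G E" "p' \<in> Hom C G S"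
    using c by (simp_all add: i'_def p'_def mem_Hom)
  moreover have "p2 \<cdot> q1 \<cdot> (j1 \<cdot> i2) = ident C E" using c r by simp
  moreover have "p' \<cdot> i' = ident C S" using c r S(9) by (simp add: i'_def p'_def)
  moreover have "p2 \<cdot> q1 \<cdot> i' = zero_arr C S E" using c r by (simp add: i'_def)
  moreover have "p' \<cdot> (j1 \<cdot> i2) = zero_arr C E S" using c r by (simp add: p'_def)
  moreover have "add_arr C (j1 \<cdot> i2 \<cdot> (p2 \<cdot> q1)) (i' \<cdot> p') = ident C G"
  proof -
    have "i' \<cdot> p' = add_arr C (j1 \<cdot> (i1 \<cdot> (p1 \<cdot> q1))) (j2 \<cdot> q2)"
      using c r by (simp add: i'_def p'_def)
    then have "add_arr C (j1 \<cdot> i2 \<cdot> (p2 \<cdot> q1)) (i' \<cdot> p') =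
        add_arr C (add_arr C (j1 \<cdot> (i1 \<cdot> (p1 \<cdot> q1))) (j1 \<cdot> (i2 \<cdot> (p2 \<cdot> q1)))) (j2 \<cdot> q2)"
      using c add_left_commute[of "j1 \<cdot> (i2 \<cdot> (p2 \<cdot> q1))" "j1 \<cdot> (i1 \<cdot> (p1 \<cdot> q1))" "j2 \<cdot> q2"]
      by simp
    then show ?thesis using G(9) QG by simp
  qed
  ultimately show ?thesis unfolding is_direct_sum_def using o by blast
qed

section \<open>Split conflations and conflations with a zero end\<close>

lemma ex_conflation_ident:
  assumes "A \<in> obj C"
  obtains T where "conflation C A (ident C A) A (zero_arr C A T) T" "T \<in> obj C"
proof -
  obtain E g T where c: "conflation C (src C (ident C A)) (ident C A) E g T"
    using ident_inflation[OF assms] inflationE by metis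
  note cd = conflationD[OF c]
  have "E = A" using cd(3) assms by simp
  moreover have "g = zero_arr C A T" using cd assms by simp
  ultimately show ?thesis using c cd(10) that assms by simp
qed

text \<open>The cokernel \<open>Z\<close> of the identity stands in for zero: the product of
  \<open>A\<close> and \<open>X\<close> is the pullback over \<open>Z\<close>, so that it arrives
  together with its conflation.\<close>

lemma ex_split_conflation:
  assumes A: "A \<in> obj C" and X: "X \<in> obj C"
  obtains E f g e where "conflation C A f E g X" "e \<in> Hom C E A" "e \<cdot> f = ident C A"
    "\<And>T x y. \<lbrakk>x \<in> Hom C T A; y \<in> Hom C T X\<rbrakk> \<Longrightarrow> \<exists>u \<in> Hom C T E. e \<cdot> u = x \<and> g \<cdot> u = y"
    "\<And>T u v. \<lbrakk>u \<in> Hom C T E; v \<in> Hom C T E; e \<cdot> u = e \<cdot> v; g \<cdot> u = g \<cdot> v\<rbrakk> \<Longrightarrow> u = v"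
proof -
  obtain Z where Z: "conflation C A (ident C A) A (zero_arr C A Z) Z" and Zo: "Z \<in> obj C"
    using ex_conflation_ident[OF A] .
  have 0: "zero_arr C X Z \<in> Hom C X Z" using X Zo by (simp add: mem_Hom)
  obtain f E g e where E: "conflation C A f E g X" "e \<in> Hom C E A"
    "zero_arr C A Z \<cdot> e = zero_arr C X Z \<cdot> g" "e \<cdot> f = ident C A"
    using ex_pullback[OF Z 0] by metis
  have "\<exists>u \<in> Hom C T E. e \<cdot> u = x \<and> g \<cdot> u = y" if h: "x \<in> Hom C T A" "y \<in> Hom C T X" for T x y
  proof -
    have "zero_arr C X Z \<cdot> y = zero_arr C A Z \<cdot> x" using h A X Zo by (simp add: mem_Hom)
    then show ?thesis using pullback_univ[OF Z E(1) 0 E(2,3,4) h(2,1)] by metis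
  qed
  moreover have "u = v"
    if "u \<in> Hom C T E" "v \<in> Hom C T E" "e \<cdot> u = e \<cdot> v" "g \<cdot> u = g \<cdot> v" for T u v
    using pullback_joint_mono[OF Z E(1,2,4) that(1,2,4,3)] .
  ultimately show ?thesis using that[OF E(1,2,4)] by blast
qed

lemma conflation_zero_iso:
  assumes c: "conflation C A f E g B" and Z: "is_zero_object C A"
  shows "is_iso C g"
proof -
  note cd = conflationD[OF c]
  have "f = zero_arr C A E" using is_zero_objectD[OF Z cd(14)] .
  then have "ident C E \<in> Hom C E E" "ident C E \<cdot> f = zero_arr C A E"
    using cd by (simp_all add: mem_Hom)
  then obtain u where u: "u \<in> Hom C B E" "u \<cdot> g = ident C E"
    using conflation_cofactor[OF c] by metis
  have "g \<cdot> u \<cdot> g = ident C B \<cdot> g" using u cd by (simp add: mem_Hom)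
  then have "g \<cdot> u = ident C B"
    by (rule conflation_epi[OF c]) (use u cd in \<open>simp_all add: mem_Hom\<close>)
  then show ?thesis using is_isoI[OF cd(15) u(1)] u(2) by blast
qed

lemma ex_conflation_zero:
  assumes "A \<in> obj C"
  obtains Z f where "conflation C Z f A (ident C A) A" "is_zero_object C Z"
proof -
  obtain T where "conflation C T (zero_arr C T A) A (ident C A) A" "T \<in> obj C"
    using exact_category.ex_conflation_ident[OF exact_op, unfolded op_cat_defs op_cat_simps,
        OF assms] by metis
  moreover from this have "ident C T = zero_arr C T T"
    using conflation_mono[OF \<open>conflation C T _ _ _ _\<close>, of "ident C T" "zero_arr C T T" T] assms
    by (simp add: mem_Hom)
  ultimately show ?thesis using that is_zero_objectI by blast
qed

end

section \<open>Yoneda extensions\<close>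

text \<open>
  A list of \<open>n\<close> conflations spliced together, as in \<^const>\<open>extensions\<close>, but with \<open>n = 0\<close>
  allowed; \<open>A\<close> is the left end and \<open>B\<close> the right end.
\<close>

inductive chain :: "('o, 'm, 'x) exact_cat_scheme \<Rightarrow> 'o \<Rightarrow> ('m \<times> 'm) list \<Rightarrow> 'o \<Rightarrow> bool"
  for C A where
  Nil: "A \<in> obj C \<Longrightarrow> chain C A [] A"
| snoc: "\<lbrakk>chain C A xs K; conflation C K f E g B\<rbrakk> \<Longrightarrow> chain C A (xs @ [(f, g)]) B"

text \<open>The component at the left end is a parameter and the one at the right end an index.
  Inductions then keep the left end fixed while the right end varies, and the middle components stay
  hidden.\<close>

inductive chain_mor ::
  "('o, 'm, 'x) exact_cat_scheme \<Rightarrow> 'm \<Rightarrow> ('m \<times> 'm) list \<Rightarrow> ('m \<times> 'm) list \<Rightarrow> 'm \<Rightarrow> bool"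
  for C a where
  Nil: "a \<in> arr C \<Longrightarrow> chain_mor C a [] [] a"
| snoc: "\<lbrakk>chain_mor C a xs ys k; conflation C K f E g B; conflation C K' f' E' g' B';
    k \<in> Hom C K K'; e \<in> Hom C E E'; b \<in> Hom C B B'; e \<cdot>\<^bsub>C\<^esub> f = f' \<cdot>\<^bsub>C\<^esub> k;
    b \<cdot>\<^bsub>C\<^esub> g = g' \<cdot>\<^bsub>C\<^esub> e\<rbrakk> \<Longrightarrow> chain_mor C a (xs @ [(f, g)]) (ys @ [(f', g')]) b"

text \<open>
  The pushout along \<open>a\<close> of the \<open>n\<close>-extension \<open>xs\<close> is zero: \<open>a\<close> extends to a morphism from \<open>xs\<close>
  to an \<open>n\<close>-extension of the zero object.
\<close>

inductive null_ext ::
  "('o, 'm, 'x) exact_cat_scheme \<Rightarrow> 'o \<Rightarrow> ('m \<times> 'm) list \<Rightarrow> bool"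
  for C A where
  "\<lbrakk>conflation C K f E g B; chain C A ys L; chain_mor C (ident C A) xs ys b;
    b \<in> Hom C K L; h \<in> Hom C E L; h \<cdot>\<^bsub>C\<^esub> f = b\<rbrakk> \<Longrightarrow> null_ext C A (xs @ [(f, g)])"

context exact_category
begin

lemma chain_snocE:
  assumes "chain C A (xs @ [p]) B"
  obtains f g K E where "p = (f, g)" "chain C A xs K" "conflation C K f E g B"
  using assms by (cases rule: chain.cases) auto

lemma chain_Nil_iff: "chain C A [] B \<longleftrightarrow> A \<in> obj C \<and> A = B"
  by (auto intro: chain.Nil elim: chain.cases)

lemma chain_obj: "chain C A xs B \<Longrightarrow> A \<in> obj C \<and> B \<in> obj C"
  by (induction rule: chain.induct) (auto dest: conflationD)

lemma chain_mor_snocE: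
  assumes "chain_mor C a (xs @ [(f, g)]) zs b"
  obtains ys f' g' k K E B K' E' B' e where "zs = ys @ [(f', g')]" "chain_mor C a xs ys k"
    "conflation C K f E g B" "conflation C K' f' E' g' B'" "k \<in> Hom C K K'" "e \<in> Hom C E E'"
    "b \<in> Hom C B B'" "e \<cdot> f = f' \<cdot> k" "b \<cdot> g = g' \<cdot> e"
  using assms by (cases rule: chain_mor.cases) auto

lemma chain_mor_Nil_iff: "chain_mor C a [] ys b \<longleftrightarrow> ys = [] \<and> b = a \<and> a \<in> arr C"
  by (auto intro: chain_mor.Nil elim: chain_mor.cases)

text \<open>\<open>chain\<close>, \<open>chain_mor\<close> and \<open>null_ext\<close> each hide
  their own objects. Since arrows determine their ends, objects obtained from different eliminations
  can be identified.\<close>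

lemma conflation_unique:
  assumes "conflation C A f E g B" "conflation C A' f E' g B'"
  shows "A' = A" "E' = E" "B' = B"
  using assms by (auto simp: conflation_def mem_Hom)

lemma chain_snoc_conflation:
  assumes "chain C A (xs @ [(f, g)]) B" "conflation C K' f E' g B'"
  shows "chain C A xs K'" "B = B'"
proof -
  obtain K E where "chain C A xs K" "conflation C K f E g B"
    using assms(1) by (auto elim: chain_snocE)
  then show "chain C A xs K'" "B = B'" using conflation_unique[OF _ assms(2)] by metis+
qed

lemma chain_mor_Hom:
  "\<lbrakk>chain_mor C a xs ys b; chain C A xs B; chain C A' ys B'; a \<in> Hom C A A'\<rbrakk> \<Longrightarrow> b \<in> Hom C B B'"
proof (induction arbitrary: B B' rule: chain_mor.induct)
  case Nil
  then show ?case by (auto simp: chain_Nil_iff)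
next
  case (snoc xs ys k K f E g B1 K' f' E' g' B1' e b)
  from \<open>chain C A (xs @ _) B\<close> \<open>chain C A' (ys @ _) B'\<close> obtain L F L' F'
    where "conflation C L f F g B" "conflation C L' f' F' g' B'"
    by (auto elim!: chain_snocE)
  then show ?case using snoc conflation_unique by metis
qed

lemma chain_mor_length: "chain_mor C a xs ys b \<Longrightarrow> length xs = length ys"
  by (induction rule: chain_mor.induct) auto

lemma chain_mor_comp:
  "\<lbrakk>chain_mor C a xs ys b; chain_mor C a' ys zs b'; a \<in> Hom C A A'; a' \<in> Hom C A' A'';
    chain C A xs B; chain C A' ys B'\<rbrakk>
    \<Longrightarrow> chain_mor C (a' \<cdot> a) xs zs (b' \<cdot> b)"
proof (induction arbitrary: B B' zs b' rule: chain_mor.induct)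
  case Nil
  then show ?case by (auto simp: chain_mor_Nil_iff mem_Hom)
next
  case (snoc xs ys k K f E g B1 K' f' E' g' B1' e b)
  from \<open>chain_mor C a' (ys @ _) zs b'\<close> obtain zs1 f'' g'' k' E'' K'' B'' e' K1 E1 BB1
    where z: "zs = zs1 @ [(f'', g'')]" "chain_mor C a' ys zs1 k'"
    "conflation C K1 f' E1 g' BB1" "conflation C K'' f'' E'' g'' B''" "k' \<in> Hom C K1 K''"
    "e' \<in> Hom C E1 E''" "b' \<in> Hom C BB1 B''" "e' \<cdot> f' = f'' \<cdot> k'" "b' \<cdot> g' = g'' \<cdot> e'"
    by (elim chain_mor_snocE)
  note u = conflation_unique[OF snoc(3) z(3)]
  note c = conflationD[OF snoc(2)] conflationD[OF snoc(3)] conflationD[OF z(4)]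
    snoc(4-6)[unfolded mem_Hom] z(5-7)[unfolded u mem_Hom]
  obtain L L' where L: "chain C A xs L" "chain C A' ys L'"
    using \<open>chain C A (xs @ _) B\<close> \<open>chain C A' (ys @ _) B'\<close> by (auto elim!: chain_snocE)
  have "chain_mor C (a' \<cdot> a) xs zs1 (k' \<cdot> k)"
    using snoc.IH[OF z(2) snoc.prems(2,3) L] .
  then show ?case unfolding z(1)
  proof (rule chain_mor.snoc[OF _ snoc(2) z(4)])
    show "e' \<cdot> e \<in> Hom C E E''" "k' \<cdot> k \<in> Hom C K K''" "b' \<cdot> b \<in> Hom C B1 B''"
      using c by (simp_all add: mem_Hom)
    show "e' \<cdot> e \<cdot> f = f'' \<cdot> (k' \<cdot> k)"
      using c snoc(7) by (simp add: comp_reassoc[OF z(8)])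
    show "b' \<cdot> b \<cdot> g = g'' \<cdot> (e' \<cdot> e)"
      using c snoc(8) by (simp add: comp_reassoc[OF z(9)])
  qed
qed

lemma chain_mor_ident:
  "chain C A xs B \<Longrightarrow> chain_mor C (ident C A) xs xs (ident C B)"
proof (induction rule: chain.induct)
  case Nil
  then show ?case by (simp add: chain_mor.Nil)
next
  case (snoc xs K f E g B)
  note c = conflationD[OF snoc(2)]
  show ?case
    by (rule chain_mor.snoc[OF snoc(3,2,2), of "ident C E"]) (use c in \<open>simp_all add: mem_Hom\<close>)
qed

text \<open>A pullback at the right end changes the last conflation only. The second clause is its
  universal property: a morphism into the old chain whose right component factors through
  \<open>b\<close> lifts to the new one.\<close>

lemma chain_pullback:
  assumes "chain C A (xs @ [(f, g)]) B" "b \<in> Hom C B' B"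
  obtains f' g' where "chain C A (xs @ [(f', g')]) B'"
    "\<And>a ws A'' B'' c. \<lbrakk>chain_mor C a ws (xs @ [(f, g)]) (b \<cdot> c); c \<in> Hom C B'' B'; chain C A'' ws B''\<rbrakk>
      \<Longrightarrow> chain_mor C a ws (xs @ [(f', g')]) c"
proof -
  from assms(1) obtain K E where K: "chain C A xs K" "conflation C K f E g B"
    by (auto elim: chain_snocE)
  obtain f' E' g' e where P: "conflation C K f' E' g' B'" "e \<in> Hom C E' E" "g \<cdot> e = b \<cdot> g'"
    "e \<cdot> f' = f"
    using ex_pullback[OF K(2) assms(2)] by metis
  note [simp] = conflationD(1-10)[OF K(2)] conflationD(1-10)[OF P(1)] P(2)[unfolded mem_Hom]
    assms(2)[unfolded mem_Hom]
  have "chain_mor C a ws (xs @ [(f', g')]) c"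
    if m: "chain_mor C a ws (xs @ [(f, g)]) (b \<cdot> c)" and c: "c \<in> Hom C B'' B'"
      and ws: "chain C A'' ws B''" for a ws c A'' B''
  proof -
    from chain_mor_length[OF m] have "ws \<noteq> []" by auto
    then obtain ws1 f1 g1 where w: "ws = ws1 @ [(f1, g1)]" by (metis rev_exhaust surj_pair)
    obtain ys fy gy k K1 E1 B1 Ky Ey By v where y: "xs @ [(f, g)] = ys @ [(fy, gy)]"
      "chain_mor C a ws1 ys k" "conflation C K1 f1 E1 g1 B1" "conflation C Ky fy Ey gy By"
      "k \<in> Hom C K1 Ky" "v \<in> Hom C E1 Ey" "v \<cdot> f1 = fy \<cdot> k" "b \<cdot> c \<cdot> g1 = gy \<cdot> v"
      using m unfolding w by (elim chain_mor_snocE)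
    then have [simp]: "ys = xs" "fy = f" "gy = g" by auto
    note u [simp] = conflation_unique[OF K(2) y(4)[simplified]]
      chain_snoc_conflation(2)[OF ws[unfolded w] y(3)]
    note [simp] = conflationD(1-10)[OF y(3)] y(5,6)[unfolded mem_Hom u] c[unfolded mem_Hom]
    have "c \<cdot> g1 \<in> Hom C E1 B'" "v \<in> Hom C E1 E" "b \<cdot> (c \<cdot> g1) = g \<cdot> v"
      using y(8) by (simp_all add: mem_Hom)
    then obtain e' where e': "e' \<in> Hom C E1 E'" "g' \<cdot> e' = c \<cdot> g1" "e \<cdot> e' = v"
      using pullback_univ[OF K(2) P(1) assms(2) P(2,3,4)] by metis
    note [simp] = e'(1)[unfolded mem_Hom]
    have "e' \<cdot> f1 = f' \<cdot> k"
      by (rule pullback_joint_mono[OF K(2) P(1,2,4)])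
        (use y(7) in \<open>simp_all add: mem_Hom comp_reassoc[OF e'(2)] comp_reassoc[OF e'(3)]
          comp_reassoc[OF P(4)] comp_reassoc[OF conflationD(7)[OF P(1)]]\<close>)
    then show ?thesis unfolding w
      by (intro chain_mor.snoc[OF _ y(3) P(1) _ e'(1)])
        (use y(2) e'(2) in \<open>simp_all add: mem_Hom\<close>)
  qed
  then show ?thesis using that chain.snoc[OF K(1) P(1)] by blast
qed

lemma null_extE:
  assumes "null_ext C A (xs @ [(f, g)])"
  obtains K E B ys L b h where "conflation C K f E g B" "chain C A ys L"
    "chain_mor C (ident C A) xs ys b" "b \<in> Hom C K L" "h \<in> Hom C E L" "h \<cdot> f = b"
  using assms by (cases rule: null_ext.cases) auto

text \<open>
  Two morphisms \<open>xs \<rightarrow> xs' \<rightarrow> zs'\<close> and \<open>xs \<rightarrow> zs \<rightarrow> zs'\<close> that agree on the left end need only agree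
  on the right end up to homotopy. Enlarging the last middle term of \<open>zs'\<close>, one arranges that
  the difference extends along a given inflation \<open>i\<close>.
\<close>

lemma chain_mor_amalgam:
  assumes "chain_mor C k xs xs' c" "chain_mor C (a \<cdot> k) xs zs b" "chain C B xs K"
    "chain C B' xs' K'" "chain C A zs L" "k \<in> Hom C B B'" "a \<in> Hom C B' A"
    "conflation C K i F p Q"
  shows "\<exists>zs' L' b' g t. chain C A zs' L' \<and> chain_mor C a xs' zs' b' \<and> b' \<in> Hom C K' L' \<and>
    g \<in> Hom C L L' \<and> t \<in> Hom C F L' \<and> b' \<cdot> c = add_arr C (g \<cdot> b) (t \<cdot> i)"
  using assms
proof (induction arbitrary: zs b K K' L i F p Q rule: chain_mor.induct)
  case Nil
  then have s: "zs = []" "b = a \<cdot> k" "K = B" "K' = B'" "L = A" "A \<in> obj C"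
    by (auto simp: chain_mor_Nil_iff chain_Nil_iff)
  note c = Nil(6,7)[unfolded mem_Hom] conflationD[OF Nil(8)]
  have "chain_mor C a [] [] a" using c by (intro chain_mor.Nil) simp
  moreover have "chain C A [] A" using s by (intro chain.Nil) simp
  moreover have "a \<cdot> k = add_arr C (ident C A \<cdot> b) (zero_arr C F A \<cdot> i)"
    using s c by simp
  moreover have "ident C A \<in> Hom C L A" "zero_arr C F A \<in> Hom C F A"
    using s c by (simp_all add: mem_Hom)
  ultimately show ?case using Nil(7) s by blast
next
  case (snoc xs xs' c K f E g B1 K' f' E' g' B1' e c1 zs b K1 K1' L i F p Q)
  note sq = snoc(4-8)
  obtain ys j q b0 N J L1 v KK EE BB where zs: "zs = ys @ [(j, q)]" "chain_mor C (a \<cdot> k) xs ys b0"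
    "conflation C N j J q L1" "b0 \<in> Hom C KK N" "v \<in> Hom C EE J" "b \<in> Hom C BB L1"
    "v \<cdot> f = j \<cdot> b0" "b \<cdot> g = q \<cdot> v" "conflation C KK f EE g BB"
    using snoc.prems(1) by (elim chain_mor_snocE) blast
  note u = conflation_unique[OF snoc(2) zs(9)]
  note chs = chain_snoc_conflation[OF snoc.prems(2) snoc(2)]
    and chs' = chain_snoc_conflation[OF snoc.prems(3) snoc(3)]
    and ys = chain_snoc_conflation[OF snoc.prems(4)[unfolded zs(1)] zs(3)]
  note cj = zs(3)
  obtain ys' N' b' m t where IH: "chain C A ys' N'" "chain_mor C a xs' ys' b'"
    "b' \<in> Hom C K' N'" "m \<in> Hom C N N'" "t \<in> Hom C E N'"
    "b' \<cdot> c = add_arr C (m \<cdot> b0) (t \<cdot> f)"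
    using snoc.IH[OF zs(2) chs(1) chs'(1) ys(1) snoc.prems(5,6) snoc(2)] by blast
  \<comment> \<open>\<open>N'\<close> is enlarged by three successive pushouts: \<open>P\<close>
    receives \<open>E'\<close>, \<open>P2\<close> also receives \<open>J\<close>, and
    \<open>J'\<close> also receives \<open>F\<close>, which lets the new homotopy extend along
    \<open>i\<close>.\<close>
  obtain P r1 s1 y1 where P1: "conflation C N' r1 P s1 B1'" "y1 \<in> Hom C E' P"
    "y1 \<cdot> f' = r1 \<cdot> b'"
    using ex_pushout[OF snoc(3) IH(3)] by metis
  have r1m: "r1 \<cdot> m \<in> Hom C N P" using IH(4) conflationD[OF P1(1)] by (simp add: mem_Hom)
  obtain P2 r2 s2 z1 where P2: "conflation C P r2 P2 s2 L1" "z1 \<in> Hom C J P2"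
    "z1 \<cdot> j = r2 \<cdot> (r1 \<cdot> m)"
    using ex_pushout[OF cj r1m] by metis
  note [simp] = conflationD(1-10,16)[OF snoc(2)] conflationD(1-10,16)[OF snoc(3)] conflationD(1-10,16)[OF cj]
    conflationD(1-10,16)[OF P1(1)] conflationD(1-10,16)[OF P2(1)] IH(3-5)[unfolded mem_Hom] sq(1-3)[unfolded mem_Hom]
    zs(4-6)[unfolded u mem_Hom] P1(2)[unfolded mem_Hom] P2(2)[unfolded mem_Hom]
    conflationD(1-10,16)[OF snoc.prems(7)]
  \<comment> \<open>\<open>r2 \<cdot> (y1 \<cdot> e)\<close> and \<open>V\<close> are the two routes
    from \<open>E\<close> to \<open>P2\<close>. The term with \<open>t\<close> makes them agree on
    \<open>K\<close>, so their difference \<open>D\<close> descends to \<open>D1\<close>, the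
    homotopy on the next joint.\<close>
  define V where "V = add_arr C (z1 \<cdot> v) (r2 \<cdot> (r1 \<cdot> t))"
  have V: "V \<in> Hom C E P2" by (simp add: V_def mem_Hom)
  define D where "D = add_arr C (r2 \<cdot> (y1 \<cdot> e)) (neg_arr C V)"
  note [simp] = V[unfolded mem_Hom]
  have D: "D \<in> Hom C E P2" by (simp add: D_def mem_Hom)
  have "y1 \<cdot> (f' \<cdot> c) = r1 \<cdot> (b' \<cdot> c)" by (simp add: comp_reassoc[OF P1(3)])
  then have "r2 \<cdot> (y1 \<cdot> e) \<cdot> f = V \<cdot> f"
    using sq(4) zs(7) by (simp add: V_def IH(6) comp_reassoc[OF P2(3)])
  then have "D \<cdot> f = zero_arr C K P2" unfolding D_def by simp
  then obtain D1 where D1: "D1 \<in> Hom C B1 P2" "D1 \<cdot> g = D"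
    using conflation_cofactor[OF snoc(2) D] by blast
  obtain J' w sw D2 where W: "conflation C P2 w J' sw Q" "D2 \<in> Hom C F J'" "D2 \<cdot> i = w \<cdot> D1"
    using ex_pushout[OF snoc.prems(7)] D1(1) unfolding chs(2) by metis
  note [simp] = conflationD(1-10,16)[OF W(1)] W(2)[unfolded mem_Hom] D1(1)[unfolded mem_Hom]
    D[unfolded mem_Hom]
  define jj where "jj = w \<cdot> (r2 \<cdot> r1)"
  have "inflation C jj" unfolding jj_def by (intro inflation_comp) simp_all
  moreover have jj: "jj \<in> Hom C N' J'" by (simp add: jj_def mem_Hom)
  ultimately obtain q' L' where Cj: "conflation C N' jj J' q' L'"
    using inflationE[of jj] by (auto simp: conflation_def mem_Hom)
  note [simp] = conflationD(1-10,16)[OF Cj]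
  have y: "w \<cdot> (r2 \<cdot> y1) \<in> Hom C E' J'" "w \<cdot> (r2 \<cdot> y1) \<cdot> f' = jj \<cdot> b'"
    using P1(3) by (simp_all add: jj_def mem_Hom)
  have z: "w \<cdot> z1 \<in> Hom C J J'" "w \<cdot> z1 \<cdot> j = jj \<cdot> m"
    using P2(3) by (simp_all add: jj_def mem_Hom)
  have "q' \<cdot> (w \<cdot> (r2 \<cdot> y1)) \<in> Hom C E' L'" using y by (simp add: mem_Hom)
  moreover have "q' \<cdot> (w \<cdot> (r2 \<cdot> y1)) \<cdot> f' = zero_arr C K' L'"
  proof -
    have "q' \<cdot> (w \<cdot> (r2 \<cdot> y1)) \<cdot> f' = q' \<cdot> (w \<cdot> (r2 \<cdot> y1) \<cdot> f')" by simp
    also have "\<dots> = zero_arr C K' L'"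
      unfolding y(2) by (simp add: comp_reassoc[OF conflationD(7)[OF Cj]])
    finally show ?thesis .
  qed
  ultimately obtain b1' where b1': "b1' \<in> Hom C B1' L'" "b1' \<cdot> g' = q' \<cdot> (w \<cdot> (r2 \<cdot> y1))"
    using conflation_cofactor[OF snoc(3)] by blast
  have "q' \<cdot> (w \<cdot> z1) \<in> Hom C J L'" using z by (simp add: mem_Hom)
  moreover have "q' \<cdot> (w \<cdot> z1) \<cdot> j = zero_arr C N L'"
  proof -
    have "q' \<cdot> (w \<cdot> z1) \<cdot> j = q' \<cdot> (w \<cdot> z1 \<cdot> j)" by simp
    also have "\<dots> = zero_arr C N L'"
      unfolding z(2) by (simp add: comp_reassoc[OF conflationD(7)[OF Cj]])
    finally show ?thesis .
  qed
  ultimately obtain m1 where m1: "m1 \<in> Hom C L1 L'" "m1 \<cdot> q = q' \<cdot> (w \<cdot> z1)"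
    using conflation_cofactor[OF cj] by blast
  note [simp] = b1'(1)[unfolded mem_Hom] m1(1)[unfolded mem_Hom]
  have q't: "q' \<cdot> (w \<cdot> (r2 \<cdot> (r1 \<cdot> t))) = zero_arr C E L'"
  proof -
    have "q' \<cdot> (w \<cdot> (r2 \<cdot> (r1 \<cdot> t))) = q' \<cdot> (jj \<cdot> t)" by (simp add: jj_def)
    then show ?thesis by (simp add: comp_reassoc[OF conflationD(7)[OF Cj]])
  qed
  have Deq: "r2 \<cdot> (y1 \<cdot> e) = add_arr C V D"
    unfolding D_def using add_left_commute[of V "r2 \<cdot> (y1 \<cdot> e)" "neg_arr C V"] by simp
  have "b1' \<cdot> c1 \<cdot> g = q' \<cdot> (w \<cdot> (r2 \<cdot> (y1 \<cdot> e)))"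
    using sq(5) by (simp add: comp_reassoc[OF b1'(2)])
  also have "\<dots> = add_arr C (q' \<cdot> (w \<cdot> (z1 \<cdot> v))) (q' \<cdot> (w \<cdot> D))"
    unfolding Deq using q't by (simp add: V_def)
  also have "\<dots> = add_arr C (m1 \<cdot> b) (q' \<cdot> D2 \<cdot> i) \<cdot> g"
    by (simp add: zs(8) D1(2) chs(2) comp_reassoc[OF m1(2)] comp_reassoc[OF W(3)])
  finally have "b1' \<cdot> c1 \<cdot> g = add_arr C (m1 \<cdot> b) (q' \<cdot> D2 \<cdot> i) \<cdot> g" .
  then have "b1' \<cdot> c1 = add_arr C (m1 \<cdot> b) (q' \<cdot> D2 \<cdot> i)"
    by (rule conflation_epi[OF snoc(2)]) (use chs(2) in \<open>simp_all add: mem_Hom\<close>)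
  moreover have "chain C A (ys' @ [(jj, q')]) L'" by (rule chain.snoc[OF IH(1) Cj])
  moreover have "chain_mor C a (xs' @ [(f', g')]) (ys' @ [(jj, q')]) b1'"
    by (rule chain_mor.snoc[OF IH(2) snoc(3) Cj IH(3) y(1) b1'(1) y(2) b1'(2)])
  moreover have "q' \<cdot> D2 \<in> Hom C F L'" by (simp add: mem_Hom)
  ultimately show ?case using b1'(1) m1(1) unfolding chs'(2) ys(2) zs(1) by blast
qed

end

section \<open>Comparison with the index-based definition of extensions\<close>

lemma snoc_nth [simp]:
  "i < length xs \<Longrightarrow> (xs @ [p]) ! i = xs ! i" "(xs @ [p]) ! length xs = p"
  by (simp_all add: nth_append)

context exact_category
begin

text \<open>The condition \<open>xs \<noteq> []\<close> occurs on both sides because the empty chain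
  means \<open>A = B\<close>, whereas the indexed formula speaks of a first and a last
  entry.\<close>

lemma chain_iff:
  "chain C B xs A \<and> xs \<noteq> [] \<longleftrightarrow> xs \<noteq> [] \<and> set xs \<subseteq> conflations C \<and>
     src C (fst (xs ! 0)) = B \<and> tgt C (snd (xs ! (length xs - 1))) = A \<and>
     (\<forall>i. Suc i < length xs \<longrightarrow> tgt C (snd (xs ! i)) = src C (fst (xs ! Suc i)))"
proof (induction xs arbitrary: A rule: rev_induct)
  case (snoc p xs)
  obtain f g where p: "p = (f, g)" by force
  have cf: "conflation C K f E g A \<longleftrightarrow>
      (f, g) \<in> conflations C \<and> src C f = K \<and> tgt C f = E \<and> tgt C g = A" for K E
    using conflation_kernel[of f g] by (auto simp: conflation_def mem_Hom is_kernel_def)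
  have sn: "chain C B (xs @ [p]) A \<longleftrightarrow> (\<exists>K E. chain C B xs K \<and> conflation C K f E g A)"
    unfolding p by (auto elim!: chain_snocE intro: chain.snoc)
  show ?case
  proof (cases "xs = []")
    case True
    then show ?thesis
      unfolding sn using conflation_kernel[of f g]
      by (auto simp: p cf chain_Nil_iff is_kernel_def)
  next
    case False
    then have l: "length xs - 1 < length xs" "Suc (length xs - 1) = length xs" by simp_all
    have adj: "(\<forall>i. Suc i < length (xs @ [p]) \<longrightarrow>
          tgt C (snd ((xs @ [p]) ! i)) = src C (fst ((xs @ [p]) ! Suc i))) \<longleftrightarrow>
        (\<forall>i. Suc i < length xs \<longrightarrow> tgt C (snd (xs ! i)) = src C (fst (xs ! Suc i))) \<and>
        tgt C (snd (xs ! (length xs - 1))) = src C f" (is "?L \<longleftrightarrow> ?R")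
    proof
      assume L: ?L
      show ?R
      proof (intro conjI allI impI)
        show "tgt C (snd (xs ! i)) = src C (fst (xs ! Suc i))" if "Suc i < length xs" for i
          using L[rule_format, of i] that by simp
        show "tgt C (snd (xs ! (length xs - 1))) = src C f"
          using L[rule_format, of "length xs - 1"] l p by simp
      qed
    next
      assume R: ?R
      show ?L
      proof (intro allI impI)
        fix i assume "Suc i < length (xs @ [p])"
        then consider "Suc i < length xs" | "Suc i = length xs" by force
        then show "tgt C (snd ((xs @ [p]) ! i)) = src C (fst ((xs @ [p]) ! Suc i))"
        proof cases
          case 1
          then show ?thesis using R by simp
        next
          case 2
          then have "i = length xs - 1" by simp
          then show ?thesis using R l p by simp
        qed
      qed
    qed
    have 0: "(xs @ [p]) ! 0 = xs ! 0" using False by (simp add: nth_append)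
    show ?thesis
      unfolding sn adj 0 using snoc[of "src C f"] False by (auto simp: p cf)
  qed
qed simp

text \<open>The ends change places: \<open>extensions C n A B\<close> names the right end
  \<open>A\<close> first, \<open>chain\<close> the left end.\<close>

lemma extensions_iff:
  "xs \<in> extensions C n A B \<longleftrightarrow> n > 0 \<and> length xs = n \<and> chain C B xs A"
  using chain_iff[of B xs A] unfolding extensions_def by auto

lemma chain_mor_snocD:
  assumes "chain_mor C a (xs @ [(f, g)]) (ys @ [(f', g')]) b"
    and K: "conflation C K f E g B" "conflation C K' f' E' g' B'"
  obtains k e where "chain_mor C a xs ys k" "k \<in> Hom C K K'" "e \<in> Hom C E E'"
    "b \<in> Hom C B B'" "e \<cdot> f = f' \<cdot> k" "b \<cdot> g = g' \<cdot> e"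
proof -
  obtain ys1 f1 g1 k K1 E1 B1 K1' E1' B1' e where m: "ys @ [(f', g')] = ys1 @ [(f1, g1)]"
    "chain_mor C a xs ys1 k" "conflation C K1 f E1 g B1" "conflation C K1' f1 E1' g1 B1'"
    "k \<in> Hom C K1 K1'" "e \<in> Hom C E1 E1'" "b \<in> Hom C B1 B1'" "e \<cdot> f = f1 \<cdot> k"
    "b \<cdot> g = g1 \<cdot> e"
    using assms(1) by (elim chain_mor_snocE)
  from m(1) have e: "ys1 = ys" "f1 = f'" "g1 = g'" by auto
  show ?thesis
    using that m(2-9) unfolding e conflation_unique[OF K(1) m(3)]
      conflation_unique[OF K(2) m(4)[unfolded e]] by blast
qed

lemma chain_mor_iff:
  assumes "chain C B xs A" "chain C B' ys A'" "length xs = n" "length ys = n" "a \<in> Hom C B B'"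
  shows "chain_mor C a xs ys b \<longleftrightarrow> (\<exists>u k. k 0 = a \<and> k n = b \<and>
        (\<forall>i<n. let (f, g) = xs ! i; (f', g') = ys ! i in
           k i \<in> Hom C (src C f) (src C f') \<and>
           u i \<in> Hom C (tgt C f) (tgt C f') \<and>
           k (Suc i) \<in> Hom C (tgt C g) (tgt C g') \<and>
           u i \<cdot> f = f' \<cdot> k i \<and>
           k (Suc i) \<cdot> g = g' \<cdot> u i))"
  using assms
proof (induction xs arbitrary: A A' b ys n rule: rev_induct)
  case Nil
  then show ?case by (auto simp: chain_mor_Nil_iff mem_Hom)
next
  case (snoc p xs)
  obtain f g where p: "p = (f, g)" by force
  define m where "m = length xs"
  from snoc.prems(3,4) have n: "n = Suc m" "length ys = Suc m" by (simp_all add: m_def)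
  then obtain ys1 p' where ys: "ys = ys1 @ [p']" "length ys1 = m"
    by (metis length_Suc_conv_rev)
  obtain f' g' where p': "p' = (f', g')" by force
  obtain K E K' E' where K: "chain C B xs K" "conflation C K f E g A" "chain C B' ys1 K'"
    "conflation C K' f' E' g' A'"
    using snoc.prems(1,2) unfolding p ys p' by (auto elim!: chain_snocE)
  note [simp] = conflationD(1-6)[OF K(2)] conflationD(1-6)[OF K(4)]
  note IH = snoc.IH[OF K(1,3) m_def[symmetric] ys(2) snoc.prems(5)]
  let ?P = "\<lambda>xs ys u k i. let (f, g) = xs ! i; (f', g') = ys ! i in
           k i \<in> Hom C (src C f) (src C f') \<and>
           u i \<in> Hom C (tgt C f) (tgt C f') \<and>
           k (Suc i) \<in> Hom C (tgt C g) (tgt C g') \<and>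
           u i \<cdot> f = f' \<cdot> k i \<and>
           k (Suc i) \<cdot> g = g' \<cdot> u i"
  have P_less: "?P (xs @ [p]) ys u k i = ?P xs ys1 u k i" if "i < m" for u k i
    using that ys by (simp add: m_def)
  have P_last: "?P (xs @ [p]) ys u k m \<longleftrightarrow> k m \<in> Hom C K K' \<and> u m \<in> Hom C E E' \<and>
      k (Suc m) \<in> Hom C A A' \<and> u m \<cdot> f = f' \<cdot> k m \<and> k (Suc m) \<cdot> g = g' \<cdot> u m" for u k
    using snoc_nth(2)[of xs p] snoc_nth(2)[of ys1 p'] ys(2) by (simp add: ys(1) p p' m_def)
  show ?case
  proof
    assume "chain_mor C a (xs @ [p]) ys b"
    then obtain k e where k: "chain_mor C a xs ys1 k" "k \<in> Hom C K K'" "e \<in> Hom C E E'"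
      "b \<in> Hom C A A'" "e \<cdot> f = f' \<cdot> k" "b \<cdot> g = g' \<cdot> e"
      unfolding p ys p' using chain_mor_snocD[OF _ K(2,4)] by metis
    from k(1) obtain u kk where u: "kk 0 = a" "kk m = k" "\<And>i. i < m \<Longrightarrow> ?P xs ys1 u kk i"
      unfolding IH by blast
    have "?P (xs @ [p]) ys (u(m := e)) (kk(Suc m := b)) i" if "i < n" for i
    proof (cases "i = m")
      case True
      then show ?thesis unfolding True P_last using k u by simp
    next
      case False
      then have "i < m" using that n by simp
      then show ?thesis using P_less[of i] u(3)[of i] by simp
    qed
    then show "\<exists>u k. k 0 = a \<and> k n = b \<and> (\<forall>i<n. ?P (xs @ [p]) ys u k i)"
      using u(1) n(1) by - (rule exI[of _ "u(m := e)"], rule exI[of _ "kk(Suc m := b)"], simp)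
  next
    assume "\<exists>u k. k 0 = a \<and> k n = b \<and> (\<forall>i<n. ?P (xs @ [p]) ys u k i)"
    then obtain u k where u: "k 0 = a" "k n = b" "\<And>i. i < n \<Longrightarrow> ?P (xs @ [p]) ys u k i" by blast
    have "chain_mor C a xs ys1 (k m)" unfolding IH
    proof (rule exI[of _ u], rule exI[of _ k], intro conjI allI impI)
      fix i assume i: "i < m"
      show "?P xs ys1 u k i" using u(3)[of i] P_less[OF i] i n by simp
    qed (use u in simp_all)
    moreover have "?P (xs @ [p]) ys u k m" using u(3)[of m] n by blast
    ultimately show "chain_mor C a (xs @ [p]) ys b"
      unfolding P_last unfolding p ys p'
      using chain_mor.snoc[OF _ K(2,4)] u(2) n by blast
  qed
qed

lemma extension_morphisms_iff:
  "(xs, ys) \<in> extension_morphisms C n A B \<longleftrightarrow> xs \<in> extensions C n A B \<and>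
     ys \<in> extensions C n A B \<and> chain_mor C (ident C B) xs ys (ident C A)"
proof -
  have "B \<in> obj C" if "xs \<in> extensions C n A B" using that chain_obj by (auto simp: extensions_iff)
  then show ?thesis
    unfolding extension_morphisms_def mem_Collect_eq case_prod_conv
    using chain_mor_iff[of B xs A B ys A n "ident C B" "ident C A"] ident_Hom[of B]
    by (auto simp: extensions_iff)
qed

section \<open>A criterion for the vanishing of Yoneda Ext\<close>

lemma yoneda_equiv_sym: "(xs, ys) \<in> yoneda_equiv C n A B \<Longrightarrow> (ys, xs) \<in> yoneda_equiv C n A B"
  unfolding yoneda_equiv_def by (metis converse_Un converse_converse rtrancl_converseD
      rtrancl_converseI sup_commute)

lemma yoneda_equiv_trans:
  "(xs, ys) \<in> yoneda_equiv C n A B \<Longrightarrow> (ys, zs) \<in> yoneda_equiv C n A B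
    \<Longrightarrow> (xs, zs) \<in> yoneda_equiv C n A B"
  unfolding yoneda_equiv_def by (rule rtrancl_trans)

lemma Ext_vanishes_iff_equiv:
  "Ext_vanishes C n A B \<longleftrightarrow> extensions C n A B \<noteq> {} \<and>
    (\<forall>xs \<in> extensions C n A B. \<forall>ys \<in> extensions C n A B. (xs, ys) \<in> yoneda_equiv C n A B)"
  (is "_ \<longleftrightarrow> ?X \<noteq> {} \<and> ?R")
proof
  let ?r = "yoneda_equiv C n A B"
  have refl: "(xs, xs) \<in> ?r" for xs by (simp add: yoneda_equiv_def)
  assume "Ext_vanishes C n A B"
  then obtain c where c: "?X // ?r = {c}"
    unfolding Ext_vanishes_def Ext_def by (auto simp: is_singleton_def)
  have cl: "?r `` {xs} = c" if "xs \<in> ?X" for xs using quotientI[OF that, of ?r] c by simp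
  have "(xs, ys) \<in> ?r" if "xs \<in> ?X" "ys \<in> ?X" for xs ys
    using cl[OF that(1)] cl[OF that(2)] refl[of ys] by blast
  then show "?X \<noteq> {} \<and> ?R" using c by auto
next
  let ?r = "yoneda_equiv C n A B"
  assume h: "?X \<noteq> {} \<and> ?R"
  then obtain xs where xs: "xs \<in> ?X" by blast
  have "?r `` {ys} = ?r `` {xs}" if "ys \<in> ?X" for ys
    using h xs that yoneda_equiv_trans by blast
  then have "(\<Union>ys\<in>?X. {?r `` {ys}}) = (\<Union>ys\<in>?X. {?r `` {xs}})"
    by (intro SUP_cong) (rule refl, metis)
  then have "?X // ?r = {?r `` {xs}}" unfolding quotient_def using h by (simp add: UN_constant)
  then show "Ext_vanishes C n A B" unfolding Ext_vanishes_def Ext_def by simp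
qed

text \<open>Composition with the witness for \<open>ys\<close> is enough. The right component
  \<open>b\<close> is arbitrary, which \<open>Ext_vanishes_sub\<close> uses with an inflation in its
  place.\<close>

lemma null_ext_precomp:
  assumes m: "chain_mor C (ident C A) xs ys b" and xs: "chain C A xs B" "xs \<noteq> []"
    and ys: "chain C A ys B'" "null_ext C A ys"
  shows "null_ext C A xs"
proof -
  obtain xs1 f g where x: "xs = xs1 @ [(f, g)]" using xs(2) by (metis rev_exhaust surj_pair)
  obtain ys1 f' g' k K E B1 K' E' B1' e where y: "ys = ys1 @ [(f', g')]"
    "chain_mor C (ident C A) xs1 ys1 k" "conflation C K f E g B1" "conflation C K' f' E' g' B1'"
    "k \<in> Hom C K K'" "e \<in> Hom C E E'" "b \<in> Hom C B1 B1'" "e \<cdot> f = f' \<cdot> k"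
    using m unfolding x by (elim chain_mor_snocE)
  obtain K1 E1 B2 zs L c h where n: "conflation C K1 f' E1 g' B2" "chain C A zs L"
    "chain_mor C (ident C A) ys1 zs c" "c \<in> Hom C K1 L" "h \<in> Hom C E1 L" "h \<cdot> f' = c"
    using ys(2) unfolding y(1) by (elim null_extE)
  note u = conflation_unique[OF y(4) n(1)]
  note [simp] = conflationD(1-10)[OF y(3)] conflationD(1-10)[OF y(4)] y(5-7)[unfolded mem_Hom]
    n(4,5)[unfolded mem_Hom u]
  have A: "A \<in> obj C" using chain_obj[OF xs(1)] by simp
  note ch = chain_snoc_conflation(1)[OF xs(1)[unfolded x] y(3)]
    chain_snoc_conflation(1)[OF ys(1)[unfolded y(1)] y(4)]
  have "chain_mor C (ident C A \<cdot> ident C A) xs1 zs (c \<cdot> k)"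
    by (rule chain_mor_comp[OF y(2) n(3) ident_Hom[OF A] ident_Hom[OF A] ch])
  then have "chain_mor C (ident C A) xs1 zs (c \<cdot> k)" using A by simp
  moreover have "c \<cdot> k \<in> Hom C K L" "h \<cdot> e \<in> Hom C E L" by (simp_all add: mem_Hom)
  moreover have "h \<cdot> e \<cdot> f = c \<cdot> k" by (simp add: y(8) comp_reassoc[OF n(6)])
  ultimately show ?thesis unfolding x by (intro null_ext.intros[OF y(3) n(2)])
qed

text \<open>Here the witness for \<open>xs\<close> must be moved along the morphism.
  \<open>chain_mor_amalgam\<close> gives \<open>b'\<close> on \<open>ys1\<close> and a homotopy
  \<open>t\<close> such that \<open>m \<cdot> h + t\<close> extends \<open>b' \<cdot> k\<close> to
  \<open>E\<close>. The last square is a pushout because the right component is the identity, so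
  \<open>b'\<close> itself extends to \<open>E'\<close>.\<close>

lemma null_ext_forward:
  assumes m: "chain_mor C (ident C A) xs ys (ident C B)" and xs: "chain C A xs B" "null_ext C A xs"
    and ys: "chain C A ys B"
  shows "null_ext C A ys"
proof -
  from xs(2) obtain xs1 f g where x: "xs = xs1 @ [(f, g)]" by (cases rule: null_ext.cases) auto
  obtain ys1 f' g' k K E B1 K' E' B1' e where y: "ys = ys1 @ [(f', g')]"
    "chain_mor C (ident C A) xs1 ys1 k" "conflation C K f E g B1" "conflation C K' f' E' g' B1'"
    "k \<in> Hom C K K'" "e \<in> Hom C E E'" "ident C B \<in> Hom C B1 B1'" "e \<cdot> f = f' \<cdot> k"
    "ident C B \<cdot> g = g' \<cdot> e"
    using m unfolding x by (elim chain_mor_snocE)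
  note chx = chain_snoc_conflation[OF xs(1)[unfolded x] y(3)]
    and chy = chain_snoc_conflation[OF ys[unfolded y(1)] y(4)]
  note y3 = y(3)[folded chx(2)] and y4 = y(4)[folded chy(2)]
  obtain K1 E1 B2 zs L c h where n: "conflation C K1 f E1 g B2" "chain C A zs L"
    "chain_mor C (ident C A) xs1 zs c" "c \<in> Hom C K1 L" "h \<in> Hom C E1 L" "h \<cdot> f = c"
    using xs(2) unfolding x by (elim null_extE)
  note u = conflation_unique[OF y3 n(1)]
  have A: "A \<in> obj C" using chain_obj[OF xs(1)] by simp
  have "chain_mor C (ident C A \<cdot> ident C A) xs1 zs c" using A n(3) by simp
  then obtain zs' L' b' m t where z: "chain C A zs' L'" "chain_mor C (ident C A) ys1 zs' b'"
    "b' \<in> Hom C K' L'" "m \<in> Hom C L L'" "t \<in> Hom C E L'" "b' \<cdot> k = add_arr C (m \<cdot> c) (t \<cdot> f)"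
    using chain_mor_amalgam[OF y(2) _ chx(1) chy(1) n(2) ident_Hom[OF A] ident_Hom[OF A] y3]
    by blast
  note [simp] = conflationD(1-10)[OF y3] conflationD(1-10)[OF y4] y(5,6)[unfolded mem_Hom]
    n(4,5)[unfolded mem_Hom u] z(3-5)[unfolded mem_Hom]
  have "add_arr C (m \<cdot> h) t \<in> Hom C E L'" by (simp add: mem_Hom)
  moreover have "b' \<cdot> k = add_arr C (m \<cdot> h) t \<cdot> f" by (simp add: z(6) n(6))
  moreover have "g' \<cdot> e = g" using y(9) by simp
  ultimately obtain h' where "h' \<in> Hom C E' L'" "h' \<cdot> f' = b'"
    using pushout_univ[OF y3 y4 y(5,6,8) _ z(3)] by metis
  then show ?thesis unfolding y(1) using null_ext.intros[OF y4 z(1,2,3)] by blast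
qed

lemma null_ext_yoneda_equiv:
  assumes "(xs, ys) \<in> yoneda_equiv C n B A" "xs \<in> extensions C n B A"
  shows "ys \<in> extensions C n B A \<and> (null_ext C A xs \<longleftrightarrow> null_ext C A ys)"
  using assms unfolding yoneda_equiv_def
proof (induction rule: rtrancl_induct)
  case (step ys zs)
  have *: "null_ext C A us \<longleftrightarrow> null_ext C A vs"
    if "(us, vs) \<in> extension_morphisms C n B A" for us vs
    using that null_ext_precomp[of A us vs] null_ext_forward[of A us vs]
    by (auto simp: extension_morphisms_iff extensions_iff)
  have "zs \<in> extensions C n B A" using step.hyps(2) by (auto simp: extension_morphisms_iff)
  moreover have "null_ext C A ys \<longleftrightarrow> null_ext C A zs" using step.hyps(2) * by blast
  ultimately show ?case using step by simp
qed simp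

text \<open>The witness is empty for \<open>n = 0\<close>, and otherwise
  \<open>A = A \<rightarrow> 0\<close> continued by zero objects. At each step
  \<open>f \<cdot> b\<close> serves as the middle component and zero as the right one.\<close>

lemma ex_initial_chain:
  assumes A: "A \<in> obj C"
  shows "\<exists>xs L. chain C A xs L \<and> length xs = n \<and>
    (\<forall>ys L'. chain C A ys L' \<and> length ys = n \<longrightarrow> (\<exists>b. chain_mor C (ident C A) xs ys b))"
proof (induction n)
  case 0
  show ?case using A by (auto simp: chain_Nil_iff chain_mor_Nil_iff)
next
  case (Suc n)
  then obtain xs L where xs: "chain C A xs L" "length xs = n"
    "\<And>ys L'. \<lbrakk>chain C A ys L'; length ys = n\<rbrakk> \<Longrightarrow> \<exists>b. chain_mor C (ident C A) xs ys b" by blast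
  have L: "L \<in> obj C" using chain_obj[OF xs(1)] by simp
  obtain T where T: "conflation C L (ident C L) L (zero_arr C L T) T" "T \<in> obj C"
    using ex_conflation_ident[OF L] .
  have "\<exists>b. chain_mor C (ident C A) (xs @ [(ident C L, zero_arr C L T)]) ys b"
    if ys: "chain C A ys L'" "length ys = Suc n" for ys L'
  proof -
    obtain ys1 f g where y: "ys = ys1 @ [(f, g)]" "length ys1 = n"
      using ys(2) by (metis length_Suc_conv_rev surj_pair)
    obtain K E where K: "chain C A ys1 K" "conflation C K f E g L'"
      using ys(1) unfolding y(1) by (auto elim: chain_snocE)
    obtain b where b: "chain_mor C (ident C A) xs ys1 b" using xs(3)[OF K(1) y(2)] by blast
    have bH: "b \<in> Hom C L K" using chain_mor_Hom[OF b xs(1) K(1) ident_Hom[OF A]] .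
    note [simp] = conflationD(1-10)[OF K(2)] bH[unfolded mem_Hom] L T(2)
    show ?thesis unfolding y(1)
      by (intro exI[of _ "zero_arr C T L'"] chain_mor.snoc[OF b T(1) K(2) bH, of "f \<cdot> b"])
        (simp_all add: mem_Hom comp_reassoc[OF conflationD(7)[OF K(2)]])
  qed
  then show ?case using chain.snoc[OF xs(1) T(1)] xs(2) by fastforce
qed

text \<open>\<open>t\<close> is an initial chain of length \<open>n - 1\<close> followed by a split
  conflation; for \<open>n = 1\<close> this is the split extension of \<open>X\<close> by
  \<open>A\<close>.\<close>

lemma ex_trivial_ext:
  assumes A: "A \<in> obj C" and X: "X \<in> obj C" and n: "n > 0"
  obtains t where "t \<in> extensions C n X A" "null_ext C A t"
    "\<And>xs. \<lbrakk>xs \<in> extensions C n X A; null_ext C A xs\<rbrakk> \<Longrightarrow> (xs, t) \<in> yoneda_equiv C n X A"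
proof -
  from n obtain m where m: "n = Suc m" by (cases n) auto
  obtain ts L where ts: "chain C A ts L" "length ts = m"
    "\<And>ys L'. \<lbrakk>chain C A ys L'; length ys = m\<rbrakk> \<Longrightarrow> \<exists>b. chain_mor C (ident C A) ts ys b"
    using ex_initial_chain[OF A] by metis
  have L: "L \<in> obj C" using chain_obj[OF ts(1)] by simp
  obtain E f g e where S: "conflation C L f E g X" "e \<in> Hom C E L" "e \<cdot> f = ident C L"
    using ex_split_conflation[OF L X] by metis
  define t where "t = ts @ [(f, g)]"
  have t: "t \<in> extensions C n X A"
    using chain.snoc[OF ts(1) S(1)] ts(2) m by (simp add: t_def extensions_iff)
  have idL: "ident C L \<in> Hom C L L" using L by (rule ident_Hom)
  have nt: "null_ext C A t"
    unfolding t_def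
    using null_ext.intros[OF S(1) ts(1) chain_mor_ident[OF ts(1)] idL S(2,3)] .
  have "(xs, t) \<in> yoneda_equiv C n X A"
    if xs: "xs \<in> extensions C n X A" "null_ext C A xs" for xs
  proof -
    from xs(2) obtain xs1 f1 g1 where x: "xs = xs1 @ [(f1, g1)]" by (cases rule: null_ext.cases) auto
    obtain K1 E1 B zs L1 b h where z: "conflation C K1 f1 E1 g1 B" "chain C A zs L1"
      "chain_mor C (ident C A) xs1 zs b" "b \<in> Hom C K1 L1" "h \<in> Hom C E1 L1" "h \<cdot> f1 = b"
      using xs(2) unfolding x by (elim null_extE)
    have lx: "length xs1 = m" and chx: "chain C A (xs1 @ [(f1, g1)]) X"
      using xs(1) unfolding x m by (simp_all add: extensions_iff)
    note chx = chain_snoc_conflation[OF chx z(1)]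
    note z1 = z(1)[folded chx(2)]
    have L1: "L1 \<in> obj C" using chain_obj[OF z(2)] by simp
    obtain E' f' g' e' where S': "conflation C L1 f' E' g' X" "e' \<in> Hom C E' L1"
      "e' \<cdot> f' = ident C L1"
      and un: "\<And>T x y. \<lbrakk>x \<in> Hom C T L1; y \<in> Hom C T X\<rbrakk>
        \<Longrightarrow> \<exists>u \<in> Hom C T E'. e' \<cdot> u = x \<and> g' \<cdot> u = y"
      and jm: "\<And>T u v. \<lbrakk>u \<in> Hom C T E'; v \<in> Hom C T E'; e' \<cdot> u = e' \<cdot> v; g' \<cdot> u = g' \<cdot> v\<rbrakk> \<Longrightarrow> u = v"
      by (rule ex_split_conflation[OF L1 X], rule that) blast+
    \<comment> \<open>Splicing \<open>zs\<close> with a split conflation gives a common target: the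
      witness \<open>h\<close> of nullity defines \<open>xs \<rightarrow> y\<close>, initiality
      defines \<open>t \<rightarrow> y\<close>, and the two form a zigzag.\<close>
    define y where "y = zs @ [(f', g')]"
    have lz: "length zs = m" using chain_mor_length[OF z(3)] lx by simp
    have y: "y \<in> extensions C n X A"
      using chain.snoc[OF z(2) S'(1)] lz m by (simp add: y_def extensions_iff)
    have mor: "chain_mor C (ident C A) (us @ [(fu, gu)]) y (ident C X)"
      if u: "conflation C K fu F gu X" "chain_mor C (ident C A) us zs c" "c \<in> Hom C K L1"
        "hu \<in> Hom C F L1" "hu \<cdot> fu = c" for us fu gu K F c hu
    proof -
      obtain v where v: "v \<in> Hom C F E'" "e' \<cdot> v = hu" "g' \<cdot> v = gu"
        using un[OF u(4) conflationD(15)[OF u(1)]] by blast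
      note [simp] = conflationD(1-10)[OF u(1)] conflationD(1-10)[OF S'(1)] u(3-5)[unfolded mem_Hom]
        v(1)[unfolded mem_Hom] S'(2)[unfolded mem_Hom]
      have "v \<cdot> fu = f' \<cdot> c"
        by (rule jm) (simp_all add: mem_Hom comp_reassoc[OF v(2)] comp_reassoc[OF v(3)]
            comp_reassoc[OF S'(3)] comp_reassoc[OF conflationD(7)[OF S'(1)]])
      then show ?thesis unfolding y_def
        by (intro chain_mor.snoc[OF u(2,1) S'(1) u(3) v(1)]) (simp_all add: mem_Hom v(3))
    qed
    have "chain_mor C (ident C A) xs y (ident C X)"
      unfolding x using mor[OF z1 z(3-6)] .
    then have 1: "(xs, y) \<in> extension_morphisms C n X A"
      using xs(1) y by (simp add: extension_morphisms_iff)
    obtain b0 where b0: "chain_mor C (ident C A) ts zs b0" using ts(3)[OF z(2) lz] by blast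
    have b0H: "b0 \<in> Hom C L L1" using chain_mor_Hom[OF b0 ts(1) z(2) ident_Hom[OF A]] .
    have "b0 \<cdot> e \<in> Hom C E L1" "b0 \<cdot> e \<cdot> f = b0"
      using b0H S conflationD(1-10)[OF S(1)] by (simp_all add: mem_Hom)
    then have "chain_mor C (ident C A) t y (ident C X)"
      unfolding t_def using mor[OF S(1) b0 b0H] by blast
    then have 2: "(t, y) \<in> extension_morphisms C n X A"
      using t y by (simp add: extension_morphisms_iff)
    show ?thesis
      using 1 2 unfolding yoneda_equiv_def
      by (meson UnI1 UnI2 converseI r_into_rtrancl rtrancl.rtrancl_into_rtrancl)
  qed
  then show ?thesis using that t nt by blast
qed

text \<open>The null extensions form exactly the class of the trivial one: they are all equivalent
  to it, and nullity is invariant under equivalence. From here on Ext is handled without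
  zigzags.\<close>

theorem Ext_vanishes_iff:
  assumes "A \<in> obj C" "X \<in> obj C" "n > 0"
  shows "Ext_vanishes C n X A \<longleftrightarrow>
    (\<forall>xs. chain C A xs X \<and> length xs = n \<longrightarrow> null_ext C A xs)"
proof -
  obtain t where t: "t \<in> extensions C n X A" "null_ext C A t"
    "\<And>xs. \<lbrakk>xs \<in> extensions C n X A; null_ext C A xs\<rbrakk> \<Longrightarrow> (xs, t) \<in> yoneda_equiv C n X A"
    using ex_trivial_ext[OF assms] by blast
  have ext: "xs \<in> extensions C n X A \<longleftrightarrow> chain C A xs X \<and> length xs = n" for xs
    using assms(3) by (auto simp: extensions_iff)
  show ?thesis
  proof
    assume v: "Ext_vanishes C n X A"
    show "\<forall>xs. chain C A xs X \<and> length xs = n \<longrightarrow> null_ext C A xs"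
    proof (intro allI impI)
      fix xs assume "chain C A xs X \<and> length xs = n"
      then have xs: "xs \<in> extensions C n X A" by (simp add: ext)
      then have "(xs, t) \<in> yoneda_equiv C n X A" using v t(1) Ext_vanishes_iff_equiv by blast
      from null_ext_yoneda_equiv[OF this xs] t(2) show "null_ext C A xs" by simp
    qed
  next
    assume h: "\<forall>xs. chain C A xs X \<and> length xs = n \<longrightarrow> null_ext C A xs"
    have to_t: "(xs, t) \<in> yoneda_equiv C n X A" if "xs \<in> extensions C n X A" for xs
      using t(3)[OF that] h that by (simp add: ext)
    have "(xs, ys) \<in> yoneda_equiv C n X A"
      if "xs \<in> extensions C n X A" "ys \<in> extensions C n X A" for xs ys
      using yoneda_equiv_trans[OF to_t[OF that(1)] yoneda_equiv_sym[OF to_t[OF that(2)]]] .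
    then show "Ext_vanishes C n X A" using t(1) unfolding Ext_vanishes_iff_equiv by blast
  qed
qed

end

section \<open>Duality and dimension shifting\<close>

text \<open>Reads an extension of the opposite category as an extension of the original one.\<close>

definition flip :: "('m \<times> 'm) list \<Rightarrow> ('m \<times> 'm) list" where
  "flip xs = rev (map prod.swap xs)"

lemma flip_flip [simp]: "flip (flip xs) = xs"
  by (simp add: flip_def rev_map)

lemma length_flip [simp]: "length (flip xs) = length xs"
  by (simp add: flip_def)

lemma flip_nth: "i < length xs \<Longrightarrow> flip xs ! i = prod.swap (xs ! (length xs - Suc i))"
  by (simp add: flip_def rev_nth)

lemma flip_extensions:
  assumes "xs \<in> extensions (op_cat C) n A B"
  shows "flip xs \<in> extensions C n B A"
proof -
  from assms have n: "n > 0" "length xs = n" "set xs \<subseteq> conflations (op_cat C)"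
    and e: "tgt C (fst (xs ! 0)) = B" "src C (snd (xs ! (n - 1))) = A"
    and adj: "\<And>i. Suc i < n \<Longrightarrow> src C (snd (xs ! i)) = tgt C (fst (xs ! Suc i))"
    by (auto simp: extensions_def op_cat_simps)
  have "set (flip xs) \<subseteq> conflations C" using n(3) by (force simp: flip_def op_cat_simps)
  moreover have "src C (fst (flip xs ! 0)) = A" "tgt C (snd (flip xs ! (n - 1))) = B"
    using n e by (simp_all add: flip_nth)
  moreover have "tgt C (snd (flip xs ! i)) = src C (fst (flip xs ! Suc i))" if "Suc i < n" for i
    using adj[of "n - Suc (Suc i)"] that n by (simp add: flip_nth Suc_diff_Suc)
  ultimately show ?thesis using n by (simp add: extensions_def)
qed

context exact_category
begin

text \<open>Morphisms change direction, which the symmetric closure in \<open>yoneda_equiv\<close>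
  absorbs. There are \<open>n + 1\<close> joints but \<open>n\<close> middle terms, so
  \<open>k\<close> is renumbered by \<open>n - i\<close> and \<open>u\<close> by
  \<open>n - Suc i\<close>.\<close>

lemma flip_extension_morphisms:
  assumes "(xs, ys) \<in> extension_morphisms (op_cat C) n A B"
  shows "(flip ys, flip xs) \<in> extension_morphisms C n B A"
proof -
  from assms have xs: "xs \<in> extensions (op_cat C) n A B" "ys \<in> extensions (op_cat C) n A B"
    by (auto simp: extension_morphisms_def)
  then have n: "length xs = n" "length ys = n" by (auto simp: extensions_def)
  from assms obtain u k where k: "k 0 = ident C B" "k n = ident C A"
    and sq: "\<And>i. i < n \<Longrightarrow> let (f, g) = xs ! i; (f', g') = ys ! i in
           k i \<in> Hom C (tgt C f') (tgt C f) \<and>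
           u i \<in> Hom C (src C f') (src C f) \<and>
           k (Suc i) \<in> Hom C (src C g') (src C g) \<and>
           f \<cdot>\<^bsub>C\<^esub> u i = k i \<cdot>\<^bsub>C\<^esub> f' \<and>
           g \<cdot>\<^bsub>C\<^esub> k (Suc i) = u i \<cdot>\<^bsub>C\<^esub> g'"
    by (auto simp: extension_morphisms_def op_cat_simps)
  have "let (f, g) = flip ys ! i; (f', g') = flip xs ! i in
           k (n - i) \<in> Hom C (src C f) (src C f') \<and>
           u (n - Suc i) \<in> Hom C (tgt C f) (tgt C f') \<and>
           k (n - Suc i) \<in> Hom C (tgt C g) (tgt C g') \<and>
           u (n - Suc i) \<cdot>\<^bsub>C\<^esub> f = f' \<cdot>\<^bsub>C\<^esub> k (n - i) \<and>
           k (n - Suc i) \<cdot>\<^bsub>C\<^esub> g = g' \<cdot>\<^bsub>C\<^esub> u (n - Suc i)"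
    if i: "i < n" for i
  proof -
    obtain f g f' g' where x: "xs ! (n - Suc i) = (f, g)" "ys ! (n - Suc i) = (f', g')"
      by (metis surj_pair)
    have "(g, f) \<in> conflations C" "(g', f') \<in> conflations C"
      using xs nth_mem[of "n - Suc i" xs] nth_mem[of "n - Suc i" ys] i n x
      by (auto simp: extensions_def op_cat_simps)
    then have cf: "tgt C g = src C f" "tgt C g' = src C f'"
      using conflation_kernel by (auto simp: is_kernel_def)
    show ?thesis
      using sq[of "n - Suc i"] i x n by (simp add: flip_nth Suc_diff_Suc) (auto simp: mem_Hom cf)
  qed
  then show ?thesis
    unfolding extension_morphisms_def using flip_extensions[OF xs(1)] flip_extensions[OF xs(2)] k
    by - (simp, rule exI[of _ "\<lambda>i. u (n - Suc i)"], rule exI[of _ "\<lambda>i. k (n - i)"], simp)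
qed

lemma flip_yoneda_equiv:
  assumes "(xs, ys) \<in> yoneda_equiv (op_cat C) n A B"
  shows "(flip xs, flip ys) \<in> yoneda_equiv C n B A"
  using assms unfolding yoneda_equiv_def
proof (induction rule: rtrancl_induct)
  case (step ys zs)
  have "(flip ys, flip zs) \<in> extension_morphisms C n B A \<union> (extension_morphisms C n B A)\<inverse>"
    using step.hyps(2) flip_extension_morphisms[of ys zs n A B]
      flip_extension_morphisms[of zs ys n A B] by blast
  then show ?case using step.IH by (rule rtrancl.rtrancl_into_rtrancl[rotated])
qed simp

lemma Ext_vanishes_op: "Ext_vanishes (op_cat C) n A B \<longleftrightarrow> Ext_vanishes C n B A"
proof -
  interpret op: exact_category "op_cat C" by (rule exact_op)
  have ext: "xs \<in> extensions (op_cat C) n A B \<longleftrightarrow> flip xs \<in> extensions C n B A" for xs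
    using flip_extensions[of xs C n A B] flip_extensions[of "flip xs" "op_cat C" n B A] by auto
  have eqv: "(xs, ys) \<in> yoneda_equiv (op_cat C) n A B \<longleftrightarrow> (flip xs, flip ys) \<in> yoneda_equiv C n B A"
    for xs ys
    using flip_yoneda_equiv[of xs ys n A B]
      op.flip_yoneda_equiv[of "flip xs" "flip ys" n B A] by auto
  have "(\<forall>xs ys. flip xs \<in> extensions C n B A \<longrightarrow> flip ys \<in> extensions C n B A \<longrightarrow>
        (flip xs, flip ys) \<in> yoneda_equiv C n B A) \<longleftrightarrow>
      (\<forall>xs ys. xs \<in> extensions C n B A \<longrightarrow> ys \<in> extensions C n B A \<longrightarrow>
        (xs, ys) \<in> yoneda_equiv C n B A)"
    by (metis flip_flip)
  moreover have "(\<exists>xs. flip xs \<in> extensions C n B A) \<longleftrightarrow> (\<exists>xs. xs \<in> extensions C n B A)"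
    by (metis flip_flip)
  ultimately show ?thesis
    unfolding Ext_vanishes_iff_equiv op.Ext_vanishes_iff_equiv Ball_def ex_in_conv[symmetric] ext eqv
    by blast
qed

section \<open>Exactness in the long Ext sequences\<close>

lemma pullback_symmetric:
  assumes "conflation C K i E p D" "conflation C A j N q D" "conflation C K i' P p' N"
    "e \<in> Hom C P E" "p \<cdot> e = q \<cdot> p'" "e \<cdot> i' = i"
  obtains j' where "conflation C A j' P e E" "p' \<cdot> j' = j"
  using exact_category.pushout_symmetric[OF exact_op, unfolded op_cat_defs op_cat_simps,
      OF assms] .

lemma ext_snocE:
  assumes "chain C A xs B" "xs \<noteq> []"
  obtains xs' f g K E where "xs = xs' @ [(f, g)]" "chain C A xs' K" "conflation C K f E g B"
proof -
  from assms(2) obtain xs' f g where "xs = xs' @ [(f, g)]" by (metis rev_exhaust surj_pair)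
  then show ?thesis using assms(1) that by (auto elim!: chain_snocE)
qed

lemma null_extD:
  assumes "null_ext C A (xs @ [(f, g)])" "conflation C K f E g B"
  obtains ys L b h where "chain C A ys L" "chain_mor C (ident C A) xs ys b" "b \<in> Hom C K L"
    "h \<in> Hom C E L" "h \<cdot> f = b"
proof -
  obtain K1 E1 B1 ys L b h where n: "conflation C K1 f E1 g B1" "chain C A ys L"
    "chain_mor C (ident C A) xs ys b" "b \<in> Hom C K1 L" "h \<in> Hom C E1 L" "h \<cdot> f = b"
    using assms(1) by (elim null_extE)
  show ?thesis using that n(2-) unfolding conflation_unique[OF assms(2) n(1)] by blast
qed

text \<open>Exactness of \<open>Ext^n(N,X) \<rightarrow> Ext^n(A,X) \<rightarrow>
  Ext^(n+1)(D,X)\<close> in the middle. Nullity of \<open>xs\<close> spliced with the conflation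
  gives a morphism to \<open>zs\<close> whose right component extends to \<open>h\<close> on
  \<open>N\<close>. Hence \<open>xs\<close> maps to the pullback of \<open>zs\<close> along
  \<open>h\<close>, an extension of \<open>N\<close>, which is null.\<close>

lemma Ext_vanishes_sub:
  assumes c: "conflation C A j N q D" and v: "Ext_vanishes C (Suc n) D X" "Ext_vanishes C n N X"
    and n: "n > 0" and X: "X \<in> obj C"
  shows "Ext_vanishes C n A X"
proof -
  note cd = conflationD[OF c]
  show ?thesis unfolding Ext_vanishes_iff[OF X cd(8) n]
  proof (intro allI impI, elim conjE)
    fix xs assume xs: "chain C X xs A" "length xs = n"
    with n obtain xs1 f g K E where x: "xs = xs1 @ [(f, g)]" "chain C X xs1 K"
      "conflation C K f E g A" using ext_snocE[OF xs(1)] by (metis length_greater_0_conv)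
    have "null_ext C X (xs @ [(j, q)])"
      using v(1) Ext_vanishes_iff[OF X cd(10), of "Suc n"] chain.snoc[OF xs(1) c] xs(2) by simp
    then obtain zs L b h where z: "chain C X zs L" "chain_mor C (ident C X) xs zs b"
      "b \<in> Hom C A L" "h \<in> Hom C N L" "h \<cdot> j = b"
      using null_extD[OF _ c] by metis
    have "length zs = n" using chain_mor_length[OF z(2)] xs(2) by simp
    with n obtain zs1 f1 g1 K1 E1 where z1: "zs = zs1 @ [(f1, g1)]" "chain C X zs1 K1"
      "conflation C K1 f1 E1 g1 L" using ext_snocE[OF z(1)] by (metis length_greater_0_conv)
    obtain f2 g2 where P: "chain C X (zs1 @ [(f2, g2)]) N"
      "\<And>a ws A'' B'' c. \<lbrakk>chain_mor C a ws (zs1 @ [(f1, g1)]) (h \<cdot> c); c \<in> Hom C B'' N;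
        chain C A'' ws B''\<rbrakk> \<Longrightarrow> chain_mor C a ws (zs1 @ [(f2, g2)]) c"
      using chain_pullback[OF z(1)[unfolded z1(1)] z(4)] by blast
    have "length (zs1 @ [(f2, g2)]) = n" using \<open>length zs = n\<close> z1(1) by simp
    then have "null_ext C X (zs1 @ [(f2, g2)])"
      using v(2) Ext_vanishes_iff[OF X cd(9) n] P(1) by blast
    moreover have "chain_mor C (ident C X) xs (zs1 @ [(f2, g2)]) j"
      using P(2)[OF _ cd(14) xs(1), of "ident C X"] z(2,5) z1(1) by simp
    moreover have "xs \<noteq> []" using x(1) by simp
    ultimately show "null_ext C X xs" using null_ext_precomp xs(1) P(1) by blast
  qed
qed

text \<open>Exactness of \<open>Ext^n(A,X) \<rightarrow> Ext^(n+1)(D,X) \<rightarrow>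
  Ext^(n+1)(N,X)\<close> in the middle. The extension becomes null after pullback to
  \<open>N\<close>; the obstruction to descending the witness \<open>h\<close> to \<open>E\<close>
  is an \<open>n\<close>-extension of \<open>A\<close>, and its nullity provides the
  correction.\<close>

lemma Ext_vanishes_quotient:
  assumes c: "conflation C A j N q D" and v: "Ext_vanishes C n A X" "Ext_vanishes C (Suc n) N X"
    and n: "n > 0" and X: "X \<in> obj C"
  shows "Ext_vanishes C (Suc n) D X"
proof -
  note cd = conflationD[OF c]
  show ?thesis unfolding Ext_vanishes_iff[OF X cd(10) zero_less_Suc]
  proof (intro allI impI, elim conjE)
    fix xs assume xs: "chain C X xs D" "length xs = Suc n"
    then have "xs \<noteq> []" by auto
    then obtain ys i p K E where x: "xs = ys @ [(i, p)]" and ys: "chain C X ys K"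
      and e: "conflation C K i E p D" using ext_snocE[OF xs(1)] by metis
    have ly: "length ys = n" using x xs(2) by simp
    with n obtain ys1 f g M F where y: "ys = ys1 @ [(f, g)]" "chain C X ys1 M"
      "conflation C M f F g K" using ext_snocE[OF ys] by (metis length_greater_0_conv)
    obtain iN EN pN eN where N: "conflation C K iN EN pN N" "eN \<in> Hom C EN E"
      "p \<cdot> eN = q \<cdot> pN" "eN \<cdot> iN = i"
      using ex_pullback[OF e cd(15)] by metis
    obtain a0 where a0: "conflation C A a0 EN eN E" "pN \<cdot> a0 = j"
      using pullback_symmetric[OF e c N] .
    have "null_ext C X (ys @ [(iN, pN)])"
      using v(2) Ext_vanishes_iff[OF X cd(9), of "Suc n"] chain.snoc[OF ys N(1)] ly by simp
    then obtain zs L b h where z: "chain C X zs L" "chain_mor C (ident C X) ys zs b"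
      "b \<in> Hom C K L" "h \<in> Hom C EN L" "h \<cdot> iN = b"
      using null_extD[OF _ N(1)] by metis
    have lz: "length zs = n" using chain_mor_length[OF z(2)] ly by simp
    with n obtain zs1 f1 g1 B F1 where z1: "zs = zs1 @ [(f1, g1)]" "chain C X zs1 B"
      "conflation C B f1 F1 g1 L" using ext_snocE[OF z(1)] by (metis length_greater_0_conv)
    note [simp] = conflationD(1-10,16)[OF c] conflationD(1-10,16)[OF e] conflationD(1-10,16)[OF y(3)]
      conflationD(1-10,16)[OF N(1)] conflationD(1-10,16)[OF a0(1)] conflationD(1-10,16)[OF z1(3)]
      N(2)[unfolded mem_Hom] z(3,4)[unfolded mem_Hom]
    \<comment> \<open>\<open>a0\<close> is a kernel of \<open>eN\<close>, so \<open>h\<close>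
      descends to \<open>E\<close> precisely when \<open>h \<cdot> a0\<close> vanishes. The pullback
      of \<open>zs\<close> along it is the extension of \<open>A\<close> to be used.\<close>
    have ha0: "h \<cdot> a0 \<in> Hom C A L" by (simp add: mem_Hom)
    obtain f2 F2 g2 e2 where P: "conflation C B f2 F2 g2 A" "e2 \<in> Hom C F2 F1"
      "g1 \<cdot> e2 = h \<cdot> a0 \<cdot> g2" "e2 \<cdot> f2 = f1"
      using ex_pullback[OF z1(3) ha0] by metis
    have "null_ext C X (zs1 @ [(f2, g2)])"
      using v(1) Ext_vanishes_iff[OF X cd(8) n] chain.snoc[OF z1(2) P(1)] lz z1(1) by simp
    then obtain ws L2 c2 h2 where w: "chain C X ws L2" "chain_mor C (ident C X) zs1 ws c2"
      "c2 \<in> Hom C B L2" "h2 \<in> Hom C F2 L2" "h2 \<cdot> f2 = c2"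
      using null_extD[OF _ P(1)] by metis
    obtain G l \<gamma> \<phi> where G: "conflation C L2 l G \<gamma> L" "\<phi> \<in> Hom C F1 G" "\<phi> \<cdot> f1 = l \<cdot> c2"
      "\<gamma> \<cdot> \<phi> = g1"
      using ex_pushout[OF z1(3) w(3)] by metis
    note [simp] = conflationD(1-10,16)[OF P(1)] P(2)[unfolded mem_Hom] w(3,4)[unfolded mem_Hom]
      conflationD(1-10,16)[OF G(1)] G(2)[unfolded mem_Hom]
    \<comment> \<open>The pullback to \<open>A\<close> splits after the pushout along
      \<open>c2\<close>. The difference \<open>d\<close> turns that splitting into \<open>m\<close>,
      a lift of \<open>h \<cdot> a0\<close> along \<open>\<gamma>\<close>.\<close>
    define d where "d = add_arr C (\<phi> \<cdot> e2) (neg_arr C (l \<cdot> h2))"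
    have "d \<in> Hom C F2 G" "d \<cdot> f2 = zero_arr C B G"
      by (simp_all add: d_def mem_Hom P(4) G(3) w(5))
    then obtain m where m: "m \<in> Hom C A G" "m \<cdot> g2 = d"
      using conflation_cofactor[OF P(1)] by metis
    note [simp] = m(1)[unfolded mem_Hom]
    have "\<gamma> \<cdot> m \<cdot> g2 = h \<cdot> a0 \<cdot> g2"
      using P(3) by (simp add: m(2) d_def comp_reassoc[OF G(4)] comp_reassoc[OF conflationD(7)[OF G(1)]])
    then have \<gamma>m: "\<gamma> \<cdot> m = h \<cdot> a0"
      by (rule conflation_epi[OF P(1)]) (simp_all add: mem_Hom)
    \<comment> \<open>\<open>G\<close> is enlarged so that the lift \<open>m\<close> extends from
      \<open>A\<close> to \<open>EN\<close>, as \<open>\<mu>\<close>; then \<open>L'\<close> is the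
      corresponding enlargement of \<open>L\<close>.\<close>
    obtain G' w' \<epsilon> \<mu> where G': "conflation C G w' G' \<epsilon> E" "\<mu> \<in> Hom C EN G'" "\<mu> \<cdot> a0 = w' \<cdot> m"
      using ex_pushout[OF a0(1) m(1)] by metis
    obtain L' \<kappa> \<epsilon>' \<pi> where L': "conflation C L \<kappa> L' \<epsilon>' E" "\<pi> \<in> Hom C G' L'" "\<pi> \<cdot> w' = \<kappa> \<cdot> \<gamma>"
      "\<epsilon>' \<cdot> \<pi> = \<epsilon>"
      using ex_pushout[OF G'(1) conflationD(15)[OF G(1)]] by metis
    have W: "conflation C L2 (w' \<cdot> l) G' \<pi> L'"
      by (rule conflation_comp_pushout[OF G(1) G'(1) L'])
    note [simp] = conflationD(1-10,16)[OF G'(1)] G'(2)[unfolded mem_Hom]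
      conflationD(1-10,16)[OF L'(1)] L'(2)[unfolded mem_Hom]
    \<comment> \<open>Subtracting \<open>\<pi> \<cdot> \<mu>\<close> makes \<open>h\<close> vanish
      on \<open>A\<close>, so it descends to \<open>t\<close> on \<open>E\<close>. The restriction
      \<open>r\<close> to \<open>K\<close> differs from \<open>\<kappa> \<cdot> b\<close> by a map
      through \<open>\<pi>\<close>, so it is still the right component of a morphism of chains once
      the middle component is corrected.\<close>
    define D' where "D' = add_arr C (\<kappa> \<cdot> h) (neg_arr C (\<pi> \<cdot> \<mu>))"
    have "D' \<in> Hom C EN L'" "D' \<cdot> a0 = zero_arr C A L'"
      by (simp_all add: D'_def mem_Hom G'(3) comp_reassoc[OF L'(3)] \<gamma>m)
    then obtain t where t: "t \<in> Hom C E L'" "t \<cdot> eN = D'"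
      using conflation_cofactor[OF a0(1)] by metis
    define r where "r = add_arr C (\<kappa> \<cdot> b) (neg_arr C (\<pi> \<cdot> (\<mu> \<cdot> iN)))"
    note [simp] = t(1)[unfolded mem_Hom]
    have "t \<cdot> i = t \<cdot> eN \<cdot> iN" by (simp add: N(4))
    also have "\<dots> = r" unfolding t(2) by (simp add: D'_def r_def z(5))
    finally have tr: "t \<cdot> i = r" .
    have r: "r \<in> Hom C K L'" by (simp add: r_def mem_Hom)
    obtain k v where kv: "chain_mor C (ident C X) ys1 zs1 k" "k \<in> Hom C M B" "v \<in> Hom C F F1"
      "v \<cdot> f = f1 \<cdot> k" "b \<cdot> g = g1 \<cdot> v"
      using chain_mor_snocD[OF z(2)[unfolded y(1) z1(1)] y(3) z1(3)] by metis
    note [simp] = kv(2,3)[unfolded mem_Hom]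
    have "chain_mor C (ident C X \<cdot> ident C X) ys1 ws (c2 \<cdot> k)"
      by (rule chain_mor_comp[OF kv(1) w(2) ident_Hom[OF X] ident_Hom[OF X] y(2) z1(2)])
    then have m1: "chain_mor C (ident C X) ys1 ws (c2 \<cdot> k)" using X by simp
    have "chain_mor C (ident C X) ys (ws @ [(w' \<cdot> l, \<pi>)]) r"
      unfolding y(1)
    proof (rule chain_mor.snoc[OF m1 y(3) W])
      show "add_arr C (w' \<cdot> (\<phi> \<cdot> v)) (neg_arr C (\<mu> \<cdot> (iN \<cdot> g))) \<in> Hom C F G'"
        by (simp add: mem_Hom)
      show "add_arr C (w' \<cdot> (\<phi> \<cdot> v)) (neg_arr C (\<mu> \<cdot> (iN \<cdot> g))) \<cdot> f = w' \<cdot> l \<cdot> (c2 \<cdot> k)"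
        by (simp add: kv(4) comp_reassoc[OF G(3)])
      show "r \<cdot> g = \<pi> \<cdot> add_arr C (w' \<cdot> (\<phi> \<cdot> v)) (neg_arr C (\<mu> \<cdot> (iN \<cdot> g)))"
        by (simp add: r_def kv(5) comp_reassoc[OF L'(3)] comp_reassoc[OF G(4)])
    qed (simp_all add: mem_Hom r[unfolded mem_Hom])
    then show "null_ext C X xs" unfolding x
      using null_ext.intros[OF e chain.snoc[OF w(1) W] _ r t(1) tr] by blast
  qed
qed

text \<open>The case \<open>n = 0\<close> of the preceding shift: in place of a vanishing Ext group
  for \<open>A\<close>, it takes surjectivity of \<open>Hom(N,X) \<rightarrow> Hom(A,X)\<close>,
  which is what approximations supply.\<close>

lemma Ext1_vanishes_quotient:
  assumes c: "conflation C A j N q D" and v: "Ext_vanishes C 1 N X"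
    and ext: "\<And>a. a \<in> Hom C A X \<Longrightarrow> \<exists>a' \<in> Hom C N X. a' \<cdot> j = a" and X: "X \<in> obj C"
  shows "Ext_vanishes C 1 D X"
proof -
  note cd = conflationD[OF c]
  show ?thesis unfolding Ext_vanishes_iff[OF X cd(10) zero_less_one]
  proof (intro allI impI, elim conjE)
    fix xs assume xs: "chain C X xs D" "length xs = 1"
    then have "xs \<noteq> []" by auto
    then obtain ys i p K E where x: "xs = ys @ [(i, p)]" and ys: "chain C X ys K"
      and e: "conflation C K i E p D" using ext_snocE[OF xs(1)] by metis
    have [simp]: "ys = []" using x xs(2) by simp
    have [simp]: "K = X" using ys by (simp add: chain_Nil_iff)
    note e = e[simplified]
    obtain iN EN pN eN where N: "conflation C X iN EN pN N" "eN \<in> Hom C EN E"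
      "p \<cdot> eN = q \<cdot> pN" "eN \<cdot> iN = i"
      using ex_pullback[OF e cd(15)] by metis
    have "null_ext C X ([] @ [(iN, pN)])"
      using v Ext_vanishes_iff[OF X cd(9), of 1] chain.snoc[OF chain.Nil[OF X] N(1)] by simp
    then obtain b ys L h where h: "h \<in> Hom C EN L" "h \<cdot> iN = b" "chain_mor C (ident C X) [] ys b"
      "chain C X ys L"
      using null_extD[OF _ N(1)] by metis
    \<comment> \<open>Only the empty chain precedes the last conflation, so nullity means that
      \<open>iN\<close> has a retraction.\<close>
    then have r: "h \<in> Hom C EN X" "h \<cdot> iN = ident C X"
      by (auto simp: chain_mor_Nil_iff chain_Nil_iff)
    note [simp] = conflationD(1-10)[OF c] conflationD(1-10)[OF e] conflationD(1-10)[OF N(1)]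
      N(2)[unfolded mem_Hom] r(1)[unfolded mem_Hom]
    define d where "d = add_arr C (ident C EN) (neg_arr C (iN \<cdot> h))"
    have "d \<in> Hom C EN EN" "d \<cdot> iN = zero_arr C X EN" by (simp_all add: d_def mem_Hom r(2))
    then obtain s where s: "s \<in> Hom C N EN" "s \<cdot> pN = d"
      using conflation_cofactor[OF N(1)] by metis
    note [simp] = s(1)[unfolded mem_Hom]
    have "pN \<cdot> s \<cdot> pN = ident C N \<cdot> pN"
      by (simp add: s(2) d_def comp_reassoc[OF conflationD(7)[OF N(1)]])
    then have pNs: "pN \<cdot> s = ident C N"
      by (rule conflation_epi[OF N(1)]) (simp_all add: mem_Hom)
    define R where "R = eN \<cdot> s"
    have R: "R \<in> Hom C N E" "p \<cdot> R = q"
      by (simp_all add: R_def mem_Hom comp_reassoc[OF N(3)] pNs)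
    note [simp] = R(1)[unfolded mem_Hom]
    have "R \<cdot> j \<in> Hom C A E" "p \<cdot> (R \<cdot> j) = zero_arr C A D"
      by (simp_all add: mem_Hom comp_reassoc[OF R(2)])
    then obtain a where a: "a \<in> Hom C A X" "i \<cdot> a = R \<cdot> j"
      using conflation_factor[OF e] by metis
    obtain a' where a': "a' \<in> Hom C N X" "a' \<cdot> j = a" using ext[OF a(1)] by blast
    note [simp] = a(1)[unfolded mem_Hom] a'(1)[unfolded mem_Hom]
    \<comment> \<open>\<open>R\<close> lifts \<open>q\<close> through \<open>p\<close>. After
      subtracting \<open>i \<cdot> a'\<close> the lift vanishes on \<open>A\<close> and descends to
      a section of \<open>p\<close>.\<close>
    define R' where "R' = add_arr C R (neg_arr C (i \<cdot> a'))"
    have "R' \<in> Hom C N E" "R' \<cdot> j = zero_arr C A E"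
      by (simp_all add: R'_def mem_Hom a'(2) a(2))
    then obtain t where t: "t \<in> Hom C D E" "t \<cdot> q = R'"
      using conflation_cofactor[OF c] by metis
    note [simp] = t(1)[unfolded mem_Hom]
    have "p \<cdot> t \<cdot> q = ident C D \<cdot> q"
      by (simp add: t(2) R'_def R(2) comp_reassoc[OF conflationD(7)[OF e]])
    then have pt: "p \<cdot> t = ident C D"
      by (rule conflation_epi[OF c]) (simp_all add: mem_Hom)
    define d' where "d' = add_arr C (ident C E) (neg_arr C (t \<cdot> p))"
    have "d' \<in> Hom C E E" "p \<cdot> d' = zero_arr C E D"
      by (simp_all add: d'_def mem_Hom comp_reassoc[OF pt])
    then obtain h' where h': "h' \<in> Hom C E X" "i \<cdot> h' = d'"
      using conflation_factor[OF e] by metis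
    note [simp] = h'(1)[unfolded mem_Hom]
    have "i \<cdot> (h' \<cdot> i) = i \<cdot> ident C X"
      by (simp add: comp_reassoc[OF h'(2)] d'_def)
    then have "h' \<cdot> i = ident C X"
      by (rule conflation_mono[OF e]) (simp_all add: mem_Hom)
    moreover have "chain_mor C (ident C X) [] [] (ident C X)"
      using X by (intro chain_mor.Nil) simp
    ultimately have "null_ext C X ([] @ [(i, p)])"
      using null_ext.intros[OF e chain.Nil[OF X] _ ident_Hom[OF X] h'(1)] by blast
    then show "null_ext C X xs" unfolding x by simp
  qed
qed

text \<open>In the dual statements subobject and quotient trade places:
  \<open>Ext_vanishes_sub_op\<close> is about the quotient of a conflation, the other two are about
  the subobject.\<close>

lemmas Ext_vanishes_sub_op =
  exact_category.Ext_vanishes_sub[OF exact_op, unfolded op_cat_defs op_cat_simps Ext_vanishes_op]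

lemmas Ext_vanishes_quotient_op =
  exact_category.Ext_vanishes_quotient[OF exact_op, unfolded op_cat_defs op_cat_simps Ext_vanishes_op]

lemmas Ext1_vanishes_quotient_op =
  exact_category.Ext1_vanishes_quotient[OF exact_op, unfolded op_cat_defs op_cat_simps
    Ext_vanishes_op]

end

section \<open>Filtrations and resolutions\<close>

text \<open>Unlike in \<^const>\<open>Filt\<close>, the filtration may have length zero.\<close>

inductive filtered :: "('o, 'm, 'x) exact_cat_scheme \<Rightarrow> 'o set \<Rightarrow> 'o \<Rightarrow> bool" for C S where
  zero: "is_zero_object C Z \<Longrightarrow> filtered C S Z"
| step: "\<lbrakk>filtered C S Y; conflation C Y f G g T; T \<in> S\<rbrakk> \<Longrightarrow> filtered C S G"

text \<open>\<open>filtered\<close> adds factors on top, while the induction on resolutions adds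
  \<open>Z\<close> at the bottom. Quantifying over what lies below \<open>T\<close> allows both, and
  \<open>Y = 0\<close> gives back that \<open>T\<close> is filtered.\<close>

definition filtered_rel :: "('o, 'm, 'x) exact_cat_scheme \<Rightarrow> 'o set \<Rightarrow> 'o \<Rightarrow> bool" where
  "filtered_rel C S T \<longleftrightarrow>
     (\<forall>Y f G g. conflation C Y f G g T \<and> filtered C S Y \<longrightarrow> filtered C S G)"

text \<open>The base consists of zero objects and not of \<open>M\<close>, so that the kernel
  \<open>W\<close> in \<open>resolved_decompose\<close> is covered when it vanishes.\<close>

inductive resolved :: "('o, 'm, 'x) exact_cat_scheme \<Rightarrow> 'o set \<Rightarrow> nat \<Rightarrow> 'o \<Rightarrow> bool"
  for C M where
  zero: "is_zero_object C Z \<Longrightarrow> resolved C M 0 Z"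
| step: "\<lbrakk>resolved C M k K; conflation C K f N g E; N \<in> M\<rbrakk> \<Longrightarrow> resolved C M (Suc k) E"

context exact_category
begin

text \<open>\<open>Filt\<close> demands at least one step. A zero object is therefore given the
  identity as its filtration, whose cokernel is zero and has to lie in \<open>S\<close>.\<close>

lemma Filt_if_filtered:
  assumes zero: "\<And>Z. is_zero_object C Z \<Longrightarrow> Z \<in> S"
  shows "filtered C S G \<Longrightarrow> G \<in> Filt C S"
proof (induction rule: filtered.induct)
  case (zero Z)
  then have Z: "Z \<in> obj C" by (simp add: is_zero_object_def)
  obtain T where T: "conflation C Z (ident C Z) Z (zero_arr C Z T) T" "T \<in> obj C"
    using ex_conflation_ident[OF Z] .
  have "ident C T = zero_arr C T T"
    by (rule conflation_epi[OF T(1)]) (use Z T(2) in \<open>simp_all add: mem_Hom\<close>)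
  then have "T \<in> S" using assms is_zero_objectI T(2) by blast
  then show ?case
    unfolding Filt_def mem_Collect_eq using conflationD[OF T(1)] zero
    by (intro conjI exI[of _ "0::nat"] exI[of _ "\<lambda>_::nat. Z"] exI[of _ "\<lambda>_::nat. ident C Z"])
      (auto intro!: exI[of _ "zero_arr C Z T"])
next
  case (step Y f G g T)
  note c = conflationD[OF step(2)]
  from step.IH obtain k X h where X: "is_zero_object C (X 0)" "X (Suc k) = Y"
    "\<And>i. i \<le> k \<Longrightarrow> h i \<in> Hom C (X i) (X (Suc i)) \<and> inflation C (h i) \<and>
        (\<exists>c. is_cokernel C c (h i) \<and> tgt C c \<in> S)"
    unfolding Filt_def by blast
  let ?X = "X(Suc (Suc k) := G)" and ?h = "h(Suc k := f)"
  have "?h i \<in> Hom C (?X i) (?X (Suc i)) \<and> inflation C (?h i) \<and>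
        (\<exists>c. is_cokernel C c (?h i) \<and> tgt C c \<in> S)" if "i \<le> Suc k" for i
  proof (cases "i = Suc k")
    case True
    then show ?thesis using c step(3) X(2) by auto
  next
    case False
    then have "i \<le> k" using that by simp
    then show ?thesis using X(3)[of i] by simp
  qed
  moreover have "is_zero_object C (?X 0)" "?X (Suc (Suc k)) = G" using X(1) by simp_all
  ultimately show ?case unfolding Filt_def using c(9) by blast
qed

lemma filtered_rel_member: "T \<in> S \<Longrightarrow> filtered_rel C S T"
  unfolding filtered_rel_def by (blast intro: filtered.step)

lemma conflation_comp_pullback:
  assumes "conflation C D q N j A" "conflation C L r I w N" "conflation C L t P c D"
    "s \<in> Hom C P I" "w \<cdot> s = q \<cdot> c" "s \<cdot> t = r"
  shows "conflation C P s I (j \<cdot> w) A"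
  using exact_category.conflation_comp_pushout[OF exact_op, unfolded op_cat_defs op_cat_simps,
      OF assms] .

text \<open>The preimage \<open>P\<close> of \<open>Z\<close> in \<open>G\<close> refines
  \<open>Y \<rightarrow> G\<close> to \<open>Y \<rightarrow> P \<rightarrow> G\<close>, with
  cokernels \<open>Z\<close> and \<open>T\<close>.\<close>

lemma filtered_rel_extension:
  assumes c: "conflation C Z a T' b T" and Z: "Z \<in> S" and T: "filtered_rel C S T"
  shows "filtered_rel C S T'"
  unfolding filtered_rel_def
proof (intro allI impI, elim conjE)
  fix Y f G g assume g: "conflation C Y f G g T'" and Y: "filtered C S Y"
  obtain t P d s where P: "conflation C Y t P d Z" "s \<in> Hom C P G" "g \<cdot> s = a \<cdot> d" "s \<cdot> t = f"
    using ex_pullback[OF g conflationD(14)[OF c]] by metis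
  have "conflation C P s G (b \<cdot> g) T" by (rule conflation_comp_pullback[OF c g P])
  moreover have "filtered C S P" using filtered.step[OF Y P(1) Z] .
  ultimately show "filtered C S G" using T unfolding filtered_rel_def by blast
qed

lemma filtered_if_filtered_rel:
  assumes "filtered_rel C S T" "T \<in> obj C"
  shows "filtered C S T"
  using ex_conflation_zero[OF assms(2)] assms(1) filtered.zero unfolding filtered_rel_def by metis

lemma cluster_tilting_op:
  assumes "cluster_tilting C d M"
  shows "cluster_tilting (op_cat C) d M"
proof -
  note M = assms[unfolded cluster_tilting_def]
  from M have sub: "subcategory C M" by blast
  \<comment> \<open>\<open>subcategory\<close> transports membership from source to target; the dual
    direction goes through the inverse.\<close>
  have "src C f \<in> M" if f: "is_iso C f" "tgt C f \<in> M" for f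
  proof -
    have "f \<in> Hom C (src C f) (tgt C f)" using f(1) by (simp add: is_iso_def mem_Hom)
    then obtain g where "g \<in> Hom C (tgt C f) (src C f)" "is_iso C g"
      using is_isoE[OF f(1)] by metis
    then show ?thesis using sub f(2) unfolding subcategory_def mem_Hom by metis
  qed
  then have "subcategory (op_cat C) M"
    using sub unfolding subcategory_def op_cat_simps op_cat_defs by blast
  moreover have "generating (op_cat C) M = cogenerating C M"
    "cogenerating (op_cat C) M = generating C M"
    by (simp_all add: generating_def cogenerating_def op_cat_simps op_cat_defs conj_commute)
  moreover have "contravariantly_finite (op_cat C) M = covariantly_finite C M"
    "covariantly_finite (op_cat C) M = contravariantly_finite C M"
    by (simp_all add: contravariantly_finite_def covariantly_finite_def op_cat_simps)
  ultimately have "cluster_tilting (op_cat C) d M \<longleftrightarrow> cluster_tilting C d M"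
    using sub unfolding cluster_tilting_def functorially_finite_def op_cat_simps Ext_vanishes_op
    by (simp only:) argo
  then show ?thesis using assms by blast
qed

end

section \<open>Approximations, resolutions and the inductive decomposition\<close>

locale cluster_tilting_category = exact_category C
  for C :: "('o, 'm, 'x) exact_cat_scheme" (structure) +
  fixes d :: nat and M :: "'o set"
  assumes cluster_tilting: "cluster_tilting C d M" and d: "d \<ge> 2"
begin

lemma M_obj: "X \<in> M \<Longrightarrow> X \<in> obj C"
  using cluster_tilting unfolding cluster_tilting_def subcategory_def by blast

lemma M_zero: "is_zero_object C Z \<Longrightarrow> Z \<in> M"
  using cluster_tilting unfolding cluster_tilting_def subcategory_def by blast

lemma M_sum: "\<lbrakk>A \<in> M; B \<in> M; is_direct_sum C A B S\<rbrakk> \<Longrightarrow> S \<in> M"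
  using cluster_tilting unfolding cluster_tilting_def subcategory_def by blast

lemma M_iso: "\<lbrakk>is_iso C f; src C f \<in> M\<rbrakk> \<Longrightarrow> tgt C f \<in> M"
  using cluster_tilting unfolding cluster_tilting_def subcategory_def by blast

lemma M_eq: "M = {E \<in> obj C. \<forall>i. 0 < i \<and> i < d \<longrightarrow> (\<forall>X \<in> M. Ext_vanishes C i X E)}"
  using cluster_tilting unfolding cluster_tilting_def by blast

lemma M_cogenerating: "cogenerating C M"
  using cluster_tilting unfolding cluster_tilting_def by blast

lemma M_covariantly_finite: "covariantly_finite C M"
  using cluster_tilting unfolding cluster_tilting_def functorially_finite_def by blast

lemma M_Ext: "\<lbrakk>X \<in> M; Y \<in> M; 0 < i; i < d\<rbrakk> \<Longrightarrow> Ext_vanishes C i X Y"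
  using M_eq by blast

lemma M_if_Ext_vanishes:
  "\<lbrakk>E \<in> obj C; \<And>i X. \<lbrakk>0 < i; i < d; X \<in> M\<rbrakk> \<Longrightarrow> Ext_vanishes C i X E\<rbrakk> \<Longrightarrow> E \<in> M"
  using M_eq by blast

lemma M_cokernel_zero:
  assumes "conflation C Z f N g E" "is_zero_object C Z" "N \<in> M"
  shows "E \<in> M"
  using M_iso[OF conflation_zero_iso[OF assms(1,2)]] conflationD[OF assms(1)] assms(3) by simp

text \<open>The approximation \<open>f\<close> from covariant finiteness is paired with an inflation
  \<open>i\<close> into \<open>M\<close>. The map to \<open>N \<oplus> X\<close> is an inflation by
  \<open>pushout_biproduct\<close>, and it remains an approximation because \<open>f\<close> is one
  of its components.\<close>

lemma ex_left_approximation: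
  assumes E: "E \<in> obj C"
  obtains g N q D where "conflation C E g N q D" "N \<in> M"
    "\<And>Y a. \<lbrakk>Y \<in> M; a \<in> Hom C E Y\<rbrakk> \<Longrightarrow> \<exists>a' \<in> Hom C N Y. a' \<cdot> g = a"
proof -
  obtain X f where X: "X \<in> M" "f \<in> Hom C E X"
    and approx: "\<And>Y a. \<lbrakk>Y \<in> M; a \<in> Hom C E Y\<rbrakk> \<Longrightarrow> \<exists>h \<in> Hom C X Y. h \<cdot> f = a"
    using M_covariantly_finite E unfolding covariantly_finite_def by metis
  obtain i where i: "inflation C i" "src C i = E" "tgt C i \<in> M"
    using M_cogenerating E unfolding cogenerating_def by blast
  obtain N p D where "conflation C (src C i) i N p D" using inflationE[OF i(1)] .
  then have c: "conflation C E i N p D" and N: "N \<in> M" using i conflationD(3) by auto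
  obtain i' P p' b where P: "conflation C X i' P p' D" "b \<in> Hom C N P" "b \<cdot> i = i' \<cdot> f" "p' \<cdot> b = p"
    using ex_pushout[OF c X(2)] by metis
  obtain Q k r n x where Q: "conflation C E k Q r P" "is_direct_sum C N X Q"
    "x \<in> Hom C Q X" "x \<cdot> k = f"
    using pushout_biproduct[OF c P(1) X(2) P(2,3,4)] by metis
  show ?thesis
  proof (rule that[OF Q(1) M_sum[OF N X(1) Q(2)]])
    fix Y a assume "Y \<in> M" "a \<in> Hom C E Y"
    then obtain h where h: "h \<in> Hom C X Y" "h \<cdot> f = a" using approx by blast
    have "h \<cdot> x \<in> Hom C Q Y" "h \<cdot> x \<cdot> k = a"
      using h Q(3,4) conflationD(1-6)[OF Q(1)] by (simp_all add: mem_Hom)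
    then show "\<exists>a' \<in> Hom C Q Y. a' \<cdot> k = a" by blast
  qed
qed

lemma cluster_tilting_category_op: "cluster_tilting_category (op_cat C) d M"
  using exact_op cluster_tilting_op[OF cluster_tilting] d
  by (simp add: cluster_tilting_category_def cluster_tilting_category_axioms_def)

lemma ex_right_approximation:
  assumes E: "E \<in> obj C"
  obtains K q N g where "conflation C K q N g E" "N \<in> M"
    "\<And>Y a. \<lbrakk>Y \<in> M; a \<in> Hom C Y E\<rbrakk> \<Longrightarrow> \<exists>a' \<in> Hom C Y N. g \<cdot> a' = a"
  using cluster_tilting_category.ex_left_approximation[OF cluster_tilting_category_op,
      unfolded op_cat_defs op_cat_simps, OF E] by metis

lemma resolved_M: "E \<in> M \<Longrightarrow> resolved C M (Suc 0) E"
  using ex_conflation_zero[OF M_obj] resolved.intros by metis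

lemma M_if_resolved: "resolved C M (Suc 0) E \<Longrightarrow> E \<in> M"
  by (erule resolved.cases) (auto elim!: resolved.cases[of _ _ 0] intro: M_cokernel_zero)

text \<open>For the kernel \<open>K\<close>, the lifting property gives
  \<open>Ext^1(X,K) = 0\<close>, and the higher degrees are shifted from \<open>E\<close>. The bound
  \<open>d - j\<close> is \<open>d\<close> at \<open>j = 0\<close>, where vanishing is the criterion
  for membership in \<open>M\<close>, and 1 at \<open>j = d - 1\<close>, where every object
  qualifies.\<close>

lemma resolved_if_Ext_vanishes:
  "\<lbrakk>j < d; E \<in> obj C; \<And>i X. \<lbrakk>0 < i; i < d - j; X \<in> M\<rbrakk> \<Longrightarrow> Ext_vanishes C i X E\<rbrakk>
    \<Longrightarrow> resolved C M (Suc j) E"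
proof (induction j arbitrary: E)
  case 0
  then show ?case using resolved_M M_if_Ext_vanishes by simp
next
  case (Suc j)
  obtain K q N g where K: "conflation C K q N g E" "N \<in> M"
    "\<And>Y a. \<lbrakk>Y \<in> M; a \<in> Hom C Y E\<rbrakk> \<Longrightarrow> \<exists>a' \<in> Hom C Y N. g \<cdot> a' = a"
    using ex_right_approximation[OF Suc.prems(2)] by metis
  have "resolved C M (Suc j) K"
  proof (rule Suc.IH)
    fix i X assume i: "0 < i" "i < d - j" and X: "X \<in> M"
    show "Ext_vanishes C i X K"
    proof (cases "i = 1")
      case True
      show ?thesis unfolding True
        using Ext1_vanishes_quotient_op[OF K(1)] M_Ext[OF X K(2)] K(3)[OF X] M_obj[OF X] d by simp
    next
      case False
      then obtain i' where i': "i = Suc i'" "0 < i'" using i(1) by (cases i) auto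
      show ?thesis unfolding i'(1)
        using Ext_vanishes_quotient_op[OF K(1) _ _ i'(2) M_obj[OF X]] M_Ext[OF X K(2), of i]
          Suc.prems(3)[of i' X] X i i' by simp
    qed
  qed (use Suc.prems conflationD[OF K(1)] in auto)
  from resolved.step[OF this K(1,2)] show ?case .
qed

lemma resolved_obj_M: "E \<in> obj C \<Longrightarrow> resolved C M d E"
  using resolved_if_Ext_vanishes[of "d - 1" E] d by (simp add: Suc_diff_le)

text \<open>
  The index of \<^const>\<open>resolved\<close> counts the terms of the resolution, so \<open>E\<close> has a resolution of
  length \<open>k + 1\<close>. Here \<open>Z\<close> is, up to a summand in \<open>M\<close>, the last cokernel of the iterated left
  approximation that starts from the leftmost map of this resolution.
\<close>

lemma resolved_decompose:
  "\<lbrakk>Suc k < d; resolved C M (Suc (Suc k)) E\<rbrakk> \<Longrightarrow>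
    \<exists>W a Z b. conflation C W a Z b E \<and> Z \<in> Ext_perp C M (Suc k) (d - Suc k) \<and> resolved C M k W"
proof (induction k arbitrary: E)
  case 0
  from 0(2) obtain K f N g where K: "resolved C M (Suc 0) K" "conflation C K f N g E" "N \<in> M"
    by (cases rule: resolved.cases) auto
  note KM = M_if_resolved[OF K(1)]
  \<comment> \<open>For \<open>k = 0\<close> take \<open>Z = E\<close> and \<open>W = 0\<close>. The
    first condition of the perpendicular class is empty; the second is shifted from
    \<open>Ext^(j+1)(X,K)\<close>, which needs \<open>j + 1 < d\<close>.\<close>
  have "Ext_vanishes C j X E" if "0 < j" "j < d - 1" "X \<in> M" for j X
    using Ext_vanishes_sub_op[OF K(2) _ _ that(1) M_obj[OF that(3)]] M_Ext[OF that(3) KM]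
      M_Ext[OF that(3) K(3)] that by simp
  then have "E \<in> Ext_perp C M (Suc 0) (d - Suc 0)"
    using conflationD(10)[OF K(2)] by (simp add: Ext_perp_def)
  then show ?case
    using ex_conflation_zero[OF conflationD(10)[OF K(2)]] resolved.zero by metis
next
  case (Suc k)
  from Suc.prems(2) obtain K \<kappa> N e where K: "resolved C M (Suc (Suc k)) K"
    "conflation C K \<kappa> N e E" "N \<in> M"
    by (cases rule: resolved.cases) auto
  obtain W a Z b where W: "conflation C W a Z b K" "Z \<in> Ext_perp C M (Suc k) (d - Suc k)"
    "resolved C M k W"
    using Suc.IH[OF _ K(1)] Suc.prems(1) by auto
  obtain g N' p D where g: "conflation C Z g N' p D" "N' \<in> M"
    "\<And>Y a. \<lbrakk>Y \<in> M; a \<in> Hom C Z Y\<rbrakk> \<Longrightarrow> \<exists>a' \<in> Hom C N' Y. a' \<cdot> g = a"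
    using ex_left_approximation[OF conflationD(9)[OF W(1)]] by metis
  obtain c P t n where P: "conflation C K c P t D" "n \<in> Hom C N' P" "n \<cdot> g = c \<cdot> b" "t \<cdot> n = p"
    using ex_pushout[OF g(1) conflationD(15)[OF W(1)]] by metis
  \<comment> \<open>\<open>P\<close> is \<open>N'/W\<close>, resolved by one term more than
    \<open>W\<close>; it becomes the kernel in the conflation for \<open>E\<close>.\<close>
  have "conflation C W (g \<cdot> a) N' n P" by (rule conflation_comp_pushout[OF W(1) g(1) P])
  then have resP: "resolved C M (Suc k) P" using resolved.step[OF W(3)] g(2) by blast
  \<comment> \<open>The pushout \<open>V\<close> plays two roles: along \<open>\<kappa>\<close> it
    gives \<open>P \<rightarrow> V \<rightarrow> E\<close>, and it is also the cokernel of
    \<open>Z \<rightarrow> N' \<oplus> N\<close>, through which its Ext groups are computed.\<close>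
  obtain c' V t' m where V: "conflation C N c' V t' D" "m \<in> Hom C P V" "m \<cdot> c = c' \<cdot> \<kappa>"
    "t' \<cdot> m = t"
    using ex_pushout[OF P(1) conflationD(14)[OF K(2)]] by metis
  obtain q' where q': "conflation C P m V q' E"
    using pushout_symmetric[OF P(1) K(2) V] .
  note [simp] = conflationD(1-10)[OF W(1)] conflationD(1-10)[OF K(2)] conflationD(1-10)[OF g(1)]
    conflationD(1-10)[OF P(1)] conflationD(1-10)[OF V(1)] P(2)[unfolded mem_Hom]
    V(2)[unfolded mem_Hom]
  have "\<kappa> \<cdot> b \<in> Hom C Z N" "m \<cdot> n \<in> Hom C N' V" by (simp_all add: mem_Hom)
  moreover have "m \<cdot> n \<cdot> g = c' \<cdot> (\<kappa> \<cdot> b)" by (simp add: P(3) comp_reassoc[OF V(3)])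
  moreover have "t' \<cdot> (m \<cdot> n) = p" by (simp add: P(4) comp_reassoc[OF V(4)])
  ultimately obtain Q k' r n' where Q: "conflation C Z k' Q r V" "is_direct_sum C N' N Q"
    "n' \<in> Hom C Q N'" "n' \<cdot> k' = g"
    using pushout_biproduct[OF g(1) V(1)] by metis
  have QM: "Q \<in> M" using M_sum[OF g(2) K(3) Q(2)] .
  \<comment> \<open>The additional component in \<open>N\<close> does no harm: maps from
    \<open>Z\<close> to \<open>M\<close> extend already along the component
    \<open>g\<close>.\<close>
  have approx: "\<exists>y \<in> Hom C Q Y. y \<cdot> k' = x" if Y: "Y \<in> M" "x \<in> Hom C Z Y" for Y x
  proof -
    obtain y where y: "y \<in> Hom C N' Y" "y \<cdot> g = x" using g(3)[OF Y] by blast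
    have "y \<cdot> n' \<in> Hom C Q Y" "y \<cdot> n' \<cdot> k' = x"
      using y Q(3,4) conflationD(1-6)[OF Q(1)] by (simp_all add: mem_Hom)
    then show ?thesis by blast
  qed
  have Z: "Ext_vanishes C i Z X" if "0 < i" "i < Suc k" "X \<in> M" for i X
    using W(2) that by (simp add: Ext_perp_def)
  have Z': "Ext_vanishes C j X Z" if "0 < j" "j < d - Suc k" "X \<in> M" for j X
    using W(2) that by (simp add: Ext_perp_def)
  \<comment> \<open>Passing from \<open>Z\<close> to the cokernel \<open>V\<close> raises degrees by
    one in the first variable, with degree 1 filled in by the approximation, and costs one degree in
    the second. This is the change from \<open>Suc k\<close> and \<open>d - Suc k\<close> to the
    next pair.\<close>
  have "Ext_vanishes C i V X" if i: "0 < i" "i < Suc (Suc k)" and X: "X \<in> M" for i X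
  proof (cases "i = 1")
    case True
    show ?thesis unfolding True
      using Ext1_vanishes_quotient[OF Q(1)] M_Ext[OF QM X] approx[OF X] M_obj[OF X] d by simp
  next
    case False
    then obtain i' where i': "i = Suc i'" "0 < i'" using i(1) by (cases i) auto
    show ?thesis unfolding i'(1)
      using Ext_vanishes_quotient[OF Q(1) _ _ i'(2) M_obj[OF X]] M_Ext[OF QM X, of i]
        Z[of i' X] X i i' Suc.prems(1) by simp
  qed
  moreover have "Ext_vanishes C j X V" if j: "0 < j" "j < d - Suc (Suc k)" and X: "X \<in> M" for j X
    using Ext_vanishes_sub_op[OF Q(1) _ _ j(1) M_obj[OF X]] M_Ext[OF X QM] Z'[of "Suc j" X] j X
    by simp
  ultimately have "V \<in> Ext_perp C M (Suc (Suc k)) (d - Suc (Suc k))"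
    by (simp add: Ext_perp_def)
  then show ?case using q' resP by blast
qed

definition perps :: "'o set" where
  "perps = \<Union>{Ext_perp C M m n | m n. m > 0 \<and> n > 0 \<and> m + n = d}"

lemma perpsI: "\<lbrakk>X \<in> Ext_perp C M m n; m > 0; n > 0; m + n = d\<rbrakk> \<Longrightarrow> X \<in> perps"
  unfolding perps_def by blast

lemma M_perps: "X \<in> M \<Longrightarrow> X \<in> perps"
  using M_obj M_Ext d by (intro perpsI[of X 1 "d - 1"]) (auto simp: Ext_perp_def)

text \<open>The induction hypothesis applies to \<open>P = N/W\<close> only after adding a summand
  \<open>N'\<close>. That summand is carried over to the middle term of
  \<open>Z \<rightarrow> N \<oplus> E \<rightarrow> P\<close> and then merged with
  \<open>N\<close>.\<close>

lemma resolved_filtered_rel: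
  "\<lbrakk>k < d; resolved C M (Suc k) E\<rbrakk>
    \<Longrightarrow> \<exists>N \<in> M. \<exists>S. is_direct_sum C E N S \<and> filtered_rel C perps S"
proof (induction k arbitrary: E)
  case 0
  then have E: "E \<in> M" using M_if_resolved by simp
  then obtain S where S: "is_direct_sum C E E S" using direct_sum_exists M_obj by blast
  then have "S \<in> perps" using M_sum[OF E E] M_perps by blast
  from filtered_rel_member[OF this] S E show ?case by blast
next
  case (Suc k)
  obtain W a Z b where W: "conflation C W a Z b E" "Z \<in> Ext_perp C M (Suc k) (d - Suc k)"
    "resolved C M k W"
    using resolved_decompose Suc.prems by blast
  have Z: "Z \<in> perps" using perpsI[OF W(2)] Suc.prems(1) by simp
  obtain g N p D where g: "conflation C Z g N p D" "N \<in> M"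
    using ex_left_approximation[OF conflationD(9)[OF W(1)]] by metis
  obtain c P t n where P: "conflation C E c P t D" "n \<in> Hom C N P" "n \<cdot> g = c \<cdot> b" "t \<cdot> n = p"
    using ex_pushout[OF g(1) conflationD(15)[OF W(1)]] by metis
  have "conflation C W (g \<cdot> a) N n P" by (rule conflation_comp_pushout[OF W(1) g(1) P])
  then have "resolved C M (Suc k) P" using resolved.step[OF W(3)] g(2) by blast
  then obtain N' T where T: "N' \<in> M" "is_direct_sum C P N' T" "filtered_rel C perps T"
    using Suc.IH Suc.prems(1) by (metis Suc_lessD)
  obtain Q k' r where Q: "conflation C Z k' Q r P" "is_direct_sum C N E Q"
    using pushout_biproduct[OF g(1) P(1) conflationD(15)[OF W(1)] P(2,3,4)] by metis
  obtain G i' r' where G: "conflation C Z i' G r' T" "is_direct_sum C Q N' G"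
    using conflation_add_summand[OF Q(1) T(2)] .
  obtain N'' where N'': "is_direct_sum C N N' N''"
    using direct_sum_exists M_obj g(2) T(1) by blast
  have "is_direct_sum C E N'' G" using direct_sum_assoc[OF Q(2) G(2) N''] .
  moreover have "filtered_rel C perps G" using filtered_rel_extension[OF G(1) Z T(3)] .
  ultimately show ?case using M_sum[OF g(2) T(1) N''] by blast
qed

lemma ex_Filt_summand:
  assumes "E \<in> obj C"
  shows "\<exists>N \<in> M. \<exists>S. is_direct_sum C E N S \<and> S \<in> Filt C perps"
proof -
  obtain N S where S: "N \<in> M" "is_direct_sum C E N S" "filtered_rel C perps S"
    using resolved_filtered_rel[of "d - 1" E] resolved_obj_M[OF assms] d by auto
  then have "filtered C perps S"
    by (intro filtered_if_filtered_rel) (auto simp: is_direct_sum_def)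
  then have "S \<in> Filt C perps" using Filt_if_filtered[of perps S] M_zero M_perps by blast
  then show ?thesis using S by blast
qed

end

theorem lemma6p5:
  fixes \<E> :: "('o, 'm) exact_cat" and \<M> :: "'o set" and d :: nat
  assumes "d \<ge> 2"
    and "exact_category \<E>"
    and "weakly_idempotent_complete \<E>"
    and "cluster_tilting \<E> d \<M>"
  shows "\<forall>E \<in> obj \<E>. \<exists>M \<in> \<M>. \<exists>S. is_direct_sum \<E> E M S \<and>
           S \<in> Filt \<E> (\<Union>{Ext_perp \<E> \<M> m n | m n. m > 0 \<and> n > 0 \<and> m + n = d})"
proof -
  interpret cluster_tilting_category \<E> d \<M>
    using assms by (simp add: cluster_tilting_category_def cluster_tilting_category_axioms_def)
  show ?thesis using ex_Filt_summand unfolding perps_def by blast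
qed

end
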